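(* Let $T>0$, let $\pi$ be any smooth probability density on $\mathbb{R}^d$, and let $K$ be the transition kernel of isotropic-momentum HMC with target $\pi$ and integration time $T$. Let $S\subset\mathbb{R}^d$ be any subset whose topological boundary $\partial S$ is a smooth embedded $(d-1)$-dimensional manifold and which is locally well-behaved. Then $$\Phi(K,S)\le\frac12\,T\,\frac{\int_{\partial S}\pi(q)\,dq}{\pi(S)},$$ where the integral over $\partial S$ is taken with respect to the volume measure on the $(d-1)$-dimensional manifold $\partial S$.
   Context: **Isotropic-momentum HMC** (idealized: Hamilton's equations are solved exactly). Let $H(p,q)=-\log\pi(q)+\frac12\|p\|^2$ on $\mathbb{R}^{2d}$, and let $(p(t),q(t))$ solve Hamilton's equations $\frac{d}{dt}p=-\partial H/\partial q$, $\frac{d}{dt}q=\partial H/\partial p$ with $(p(0),q(0))=(p,q)$. Write $\gamma_{p,q}:\mathbb{R}\to\mathbb{R}^d$, $\gamma_{p,q}(t)=q(t)$. From the current point $q$, the kernel $K$ samples $p\sim\mathcal N(0,\mathrm{Id})$ and moves to $\gamma_{p,q}(T)$. **Conductance.** $\Phi(K,S)=\frac{1}{\pi(S)}\int_S K(x,S^c)\,\pi(x)\,dx$, where $\pi(S)=\int_S\pi$. **Boundary notation.** For $q\in\partial S$, $\eta(q)$ is the unit normal vector of $\partial S$ at $q$ that points away from the interior of $S$. For $x\in\partial S$, $\mathcal T_x$ is the tangent space of $\partial S$ at $x$, viewed as an affine subspace of $\mathbb{R}^d$ based at $x$, and $\mathrm{Proj}_x:\mathbb{R}^d\to\mathcal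 T_x$ is the projection map. **Locally well-behaved.** $S$ is locally well-behaved if for every compact set $A\subset\mathbb{R}^d$ there exist constants $0<\epsilon,C<\infty$ so that (1) for every ball $A'\subset A$ of diameter less than $\epsilon$, the set $A'\cap\partial S$ has a single component; and (2) for every $x,y\in A\cap\partial S$, $\|y-\mathrm{Proj}_x(y)\|\le C\|x-\mathrm{Proj}_x(y)\|^2$ and $\|\eta(x)-\eta(y)\|\le C\|x-y\|$. *)

theory Defs
  imports "HOL-Probability.Probability"
begin

section \<open>Smooth maps and hypersurfaces\<close>

text \<open>
  \<open>Ck_on n S f\<close> is meant for open \<open>S\<close> and a finite-dimensional domain, where it says that \<open>f\<close> is
  of class \<open>C\<^sup>n\<close> on \<open>S\<close>: all iterated directional derivatives up to order \<open>n\<close> exist and are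
  continuous.
\<close>

primrec Ck_on :: "nat \<Rightarrow> 'a::real_normed_vector set \<Rightarrow> ('a \<Rightarrow> 'b::real_normed_vector) \<Rightarrow> bool"
where
  "Ck_on 0 S f \<longleftrightarrow> continuous_on S f"
| "Ck_on (Suc n) S f \<longleftrightarrow>
     (\<forall>x\<in>S. f differentiable (at x)) \<and> (\<forall>v. Ck_on n S (\<lambda>x. frechet_derivative f (at x) v))"

definition smooth_on :: "'a::real_normed_vector set \<Rightarrow> ('a \<Rightarrow> 'b::real_normed_vector) \<Rightarrow> bool"
  where "smooth_on S f \<longleftrightarrow> (\<forall>n. Ck_on n S f)"

text \<open>
  A slice chart is a diffeomorphism \<open>\<phi>\<close> between open sets \<open>U\<close> and \<open>\<phi> ` U\<close> which carries the part
  of the coordinate hyperplane \<open>u $ k = 0\<close> in \<open>U\<close> onto the part of \<open>M\<close> in \<open>\<phi> ` U\<close>. Modelling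
  (d-1)-dimensional parameters by a hyperplane of the ambient space also covers \<open>d = 1\<close>.
\<close>

definition slice_chart ::
    "(real^'n) set \<Rightarrow> 'n::finite \<Rightarrow> (real^'n) set \<Rightarrow> (real^'n \<Rightarrow> real^'n) \<Rightarrow> bool"
  where "slice_chart M k U \<phi> \<longleftrightarrow>
    open U \<and> open (\<phi> ` U) \<and> inj_on \<phi> U \<and>
    smooth_on U \<phi> \<and> smooth_on (\<phi> ` U) (inv_into U \<phi>) \<and>
    \<phi> ` (U \<inter> {u. u $ k = 0}) = \<phi> ` U \<inter> M"

definition embedded_hypersurface :: "(real^'n::finite) set \<Rightarrow> bool"
  where "embedded_hypersurface M \<longleftrightarrow> (\<forall>x\<in>M. \<exists>k U \<phi>. slice_chart M k U \<phi> \<and> x \<in> \<phi> ` U)"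

definition tangent_vectors :: "(real^'n::finite) set \<Rightarrow> real^'n \<Rightarrow> (real^'n) set"
  where "tangent_vectors M x =
    {v. \<exists>c e. 0 < e \<and> smooth_on {-e<..<e} c \<and> c ` {-e<..<e} \<subseteq> M \<and> c (0::real) = x \<and>
      (c has_vector_derivative v) (at 0)}"

definition affine_tangent_space :: "(real^'n::finite) set \<Rightarrow> real^'n \<Rightarrow> (real^'n) set"
  where "affine_tangent_space M x = (\<lambda>v. x + v) ` tangent_vectors M x"

section \<open>Volume measure of a hypersurface\<close>

text \<open>(d-1)-dimensional Lebesgue measure on the hyperplane \<open>u $ k = 0\<close>, as a measure on the ambient space.\<close>

definition hyperplane_measure :: "'n::finite \<Rightarrow> (real^'n) measure"
  where "hyperplane_measure k =
    distr (\<Pi>\<^sub>M i\<in>- {k}. lborel) borel (\<lambda>x. \<chi> i. if i = k then 0 else x i)"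

text \<open>
  \<open>sqrt (det g)\<close>, where \<open>g\<close> is the Gram matrix of the partial derivatives of \<open>\<phi>\<close> in the directions
  other than \<open>k\<close>. To stay within square matrices indexed by \<open>'n\<close>, \<open>g\<close> is bordered with the
  \<open>k\<close>-th row and column of the identity matrix, which leaves the determinant unchanged.
\<close>

definition chart_density :: "'n::finite \<Rightarrow> (real^'n \<Rightarrow> real^'n) \<Rightarrow> real^'n \<Rightarrow> real"
  where "chart_density k \<phi> u = sqrt (det (\<chi> i j.
    if i = k \<or> j = k then (if i = j then 1 else 0)
    else frechet_derivative \<phi> (at u) (axis i 1) \<bullet> frechet_derivative \<phi> (at u) (axis j 1)))"

text \<open>The volume of the part of the hypersurface covered by the slice chart \<open>\<phi>\<close>.\<close>

definition chart_measure :: "'n::finite \<Rightarrow> (real^'n) set \<Rightarrow> (real^'n \<Rightarrow> real^'n) \<Rightarrow> (real^'n) measure"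
  where "chart_measure k U \<phi> =
    distr (density (restrict_space (hyperplane_measure k) U) (\<lambda>u. ennreal (chart_density k \<phi> u)))
      borel \<phi>"

text \<open>
  By the change of variables formula, any two chart measures agree on the overlap of their charts,
  and countably many charts cover an embedded hypersurface \<open>M\<close>. The supremum (in the complete
  lattice of measures) is therefore the Borel measure that vanishes outside \<open>M\<close> and restricts to
  \<open>chart_measure k U \<phi>\<close> on \<open>\<phi> ` U\<close> for every slice chart, i.e. the Riemannian volume measure.
\<close>

definition volume_measure :: "(real^'n::finite) set \<Rightarrow> (real^'n) measure"
  where "volume_measure M =
    (SUP (k, U, \<phi>) \<in> {(k, U, \<phi>). slice_chart M k U \<phi>}. chart_measure k U \<phi>)"

section \<open>Locally well-behaved sets\<close>

text \<open>
  If \<open>interior S\<close> lies locally on exactly one side of \<open>frontier S\<close>, there is exactly one such vector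
  at \<open>q\<close>; if it lies on both sides there is none. Both unit normals qualify where \<open>interior S\<close> is
  locally absent.
\<close>

definition outward_unit_normal :: "(real^'n::finite) set \<Rightarrow> real^'n \<Rightarrow> real^'n \<Rightarrow> bool"
  where "outward_unit_normal S q n \<longleftrightarrow>
    norm n = 1 \<and> (\<forall>v\<in>tangent_vectors (frontier S) q. n \<bullet> v = 0) \<and>
    (\<forall>\<^sub>F t in at_right 0. q + t *\<^sub>R n \<notin> interior S)"

definition locally_well_behaved :: "(real^'n::finite) set \<Rightarrow> bool"
  where "locally_well_behaved S \<longleftrightarrow>
    (\<exists>\<eta>. (\<forall>q\<in>frontier S. outward_unit_normal S q (\<eta> q)) \<and>
      (\<forall>A. compact A \<longrightarrow> (\<exists>\<epsilon> C. 0 < \<epsilon> \<and> 0 < C \<and>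
        (\<forall>c r. ball c r \<subseteq> A \<and> diameter (ball c r) < \<epsilon> \<longrightarrow> connected (ball c r \<inter> frontier S)) \<and>
        (\<forall>x\<in>A \<inter> frontier S. \<forall>y\<in>A \<inter> frontier S.
          (let y' = closest_point (affine_tangent_space (frontier S) x) y
           in norm (y - y') \<le> C * (norm (x - y'))\<^sup>2) \<and>
          norm (\<eta> x - \<eta> y) \<le> C * norm (x - y)))))"

section \<open>Idealized isotropic-momentum HMC\<close>

definition smooth_probability_density :: "(real^'n::finite \<Rightarrow> real) \<Rightarrow> bool"
  where "smooth_probability_density \<pi> \<longleftrightarrow>
    smooth_on UNIV \<pi> \<and> (\<forall>x. 0 \<le> \<pi> x) \<and> (\<integral>\<^sup>+x. ennreal (\<pi> x) \<partial>lebesgue) = 1"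

definition hamiltonian :: "(real^'n::finite \<Rightarrow> real) \<Rightarrow> real^'n \<Rightarrow> real^'n \<Rightarrow> real"
  where "hamiltonian \<pi> p q = - ln (\<pi> q) + (norm p)\<^sup>2 / 2"

text \<open>
  Solutions of Hamilton's equations over the time interval \<open>[0, T]\<close>; \<open>0 < \<pi> (Q t)\<close> says that the
  trajectory stays where the Hamiltonian is defined, and is vacuous for positive \<open>\<pi>\<close>.
\<close>

definition hamilton_solution ::
    "(real^'n::finite \<Rightarrow> real) \<Rightarrow> real \<Rightarrow> (real \<Rightarrow> real^'n) \<Rightarrow> (real \<Rightarrow> real^'n) \<Rightarrow> bool"
  where "hamilton_solution \<pi> T P Q \<longleftrightarrow>
    (\<forall>t\<in>{0..T}. 0 < \<pi> (Q t) \<and>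
      (\<exists>a b. GDERIV (\<lambda>q. hamiltonian \<pi> (P t) q) (Q t) :> a \<and>
             GDERIV (\<lambda>p. hamiltonian \<pi> p (Q t)) (P t) :> b \<and>
             (P has_vector_derivative - a) (at t within {0..T}) \<and>
             (Q has_vector_derivative b) (at t within {0..T})))"

text \<open>The law \<open>N(0, Id)\<close>, completed so that it also measures Lebesgue sets that are not Borel.\<close>

definition std_gaussian :: "(real^'n::finite) measure"
  where "std_gaussian = density lebesgue (\<lambda>p. \<Prod>i\<in>UNIV. ennreal (std_normal_density (p $ i)))"

text \<open>
  \<open>hmc_kernel \<pi> T x A\<close> is the probability that the trajectory started at \<open>x\<close> with a Gaussian
  momentum \<open>p\<close> is in \<open>A\<close> at time \<open>T\<close>. The solution with given initial values is unique because
  \<open>ln \<circ> \<pi>\<close> is smooth where \<open>\<pi> > 0\<close>. Global existence is not presupposed: momenta whose trajectory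
  blows up before time \<open>T\<close> contribute to no set \<open>A\<close>.
\<close>

definition hmc_kernel ::
    "(real^'n::finite \<Rightarrow> real) \<Rightarrow> real \<Rightarrow> real^'n \<Rightarrow> (real^'n) set \<Rightarrow> ennreal"
  where "hmc_kernel \<pi> T x A =
    emeasure std_gaussian {p. \<exists>P Q. hamilton_solution \<pi> T P Q \<and> P 0 = p \<and> Q 0 = x \<and> Q T \<in> A}"

text \<open>
  Integrals take values in the extended nonnegative reals and are over \<open>lebesgue\<close>, because a set
  with smooth frontier is Lebesgue measurable but not necessarily Borel.
\<close>

definition density_mass :: "(real^'n::finite \<Rightarrow> real) \<Rightarrow> (real^'n) set \<Rightarrow> ennreal"
  where "density_mass \<pi> S = (\<integral>\<^sup>+x\<in>S. ennreal (\<pi> x) \<partial>lebesgue)"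

definition conductance ::
    "(real^'n::finite \<Rightarrow> real) \<Rightarrow> (real^'n \<Rightarrow> (real^'n) set \<Rightarrow> ennreal) \<Rightarrow> (real^'n) set \<Rightarrow> ennreal"
  where "conductance \<pi> K S =
    (\<integral>\<^sup>+x\<in>S. (K x (- S) * ennreal (\<pi> x)) \<partial>lebesgue) / density_mass \<pi> S"

end

theory Submission
  imports Defs
begin

text \<open>
  Let \<open>R = interior (closure S)\<close>, and follow the trajectories by the symplectic Euler scheme with step
  \<open>h = T / N\<close>. It alternates straight drifts \<open>q \<mapsto> q + h p\<close> with kicks of the momentum, so it preserves
  Lebesgue measure exactly, and along a given trajectory it converges to the exact solution, whose
  energy is constant. Hence a trajectory that ends outside \<open>S\<close> is, for large \<open>N\<close>, followed by a
  discrete path that leaves \<open>R\<close> during one of the \<open>N\<close> drifts and along which the phase space density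
  has decreased by at most a factor close to 1. By measure preservation and Fatou's lemma it suffices
  to bound the mass of the points that leave \<open>R\<close> during one drift by \<open>h / 2\<close> times the boundary mass.

  For fixed momentum \<open>p\<close> these points are of the form \<open>y - s p\<close> with \<open>y\<close> on the boundary, \<open>0 \<le> s \<le> h\<close> and
  \<open>p\<close> pointing outward at \<open>y\<close>. The Jacobian of \<open>(y, s) \<mapsto> y - s p\<close> is the normal component of \<open>p\<close>,
  and the positive part of a standard normal variable has mean at most \<open>1 / 2\<close>.
\<close>

text \<open>Exact trajectories may blow up in finite time, so no globally defined measure-preserving
  flow is at hand. Each Euler map, by contrast, is defined on the whole phase space, and only
  convergence along a single given trajectory is required.

  Two losses have to disappear in the end. A trajectory may end on \<open>frontier S\<close>, where
  a nearby discrete endpoint can still lie in \<open>R\<close>; such endpoints are charged to an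
  open neighbourhood \<open>V\<close> of the frontier, whose mass can be made small because the
  frontier is a null set. The discrete path follows the density only up to a factor
  \<open>c > 1\<close>. First \<open>N\<close> tends to infinity for fixed \<open>c\<close> and
  \<open>V\<close>, then \<open>c\<close> tends to 1 and \<open>V\<close> shrinks.

  The constant 1/2 depends on counting outward momenta only: the mean of the modulus of a standard
  normal variable exceeds 1/2. Since \<open>interior S\<close> may lie on both sides of a piece of
  its frontier, it is replaced by \<open>R\<close>, which fills such slits.\<close>

section \<open>Images of measurable sets under differentiable maps\<close>

text \<open>
  The change of variables results of \<open>HOL-Analysis\<close> require the index type to be well-ordered. They are
  transferred to arbitrary finite index types along a well-ordered copy.
\<close>

typedef 'a ordered_copy = "UNIV :: 'a set"
  morphisms of_copy to_copy by simp

lemma bij_of_copy: "bij of_copy"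
  by (metis UNIV_I bijI' of_copy_inject to_copy_inverse)

instance ordered_copy :: (finite) finite
proof
  show "finite (UNIV :: 'a ordered_copy set)"
    using bij_betw_finite[OF bij_of_copy[where ?'a = 'a]] by simp
qed

definition copy_index :: "'a::finite ordered_copy \<Rightarrow> nat"
  where "copy_index = (SOME f. inj f)"

lemma inj_copy_index: "inj copy_index"
  unfolding copy_index_def
  using finite_imp_inj_to_nat_seg[of "UNIV :: 'a ordered_copy set"] by (intro someI_ex[of inj]) auto

instantiation ordered_copy :: (finite) wellorder
begin

definition less_eq_ordered_copy :: "'a ordered_copy \<Rightarrow> 'a ordered_copy \<Rightarrow> bool"
  where "x \<le> y \<longleftrightarrow> copy_index x \<le> copy_index y"

definition less_ordered_copy :: "'a ordered_copy \<Rightarrow> 'a ordered_copy \<Rightarrow> bool"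
  where "x < y \<longleftrightarrow> copy_index x < copy_index y"

instance
proof
  fix P :: "'a ordered_copy \<Rightarrow> bool" and a :: "'a ordered_copy"
  assume "\<And>x. (\<And>y. y < x \<Longrightarrow> P y) \<Longrightarrow> P x"
  then show "P a"
    unfolding less_ordered_copy_def by (rule measure_induct_rule)
qed (auto simp: less_eq_ordered_copy_def less_ordered_copy_def inj_eq[OF inj_copy_index])

end

text \<open>Conjugation by \<open>f\<close> is a bijection between the permutations of the two index
  types and preserves the sign, so the two Leibniz sums agree term by term.\<close>

lemma det_reindex:
  fixes A :: "'a::comm_ring_1^'n^'n" and f :: "'m::finite \<Rightarrow> 'n"
  assumes f: "bij f"
  shows "det (\<chi> i j. A $ f i $ f j) = det A"
proof -
  let ?c = "\<lambda>p x. f (p (inv f x))"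
  have c: "bij_betw ?c {p. p permutes UNIV} {p. p permutes UNIV}"
    using bij_betw_permutations[OF f] by simp
  have "det A = (\<Sum>p | p permutes UNIV. of_int (sign (?c p)) * (\<Prod>i\<in>UNIV. A $ i $ ?c p i))"
    unfolding det_def by (rule sum.reindex_bij_betw[OF c, symmetric])
  also have "\<dots> = (\<Sum>p | p permutes UNIV. of_int (sign p) * (\<Prod>i\<in>UNIV. A $ f i $ f (p i)))"
  proof (rule sum.cong[OF refl], clarify)
    fix p :: "'m \<Rightarrow> 'm" assume p: "p permutes UNIV"
    have "permutes_bij_finite p UNIV UNIV f (inv f)"
      by unfold_locales (simp_all add: p f bij_is_inj)
    from permutes_bij_finite.sign_p'[OF this] have "sign (?c p) = sign p" by simp
    moreover have "(\<Prod>i\<in>UNIV. A $ i $ ?c p i) = (\<Prod>i\<in>UNIV. A $ f i $ f (p i))"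
      by (subst prod.reindex_bij_betw[OF f, symmetric]) (simp add: bij_is_inj[OF f])
    ultimately show "of_int (sign (?c p)) * (\<Prod>i\<in>UNIV. A $ i $ ?c p i) =
      of_int (sign p) * (\<Prod>i\<in>UNIV. A $ f i $ f (p i))" by (simp only:)
  qed
  finally show ?thesis unfolding det_def by simp
qed

text \<open>The real-valued area inequality presupposes an integrable Jacobian determinant;
  otherwise the right-hand side is infinite. Overlaps of the image are counted once on the left,
  hence an inequality.\<close>

lemma emeasure_image_le_wellorder:
  fixes f :: "real^'n::{finite,wellorder} \<Rightarrow> real^'n::_"
  assumes S: "S \<in> sets lebesgue"
    and deriv: "\<And>x. x \<in> S \<Longrightarrow> (f has_derivative f' x) (at x within S)"
  shows "f ` S \<in> sets lebesgue"
    "emeasure lebesgue (f ` S) \<le> (\<integral>\<^sup>+x\<in>S. ennreal \<bar>det (matrix (f' x))\<bar> \<partial>lebesgue)"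
proof -
  show "f ` S \<in> sets lebesgue"
    using S deriv by (intro differentiable_image_in_sets_lebesgue) (auto simp: differentiable_on_def differentiable_def)
  let ?J = "\<lambda>x. \<bar>det (matrix (f' x))\<bar>"
  let ?I = "\<integral>\<^sup>+x\<in>S. ennreal (?J x) \<partial>lebesgue"
  have m: "(\<lambda>x. ?J x) \<in> borel_measurable (lebesgue_on S)"
    using borel_measurable_det_Jacobian[OF S deriv] by measurable
  show "emeasure lebesgue (f ` S) \<le> ?I"
  proof (cases "?I = \<infinity>")
    case False
    have I: "?I = (\<integral>\<^sup>+x. ennreal (?J x) \<partial>lebesgue_on S)"
      using S by (subst nn_integral_restrict_space) auto
    have int: "integrable (lebesgue_on S) ?J"
      using m False I by (intro integrableI_bounded) (auto simp: top.not_eq_extremum)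
    have "?J absolutely_integrable_on S"
      using int S by (simp add: integrable_restrict_space set_integrable_def)
    then have io: "?J integrable_on S" and "integral S ?J = integral\<^sup>L (lebesgue_on S) ?J"
      using S by (auto simp: set_lebesgue_integral_eq_integral(1) integral_restrict_space
          set_lebesgue_integral_eq_integral(2)[symmetric] set_lebesgue_integral_def)
    moreover have "?I = ennreal (integral\<^sup>L (lebesgue_on S) ?J)"
      unfolding I using int by (intro nn_integral_eq_integral) auto
    moreover have "f ` S \<in> lmeasurable" "measure lebesgue (f ` S) \<le> integral S ?J"
      using measurable_differentiable_image[OF S deriv io] measure_differentiable_image[OF S deriv io] by auto
    ultimately show ?thesis
      by (simp add: emeasure_eq_measure2)
  qed simp
qed

lemma prod_Basis_vec:
  fixes f :: "real^'n::finite \<Rightarrow> 'a::comm_monoid_mult"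
  shows "prod f Basis = (\<Prod>i\<in>UNIV. f (axis i 1))"
proof -
  have B: "(Basis :: (real^'n) set) = (\<lambda>i. axis i 1) ` UNIV"
    by (auto simp: Basis_vec_def)
  have inj: "inj (\<lambda>i. axis i (1::real) :: real^'n)"
    by (simp add: inj_on_def axis_eq_axis)
  show ?thesis
    unfolding B by (subst prod.reindex[OF inj]) (simp add: o_def)
qed

lemma lborel_reindex:
  fixes f :: "'m::finite \<Rightarrow> 'n::finite"
  assumes f: "bij f"
  shows "distr lborel borel (\<lambda>x :: real^'n. \<chi> i. x $ f i) = (lborel :: (real^'m) measure)"
proof (rule lborel_eqI[symmetric])
  let ?L = "\<lambda>x :: real^'n. (\<chi> i. x $ f i) :: real^'m"
  let ?L' = "\<lambda>x :: real^'m. (\<chi> i. x $ inv f i) :: real^'n"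
  have [measurable]: "?L \<in> borel_measurable borel"
    by (intro borel_measurable_continuous_onI continuous_intros)
  fix l u :: "real^'m" assume "\<And>b. b \<in> Basis \<Longrightarrow> l \<bullet> b \<le> u \<bullet> b"
  from this[of "axis i 1" for i] have le: "l $ i \<le> u $ i" for i
    by (simp add: inner_axis)
  have "?L -` box l u = box (?L' l) (?L' u)"
    by (auto simp: mem_box_cart) (metis f bij_inv_eq_iff)+
  then have "emeasure (distr lborel borel ?L) (box l u) = emeasure lborel (box (?L' l) (?L' u))"
    by (simp add: emeasure_distr)
  also have "\<dots> = (\<Prod>b\<in>Basis. (?L' u - ?L' l) \<bullet> b)"
    using le by (intro emeasure_lborel_box) (auto simp: Basis_vec_def inner_axis)
  also have "(\<Prod>b\<in>Basis. (?L' u - ?L' l) \<bullet> b) = (\<Prod>i\<in>UNIV. u $ inv f i - l $ inv f i)"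
    by (simp add: prod_Basis_vec inner_axis)
  also have "\<dots> = (\<Prod>i\<in>UNIV. u $ i - l $ i)"
    using prod.reindex_bij_betw[OF bij_imp_bij_inv[OF f], of "\<lambda>i. u $ i - l $ i"] by simp
  also have "\<dots> = (\<Prod>b\<in>Basis. (u - l) \<bullet> b)"
    by (simp add: prod_Basis_vec inner_axis)
  finally show "emeasure (distr lborel borel ?L) (box l u) = (\<Prod>b\<in>Basis. (u - l) \<bullet> b)" by simp
qed simp

lemma lebesgue_reindex:
  fixes f :: "'m::finite \<Rightarrow> 'n::finite"
  assumes f: "bij f"
  shows "(\<lambda>x :: real^'n. (\<chi> i. x $ f i) :: real^'m) \<in> lebesgue \<rightarrow>\<^sub>M lebesgue" (is "?L \<in> _")
    and "distr lebesgue lebesgue (\<lambda>x :: real^'n. \<chi> i. x $ f i) = (lebesgue :: (real^'m) measure)"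
proof -
  have [measurable]: "?L \<in> borel_measurable borel"
    by (intro borel_measurable_continuous_onI continuous_intros)
  have m: "?L \<in> lebesgue \<rightarrow>\<^sub>M lborel"
    by (simp add: measurable_completion)
  have eq: "distr lebesgue lborel ?L = lborel"
    using lborel_reindex[OF f] by (simp add: distr_completion cong: distr_cong)
  then show "?L \<in> lebesgue \<rightarrow>\<^sub>M lebesgue"
    by (intro completion.measurable_completion2 m) simp
  show "distr lebesgue lebesgue ?L = lebesgue"
    using completion.completion_distr_eq[OF m] eq by simp
qed

lemma emeasure_image_le:
  fixes f :: "real^'n::finite \<Rightarrow> real^'n"
  assumes S: "S \<in> sets lebesgue"
    and deriv: "\<And>x. x \<in> S \<Longrightarrow> (f has_derivative f' x) (at x within S)"
    and meas: "(\<lambda>x. \<bar>det (matrix (f' x))\<bar> * indicator S x) \<in> borel_measurable lebesgue"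
  shows "f ` S \<in> sets lebesgue"
    "emeasure lebesgue (f ` S) \<le> (\<integral>\<^sup>+x\<in>S. ennreal \<bar>det (matrix (f' x))\<bar> \<partial>lebesgue)"
proof -
  show fS: "f ` S \<in> sets lebesgue"
    using S deriv by (intro differentiable_image_in_sets_lebesgue) (auto simp: differentiable_on_def differentiable_def)
  let ?o = "of_copy :: 'n ordered_copy \<Rightarrow> 'n"
  define L where "L = (\<lambda>x :: real^'n. (\<chi> i. x $ ?o i) :: real^'n ordered_copy)"
  define L' where "L' = (\<lambda>x :: real^'n ordered_copy. (\<chi> i. x $ inv ?o i) :: real^'n)"
  note bij = bij_of_copy[where ?'a = 'n]
  have LL: "L (L' x) = x" "L' (L y) = y" for x y
    using bij by (auto simp: L_def L'_def vec_eq_iff bij_is_inj bij_is_surj surj_f_inv_f)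
  have L: "L \<in> lebesgue \<rightarrow>\<^sub>M lebesgue" "distr lebesgue lebesgue L = lebesgue"
    using lebesgue_reindex[OF bij] by (auto simp: L_def)
  have L': "L' \<in> lebesgue \<rightarrow>\<^sub>M lebesgue" "distr lebesgue lebesgue L' = lebesgue"
    using lebesgue_reindex[OF bij_imp_bij_inv[OF bij]] by (auto simp: L'_def)
  have bl: "bounded_linear L" "bounded_linear L'"
    unfolding L_def L'_def by (auto intro!: linear_conv_bounded_linear[THEN iffD1] simp: linear_iff vec_eq_iff)
  have imL: "L ` X = L' -` X" for X
    by (force simp: LL image_iff)
  \<comment> \<open>Conjugation with the measure-preserving relabelling \<open>L\<close> moves
    \<open>f\<close> to the well-ordered index type; by \<open>det_reindex\<close> the Jacobian
    determinant is unchanged.\<close>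
  define g where "g = (\<lambda>x. L (f (L' x)))"
  define g' where "g' = (\<lambda>x v. L (f' (L' x) (L' v)))"
  have LS: "L ` S \<in> sets lebesgue"
    unfolding imL using measurable_sets[OF L'(1) S] by simp
  have "(g has_derivative g' x) (at x within L ` S)" if x: "x \<in> L ` S" for x
  proof -
    have x': "L' x \<in> S" using x by (auto simp: LL)
    have "(L' has_derivative L') (at x within L ` S)"
      using bl by (simp add: bounded_linear_imp_has_derivative)
    moreover have "(f has_derivative f' (L' x)) (at (L' x) within L' ` (L ` S))"
      using deriv[OF x'] by (simp add: image_image LL)
    ultimately have "((\<lambda>x. f (L' x)) has_derivative (\<lambda>v. f' (L' x) (L' v))) (at x within L ` S)"
      using diff_chain_within[of L' L' x "L ` S" f "f' (L' x)"] by (simp add: o_def)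
    then show ?thesis
      unfolding g_def g'_def by (rule bounded_linear.has_derivative[OF bl(1)])
  qed
  then have *: "emeasure lebesgue (g ` L ` S) \<le> (\<integral>\<^sup>+x\<in>L ` S. ennreal \<bar>det (matrix (g' x))\<bar> \<partial>lebesgue)"
    by (rule emeasure_image_le_wellorder(2)[OF LS])
  have det: "det (matrix (g' x)) = det (matrix (f' (L' x)))" if "x \<in> L ` S" for x
  proof -
    have "L' (axis j 1) = axis (?o j) 1" for j
      using bij by (simp add: L'_def axis_def vec_eq_iff) (metis bij_inv_eq_iff)
    then have "matrix (g' x) = (\<chi> i j. matrix (f' (L' x)) $ ?o i $ ?o j)"
      by (simp only: matrix_def g'_def L_def vec_lambda_beta)
    then show ?thesis
      using det_reindex[OF bij] by simp
  qed
  have im: "L' -` (f ` S) \<inter> space lebesgue = g ` L ` S"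
    unfolding imL[symmetric] g_def by (simp add: image_image LL(2))
  have "emeasure lebesgue (f ` S) = emeasure (distr lebesgue lebesgue L') (f ` S)"
    by (simp only: L'(2))
  also have "\<dots> = emeasure lebesgue (g ` L ` S)"
    unfolding im[symmetric] by (rule emeasure_distr[OF L'(1) fS])
  also have "\<dots> \<le> (\<integral>\<^sup>+x\<in>L ` S. ennreal \<bar>det (matrix (f' (L' x)))\<bar> \<partial>lebesgue)"
    by (rule order.trans[OF *], intro nn_integral_mono) (simp add: det split: split_indicator)
  also have "\<dots> = (\<integral>\<^sup>+x. ennreal (\<bar>det (matrix (f' (L' x)))\<bar> * indicator S (L' x)) \<partial>lebesgue)"
    unfolding imL by (intro nn_integral_cong) (simp split: split_indicator)
  also have "\<dots> = (\<integral>\<^sup>+x. ennreal (\<bar>det (matrix (f' x))\<bar> * indicator S x) \<partial>distr lebesgue lebesgue L')"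
    by (rule nn_integral_distr[symmetric, OF L'(1)]) (simp add: meas)
  also have "\<dots> = (\<integral>\<^sup>+x\<in>S. ennreal \<bar>det (matrix (f' x))\<bar> \<partial>lebesgue)"
    unfolding L'(2) by (intro nn_integral_cong) (simp split: split_indicator)
  finally show "emeasure lebesgue (f ` S) \<le> (\<integral>\<^sup>+x\<in>S. ennreal \<bar>det (matrix (f' x))\<bar> \<partial>lebesgue)" .
qed

text \<open>The area inequality on the preimage of every Borel set amounts to an inequality of
  measures: Lebesgue measure on the image is at most the push-forward of the Jacobian density.
  Integrating \<open>g\<close> against both gives the claim.\<close>

lemma nn_integral_image_le:
  fixes f :: "real^'n::finite \<Rightarrow> real^'n" and g :: "real^'n \<Rightarrow> ennreal"
  assumes S: "S \<in> sets borel"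
    and deriv: "\<And>x. x \<in> S \<Longrightarrow> (f has_derivative f' x) (at x within S)"
    and meas: "(\<lambda>x. \<bar>det (matrix (f' x))\<bar> * indicator S x) \<in> borel_measurable borel"
    and g[measurable]: "g \<in> borel_measurable borel"
  shows "(\<integral>\<^sup>+y\<in>f ` S. g y \<partial>lebesgue) \<le> (\<integral>\<^sup>+x\<in>S. (g (f x) * ennreal \<bar>det (matrix (f' x))\<bar>) \<partial>lborel)"
proof -
  let ?J = "\<lambda>x. \<bar>det (matrix (f' x))\<bar> * indicator S x"
  \<comment> \<open>Extension by 0 gives a Borel map on the whole space, along which the
    push-forward can be formed.\<close>
  define h where "h x = (if x \<in> S then f x else 0)" for x
  have "continuous_on S f"
    using deriv by (meson has_derivative_continuous continuous_on_eq_continuous_within)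
  then have h[measurable]: "h \<in> borel_measurable borel"
    unfolding h_def using S by (intro borel_measurable_continuous_on_if) auto
  note meas[measurable] S[measurable]
  have SL: "B \<in> sets borel \<Longrightarrow> S \<inter> h -` B \<in> sets borel" for B
    using measurable_sets[OF h, of B] by auto
  have image: "f ` (S \<inter> h -` B) = B \<inter> f ` S" for B
    by (auto simp: h_def)
  have fS: "f ` (S \<inter> h -` B) \<in> sets lebesgue"
    and le: "emeasure lebesgue (f ` (S \<inter> h -` B))
      \<le> (\<integral>\<^sup>+x\<in>S \<inter> h -` B. ennreal \<bar>det (matrix (f' x))\<bar> \<partial>lebesgue)" if B: "B \<in> sets borel" for B
  proof -
    have sets: "S \<inter> h -` B \<in> sets lebesgue"
      using SL[OF B] by simp
    have eq: "(\<lambda>x. \<bar>det (matrix (f' x))\<bar> * indicator (S \<inter> h -` B) x) = (\<lambda>x. ?J x * indicator (S \<inter> h -` B) x)"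
      by (auto split: split_indicator)
    have meas': "(\<lambda>x. \<bar>det (matrix (f' x))\<bar> * indicator (S \<inter> h -` B) x) \<in> borel_measurable lebesgue"
      unfolding eq using SL[OF B]
      by (intro measurable_completion) (simp add: borel_measurable_times[OF meas] borel_measurable_indicator)
    show "f ` (S \<inter> h -` B) \<in> sets lebesgue"
      and "emeasure lebesgue (f ` (S \<inter> h -` B))
      \<le> (\<integral>\<^sup>+x\<in>S \<inter> h -` B. ennreal \<bar>det (matrix (f' x))\<bar> \<partial>lebesgue)"
      by (rule emeasure_image_le[OF sets _ meas'], metis IntD1 Int_lower1 deriv has_derivative_subset)+
  qed
  have fS': "f ` S \<in> sets lebesgue"
    using fS[of UNIV] by simp
  let ?N1 = "distr (density lebesgue (indicator (f ` S))) borel (\<lambda>x. x)"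
  let ?N2 = "distr (density lborel (\<lambda>x. ennreal (?J x))) borel h"
  have le': "?N1 \<le> ?N2"
  proof (subst le_measure; (intro ballI)?)
    fix B assume "B \<in> sets ?N1"
    then have B[measurable]: "B \<in> sets borel" by simp
    have "emeasure ?N1 B = emeasure (density lebesgue (indicator (f ` S))) B"
      by (subst emeasure_distr) (auto simp: measurable_completion)
    also have "\<dots> = (\<integral>\<^sup>+x. indicator (f ` S) x * indicator B x \<partial>lebesgue)"
      using fS' by (subst emeasure_density) auto
    also have "\<dots> = (\<integral>\<^sup>+x. indicator (f ` (S \<inter> h -` B)) x \<partial>lebesgue)"
      unfolding image by (intro nn_integral_cong) (simp split: split_indicator)
    also have "\<dots> = emeasure lebesgue (f ` (S \<inter> h -` B))"
      using fS[OF B] by simp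
    also note le[OF B]
    also have "(\<integral>\<^sup>+x\<in>S \<inter> h -` B. ennreal \<bar>det (matrix (f' x))\<bar> \<partial>lebesgue)
      = (\<integral>\<^sup>+x. ennreal (?J x) * indicator (h -` B) x \<partial>lborel)"
      by (subst nn_integral_completion) (intro nn_integral_cong, simp split: split_indicator)
    also have "\<dots> = emeasure (density lborel (\<lambda>x. ennreal (?J x))) (h -` B)"
      using measurable_sets[OF h B] by (subst emeasure_density) auto
    also have "\<dots> = emeasure ?N2 B"
      by (subst emeasure_distr) auto
    finally show "emeasure ?N1 B \<le> emeasure ?N2 B" .
  qed simp
  have "(\<integral>\<^sup>+y\<in>f ` S. g y \<partial>lebesgue) = (\<integral>\<^sup>+y. g y \<partial>density lebesgue (indicator (f ` S)))"
    using fS' by (subst nn_integral_density) (auto simp: mult.commute measurable_completion)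
  also have "\<dots> = nn_integral ?N1 g"
    by (subst nn_integral_distr) (auto simp: measurable_completion)
  also have "\<dots> \<le> nn_integral ?N2 g"
    by (rule nn_integral_mono_measure[OF _ le']) simp
  also have "\<dots> = (\<integral>\<^sup>+x. ennreal (?J x) * g (h x) \<partial>lborel)"
    by (subst nn_integral_distr, simp, simp, subst nn_integral_density) auto
  also have "\<dots> = (\<integral>\<^sup>+x\<in>S. (g (f x) * ennreal \<bar>det (matrix (f' x))\<bar>) \<partial>lborel)"
    by (intro nn_integral_cong) (simp add: h_def mult.commute split: split_indicator)
  finally show ?thesis .
qed

section \<open>Disintegration of Lebesgue measure along a coordinate hyperplane\<close>

lemma borel_measurable_vec_lambda:
  fixes f :: "'a \<Rightarrow> 'n::finite \<Rightarrow> real"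
  assumes "\<And>i. (\<lambda>x. f x i) \<in> borel_measurable M"
  shows "(\<lambda>x. \<chi> i. f x i) \<in> borel_measurable M"
proof (subst borel_measurable_euclidean_space, intro ballI)
  fix b :: "real^'n" assume "b \<in> Basis"
  then obtain i where "b = axis i 1" by (auto simp: Basis_vec_def)
  then show "(\<lambda>x. (\<chi> i. f x i) \<bullet> b) \<in> borel_measurable M"
    using assms[of i] by (simp add: inner_axis)
qed

lemma measurable_vec_PiM [measurable]:
  "(\<lambda>x. \<chi> i. if i = k then (0::real) else x i) \<in> (\<Pi>\<^sub>M i\<in>- {k}. lborel) \<rightarrow>\<^sub>M borel"
  "(\<lambda>(x, s). \<chi> i. if i = k then (s::real) else x i) \<in> (\<Pi>\<^sub>M i\<in>- {k}. lborel) \<Otimes>\<^sub>M lborel \<rightarrow>\<^sub>M borel"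
proof -
  have "(\<lambda>x. if i = k then (0::real) else x i) \<in> borel_measurable (\<Pi>\<^sub>M i\<in>- {k}. lborel)" for i
    by (cases "i = k") auto
  then show "(\<lambda>x. \<chi> i. if i = k then (0::real) else x i) \<in> (\<Pi>\<^sub>M i\<in>- {k}. lborel) \<rightarrow>\<^sub>M borel"
    by (rule borel_measurable_vec_lambda)
  have "(\<lambda>x. if i = k then snd x else fst x i) \<in> borel_measurable ((\<Pi>\<^sub>M i\<in>- {k}. lborel) \<Otimes>\<^sub>M (lborel :: real measure))" for i
    by (cases "i = k") auto
  then show "(\<lambda>(x, s). \<chi> i. if i = k then (s::real) else x i) \<in> (\<Pi>\<^sub>M i\<in>- {k}. lborel) \<Otimes>\<^sub>M lborel \<rightarrow>\<^sub>M borel"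
    unfolding case_prod_beta by (rule borel_measurable_vec_lambda)
qed

lemma all_if_eq: "(\<forall>i. Q i (if i = k then a else f i)) \<longleftrightarrow> Q k a \<and> (\<forall>i\<in>- {k}. Q i (f i))"
proof
  assume *: "\<forall>i. Q i (if i = k then a else f i)"
  have "Q i (f i)" if "i \<in> - {k}" for i
    using spec[OF *, of i] that by simp
  then show "Q k a \<and> (\<forall>i\<in>- {k}. Q i (f i))"
    using spec[OF *, of k] by simp
qed simp

lemma sets_hyperplane_measure [simp, measurable_cong]: "sets (hyperplane_measure k) = sets borel"
  and space_hyperplane_measure [simp]: "space (hyperplane_measure k) = UNIV"
  by (simp_all add: hyperplane_measure_def)

lemma AE_hyperplane_measure: "AE u in hyperplane_measure k. u $ k = 0"
  unfolding hyperplane_measure_def by (subst AE_distr_iff) auto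

lemma lborel_eq_hyperplane:
  fixes k :: "'n::finite"
  shows "lborel = distr ((\<Pi>\<^sub>M i\<in>- {k}. lborel) \<Otimes>\<^sub>M lborel) borel (\<lambda>(x, s). (\<chi> i. if i = k then s else x i) :: real^'n)"
    (is "_ = distr ?P borel ?f")
proof (rule lborel_eqI)
  interpret product_sigma_finite "\<lambda>i::'n. lborel :: real measure" by standard
  fix l u :: "real^'n" assume "\<And>b. b \<in> Basis \<Longrightarrow> l \<bullet> b \<le> u \<bullet> b"
  from this[of "axis i 1" for i] have le: "l $ i \<le> u $ i" for i
    by (simp add: inner_axis)
  let ?R = "Pi\<^sub>E (- {k}) (\<lambda>i. {l $ i<..<u $ i})"
  have "?f -` box l u \<inter> space ?P = ?R \<times> {l $ k<..<u $ k}"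
  proof (rule set_eqI)
    fix z :: "('n \<Rightarrow> real) \<times> real"
    obtain x s where z: "z = (x, s)" by (cases z)
    have "?f z \<in> box l u \<longleftrightarrow> (\<forall>i. (if i = k then s else x i) \<in> {l $ i<..<u $ i})"
      by (simp only: z mem_box_cart case_prod_conv vec_lambda_beta greaterThanLessThan_iff)
    also have "\<dots> \<longleftrightarrow> s \<in> {l $ k<..<u $ k} \<and> (\<forall>i\<in>- {k}. x i \<in> {l $ i<..<u $ i})"
      by (rule all_if_eq)
    finally show "z \<in> ?f -` box l u \<inter> space ?P \<longleftrightarrow> z \<in> ?R \<times> {l $ k<..<u $ k}"
      unfolding z by (simp add: space_pair_measure space_PiM PiE_iff) blast
  qed
  then have "emeasure (distr ?P borel ?f) (box l u) = emeasure ?P (?R \<times> {l $ k<..<u $ k})"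
    by (subst emeasure_distr) auto
  also have "\<dots> = emeasure (\<Pi>\<^sub>M i\<in>- {k}. lborel) ?R * emeasure lborel {l $ k<..<u $ k}"
    by (intro lborel.emeasure_pair_measure_Times sets_PiM_I_finite) auto
  also have "\<dots> = (\<Prod>i\<in>- {k}. ennreal (u $ i - l $ i)) * ennreal (u $ k - l $ k)"
    using le by (subst emeasure_PiM) auto
  also have "\<dots> = (\<Prod>i\<in>UNIV. ennreal (u $ i - l $ i))"
    by (simp add: prod.remove[of UNIV k] mult.commute Compl_eq_Diff_UNIV)
  also have "\<dots> = (\<Prod>b\<in>Basis. (u - l) \<bullet> b)"
    using le by (simp add: prod_Basis_vec inner_axis prod_ennreal)
  finally show "emeasure (distr ?P borel ?f) (box l u) = (\<Prod>b\<in>Basis. (u - l) \<bullet> b)" .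
qed simp

lemma nn_integral_hyperplane:
  fixes g :: "real^'n::finite \<Rightarrow> ennreal"
  assumes [measurable]: "g \<in> borel_measurable borel"
  shows "(\<integral>\<^sup>+u. g u \<partial>lborel) = (\<integral>\<^sup>+u. (\<integral>\<^sup>+s. g (u + s *\<^sub>R axis k 1) \<partial>lborel) \<partial>hyperplane_measure k)"
proof -
  have eq: "(\<chi> i. if i = k then s else x i) = (\<chi> i. if i = k then 0 else x i) + s *\<^sub>R axis k 1" for s and x :: "'n \<Rightarrow> real"
    by (auto simp: vec_eq_iff axis_def)
  have "(\<integral>\<^sup>+u. g u \<partial>lborel) = (\<integral>\<^sup>+z. g (case z of (x, s) \<Rightarrow> \<chi> i. if i = k then s else x i) \<partial>((\<Pi>\<^sub>M i\<in>- {k}. lborel) \<Otimes>\<^sub>M lborel))"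
    by (subst lborel_eq_hyperplane[of k], subst nn_integral_distr) auto
  also have "\<dots> = (\<integral>\<^sup>+x. (\<integral>\<^sup>+s. g (\<chi> i. if i = k then s else x i) \<partial>lborel) \<partial>(\<Pi>\<^sub>M i\<in>- {k}. lborel))"
    by (subst lborel.nn_integral_fst[symmetric]) auto
  also have "\<dots> = (\<integral>\<^sup>+u. (\<integral>\<^sup>+s. g (u + s *\<^sub>R axis k 1) \<partial>lborel) \<partial>hyperplane_measure k)"
    unfolding hyperplane_measure_def by (subst nn_integral_distr) (simp_all add: eq[symmetric])
  finally show ?thesis .
qed

text \<open>Required to exchange the integral over momenta with the one over surface parameters. The
  cubes have finite measure because only the coordinates other than \<open>k\<close> contribute
  lengths.\<close>

lemma sigma_finite_hyperplane_measure: "sigma_finite_measure (hyperplane_measure (k :: 'n::finite))"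
proof
  interpret product_sigma_finite "\<lambda>i::'n. lborel :: real measure" by standard
  let ?A = "\<lambda>n::nat. {u :: real^'n. \<forall>i. u $ i \<in> {-real n..real n}}"
  have [measurable]: "?A n \<in> sets borel" for n
    by measurable
  have fin: "emeasure (hyperplane_measure k) (?A n) \<noteq> \<infinity>" for n
  proof -
    have "(\<lambda>x. \<chi> i. if i = k then 0 else x i) -` ?A n \<inter> space (\<Pi>\<^sub>M i\<in>- {k}. lborel) = Pi\<^sub>E (- {k}) (\<lambda>i. {-real n..real n})"
      unfolding vimage_def mem_Collect_eq vec_lambda_beta all_if_eq space_PiM
      by (simp add: set_eq_iff PiE_iff) blast
    then have "emeasure (hyperplane_measure k) (?A n) = (\<Prod>i\<in>- {k}. emeasure lborel {-real n..real n})"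
      unfolding hyperplane_measure_def by (simp add: emeasure_distr emeasure_PiM)
    also have "\<dots> \<noteq> \<infinity>"
      by (simp add: ennreal_power)
    finally show ?thesis .
  qed
  have "(\<Union>n. ?A n) = UNIV"
  proof -
    have "\<exists>n. u \<in> ?A n" for u :: "real^'n"
    proof -
      obtain n where "norm u \<le> real n" using real_arch_simple by blast
      then have "\<bar>u $ i\<bar> \<le> real n" for i
        using component_le_norm_cart[of u i] by linarith
      then have "u \<in> ?A n" by (simp add: abs_le_iff minus_le_iff)
      then show ?thesis ..
    qed
    then show ?thesis by blast
  qed
  moreover have "range ?A \<subseteq> sets (hyperplane_measure k)"
    by (rule image_subsetI) simp
  ultimately show "\<exists>A. countable A \<and> A \<subseteq> sets (hyperplane_measure k) \<and> \<Union>A = space (hyperplane_measure k) \<and>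
     (\<forall>a\<in>A. emeasure (hyperplane_measure k) a \<noteq> \<infinity>)"
    using fin by (intro exI[of _ "range ?A"] conjI) (rule countable_image[OF countableI_type], assumption, simp only: space_hyperplane_measure, blast)
qed

section \<open>Gaussian momenta\<close>

definition gauss :: "real^'n::finite \<Rightarrow> real"
  where "gauss p = (\<Prod>i\<in>UNIV. std_normal_density (p $ i))"

lemma gauss_pos: "0 < gauss p"
  unfolding gauss_def by (intro prod_pos) (simp add: normal_density_pos)

lemma continuous_gauss: "continuous_on UNIV (gauss :: real^'n::finite \<Rightarrow> real)"
  unfolding gauss_def std_normal_density_def by (intro continuous_intros) auto

lemma borel_measurable_gauss [measurable]: "(gauss :: real^'n::finite \<Rightarrow> real) \<in> borel_measurable borel"
  by (rule borel_measurable_continuous_onI[OF continuous_gauss])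

lemma gauss_eq: "gauss p = (1 / sqrt (2 * pi)) ^ CARD('n) * exp (- (norm p)\<^sup>2 / 2)"
  for p :: "real^'n::finite"
proof -
  have "gauss p = (1 / sqrt (2 * pi)) ^ CARD('n) * (\<Prod>i\<in>UNIV. exp (- (p $ i)\<^sup>2 / 2))"
    unfolding gauss_def std_normal_density_def by (simp only: prod.distrib prod_constant)
  also have "(\<Prod>i\<in>UNIV. exp (- (p $ i)\<^sup>2 / 2)) = exp (- (norm p)\<^sup>2 / 2)"
    unfolding power2_norm_eq_inner inner_vec_def
    by (simp add: exp_sum[symmetric] sum_negf sum_divide_distrib[symmetric] power2_eq_square)
  finally show ?thesis .
qed

lemma nn_integral_lborel_prod_vec:
  fixes f :: "'n::finite \<Rightarrow> real \<Rightarrow> ennreal"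
  assumes "\<And>i. f i \<in> borel_measurable borel"
  shows "(\<integral>\<^sup>+p. (\<Prod>i\<in>UNIV. f i ((p :: real^'n) $ i)) \<partial>lborel) = (\<Prod>i\<in>UNIV. \<integral>\<^sup>+x. f i x \<partial>lborel)"
proof -
  define g where "g b = f (THE i. b = axis i 1)" for b :: "real^'n"
  have g: "g (axis i 1) = f i" for i
    by (simp add: g_def axis_eq_axis)
  have "(\<integral>\<^sup>+p. (\<Prod>b\<in>Basis. g b ((p :: real^'n) \<bullet> b)) \<partial>lborel) = (\<Prod>b\<in>Basis. \<integral>\<^sup>+x. g b x \<partial>lborel)"
    using assms by (intro nn_integral_lborel_prod) (auto simp: g_def)
  then show ?thesis
    by (simp add: prod_Basis_vec g inner_axis)
qed

lemma nn_integral_gauss: "(\<integral>\<^sup>+p. ennreal (gauss (p :: real^'n::finite)) \<partial>lborel) = 1"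
proof -
  have "(\<integral>\<^sup>+x. ennreal (std_normal_density x) \<partial>lborel) = 1"
    using nn_integral_eq_integral[of lborel std_normal_density] integral_std_normal_moment_even[of 0]
      integrable_std_normal_moment[of 0] by simp
  then show ?thesis
    using nn_integral_lborel_prod_vec[of "\<lambda>i::'n. \<lambda>x. ennreal (std_normal_density x)"]
    by (simp add: gauss_def prod_ennreal)
qed

text \<open>The Gaussian factorizes, and one factor carries the second moment 1 in place of the
  total mass 1.\<close>

lemma nn_integral_gauss_coordinate:
  "(\<integral>\<^sup>+p. ennreal (gauss (p :: real^'n::finite)) * ennreal ((c * p $ k)\<^sup>2) \<partial>lborel) = ennreal (c\<^sup>2)"
proof -
  have 1: "(\<integral>\<^sup>+x. ennreal (std_normal_density x) \<partial>lborel) = 1"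
    using nn_integral_eq_integral[of lborel std_normal_density] integral_std_normal_moment_even[of 0]
      integrable_std_normal_moment[of 0] by simp
  have 2: "(\<integral>\<^sup>+x. ennreal (std_normal_density x * x\<^sup>2) \<partial>lborel) = 1"
    using nn_integral_eq_integral[of lborel "\<lambda>x. std_normal_density x * x\<^sup>2"] integral_std_normal_moment_even[of 1]
      integrable_std_normal_moment[of 2] by (simp add: fact_numeral)
  let ?f = "\<lambda>i x. if i = k then ennreal (std_normal_density x * x\<^sup>2) else ennreal (std_normal_density x)"
  have eq: "ennreal (gauss p) * ennreal ((c * p $ k)\<^sup>2) = ennreal (c\<^sup>2) * (\<Prod>i\<in>UNIV. ?f i (p $ i))" for p :: "real^'n"
  proof -
    have "(\<Prod>i\<in>UNIV. ?f i (p $ i)) = ?f k (p $ k) * (\<Prod>i\<in>UNIV - {k}. ?f i (p $ i))"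
      by (rule prod.remove) auto
    also have "(\<Prod>i\<in>UNIV - {k}. ?f i (p $ i)) = (\<Prod>i\<in>UNIV - {k}. ennreal (std_normal_density (p $ i)))"
      by (rule prod.cong) auto
    also have "?f k (p $ k) * \<dots> = ennreal ((p $ k)\<^sup>2) * (ennreal (std_normal_density (p $ k)) * \<dots>)"
      by (simp add: ennreal_mult' mult_ac)
    also have "ennreal (std_normal_density (p $ k)) * (\<Prod>i\<in>UNIV - {k}. ennreal (std_normal_density (p $ i)))
       = (\<Prod>i\<in>UNIV. ennreal (std_normal_density (p $ i)))"
      by (rule prod.remove[symmetric]) auto
    also have "\<dots> = ennreal (gauss p)"
      by (simp add: gauss_def prod_ennreal)
    finally show ?thesis
      by (simp add: power_mult_distrib ennreal_mult' mult_ac)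
  qed
  have m: "?f i \<in> borel_measurable borel" for i
    by (cases "i = k") auto
  have "(\<integral>\<^sup>+x. ?f i x \<partial>lborel) = 1" for i
    using 1 2 by (cases "i = k") auto
  then have "(\<integral>\<^sup>+p. (\<Prod>i\<in>UNIV. ?f i ((p :: real^'n) $ i)) \<partial>lborel) = 1"
    using nn_integral_lborel_prod_vec[of ?f, OF m] by (simp only: prod.neutral_const)
  moreover have "(\<lambda>p :: real^'n. \<Prod>i\<in>UNIV. ?f i (p $ i)) \<in> borel_measurable lborel"
    using m by (intro borel_measurable_prod_ennreal measurable_compose[OF _ m]) auto
  ultimately show ?thesis
    unfolding eq by (subst nn_integral_cmult) auto
qed

text \<open>A diagonal map with entries of modulus 1 has determinant of modulus 1. It is applied
  below with a single sign changed and with all signs changed.\<close>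

lemma nn_integral_lborel_flip:
  fixes f :: "real^'n::finite \<Rightarrow> ennreal"
  assumes f: "f \<in> borel_measurable borel" and c: "\<And>i. \<bar>c i\<bar> = 1"
  shows "(\<integral>\<^sup>+p. f (\<chi> i. c i * p $ i) \<partial>lborel) = (\<integral>\<^sup>+p. f p \<partial>lborel)"
proof -
  \<comment> \<open>\<open>THE\<close> recovers the coordinate from the basis vector, since the
    affine change of variables is indexed by \<open>Basis\<close>.\<close>
  define d where "d b = c (THE i. b = axis i 1)" for b :: "real^'n"
  have d: "d (axis i 1) = c i" for i
    by (simp add: d_def axis_eq_axis)
  let ?T = "\<lambda>p :: real^'n. 0 + (\<Sum>j\<in>Basis. (d j * (p \<bullet> j)) *\<^sub>R j)"
  have B: "(Basis :: (real^'n) set) = (\<lambda>i. axis i 1) ` UNIV"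
    by (auto simp: Basis_vec_def)
  have T: "?T p = (\<chi> i. c i * p $ i)" for p
  proof -
    have "inj (\<lambda>i. axis i (1::real) :: real^'n)"
      by (simp add: inj_on_def axis_eq_axis)
    then have "?T p = (\<Sum>i\<in>UNIV. (d (axis i 1) * (p \<bullet> axis i 1)) *\<^sub>R axis i 1)"
      unfolding B by (simp add: sum.reindex)
    also have "\<dots> = (\<Sum>i\<in>UNIV. (\<chi> i. c i * p $ i) $ i *s axis i 1)"
      by (simp add: d inner_axis scalar_mult_eq_scaleR)
    finally show ?thesis unfolding basis_expansion .
  qed
  have nz: "d j \<noteq> 0" and ab: "\<bar>d j\<bar> = 1" if "j \<in> Basis" for j
    using c that d unfolding B by (auto, metis abs_zero zero_neq_one)
  have "lborel = density (distr lborel borel ?T) (\<lambda>_. \<Prod>j\<in>Basis. \<bar>d j\<bar>)"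
    by (rule lborel_affine_euclidean[OF nz])
  also have "\<dots> = distr lborel borel ?T"
    using ab by (simp add: density_1)
  finally have "(\<integral>\<^sup>+p. f p \<partial>lborel) = (\<integral>\<^sup>+p. f p \<partial>distr lborel borel ?T)"
    by (rule arg_cong)
  also have "\<dots> = (\<integral>\<^sup>+p. f (?T p) \<partial>lborel)"
    by (rule nn_integral_distr) (use f in auto)
  finally show ?thesis unfolding T by simp
qed

lemma gauss_flip:
  assumes "\<And>i. \<bar>c i\<bar> = 1"
  shows "gauss (\<chi> i. c i * p $ i) = gauss p"
proof -
  have "(c i)\<^sup>2 = 1" for i using assms[of i] by (metis one_power2 power2_abs)
  then show ?thesis
    by (simp add: gauss_def std_normal_density_def power_mult_distrib)
qed

text \<open>Flipping the sign of one coordinate preserves the Gaussian and cancels the mixed term of the square.\<close>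

lemma nn_integral_gauss_sum_square:
  fixes w :: "'n::finite \<Rightarrow> real"
  shows "(\<integral>\<^sup>+p. ennreal (gauss (p :: real^'n)) * ennreal ((\<Sum>i\<in>A. w i * p $ i)\<^sup>2) \<partial>lborel) = ennreal (\<Sum>i\<in>A. (w i)\<^sup>2)"
proof (induction A rule: finite_induct[OF finite])
  case (2 k A)
  let ?J = "\<lambda>h. \<integral>\<^sup>+p. ennreal (gauss (p :: real^'n)) * ennreal ((h p)\<^sup>2) \<partial>lborel"
  let ?a = "\<lambda>p :: real^'n. w k * p $ k" and ?b = "\<lambda>p :: real^'n. \<Sum>i\<in>A. w i * p $ i"
  have [measurable]: "?b \<in> borel_measurable borel" by (intro borel_measurable_sum) auto
  let ?c = "\<lambda>i. if i = k then -1 else (1::real)"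
  have "?J (\<lambda>p. ?a p + ?b p) = ?J (\<lambda>p. ?b p - ?a p)"
  proof -
    have b: "?b (\<chi> i. ?c i * p $ i) = ?b p" for p
      using 2 by (intro sum.cong) auto
    have "?J (\<lambda>p. ?a p + ?b p) = (\<integral>\<^sup>+p. ennreal (gauss (\<chi> i. ?c i * p $ i))
      * ennreal ((?a (\<chi> i. ?c i * p $ i) + ?b (\<chi> i. ?c i * p $ i))\<^sup>2) \<partial>lborel)"
      by (rule nn_integral_lborel_flip[symmetric]) auto
    also have "\<dots> = ?J (\<lambda>p. ?b p - ?a p)"
      by (subst gauss_flip, simp) (simp only: b, simp)
    finally show ?thesis .
  qed
  then have "2 * ?J (\<lambda>p. ?a p + ?b p) = ?J (\<lambda>p. ?a p + ?b p) + ?J (\<lambda>p. ?b p - ?a p)"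
    by (simp only: mult_2)
  also have "\<dots> = (\<integral>\<^sup>+p. ennreal (gauss p) * ennreal ((?a p + ?b p)\<^sup>2) + ennreal (gauss p) * ennreal ((?b p - ?a p)\<^sup>2) \<partial>lborel)"
    by (rule nn_integral_add[symmetric]) auto
  also have "\<dots> = (\<integral>\<^sup>+p. 2 * (ennreal (gauss p) * ennreal ((?a p)\<^sup>2) + ennreal (gauss p) * ennreal ((?b p)\<^sup>2)) \<partial>lborel)"
  proof (rule nn_integral_cong)
    fix p :: "real^'n"
    have "ennreal (gauss p) * ennreal ((?a p + ?b p)\<^sup>2) + ennreal (gauss p) * ennreal ((?b p - ?a p)\<^sup>2)
      = ennreal (gauss p) * (ennreal ((?a p + ?b p)\<^sup>2 + (?b p - ?a p)\<^sup>2))"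
      by (simp add: distrib_left)
    also have "(?a p + ?b p)\<^sup>2 + (?b p - ?a p)\<^sup>2 = 2 * ((?a p)\<^sup>2 + (?b p)\<^sup>2)"
      by (simp add: power2_eq_square algebra_simps)
    also have "ennreal (gauss p) * ennreal \<dots> = 2 * (ennreal (gauss p) * ennreal ((?a p)\<^sup>2) + ennreal (gauss p) * ennreal ((?b p)\<^sup>2))"
      by (simp add: ennreal_mult' distrib_left mult_ac)
    finally show "ennreal (gauss p) * ennreal ((?a p + ?b p)\<^sup>2) + ennreal (gauss p) * ennreal ((?b p - ?a p)\<^sup>2)
      = 2 * (ennreal (gauss p) * ennreal ((?a p)\<^sup>2) + ennreal (gauss p) * ennreal ((?b p)\<^sup>2))" .
  qed
  also have "\<dots> = 2 * (?J ?a + ?J ?b)"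
    by (subst nn_integral_cmult, simp, subst nn_integral_add) auto
  finally have "?J (\<lambda>p. ?a p + ?b p) = ?J ?a + ?J ?b"
    by (simp add: ennreal_mult_cancel_left del: distrib_left_numeral)
  then show ?case
    using 2 by (simp add: nn_integral_gauss_coordinate sum_nonneg)
qed simp

text \<open>Coercion to \<open>ennreal\<close> cuts off negative values, so this is the mean of a
  positive part. By symmetry under negation of \<open>p\<close> it is half the mean of
  \<open>\<bar>w \<bullet> p\<bar>\<close>. The bound
  \<open>\<bar>x\<bar> \<le> norm w / 2 + x^2 / (2 * norm w)\<close> and the second moment
  \<open>(norm w)^2\<close> show that the latter mean is at most \<open>norm w\<close>. Here the
  factor 1/2 of the theorem originates.\<close>

lemma nn_integral_gauss_inner_pos:
  fixes w :: "real^'n::finite"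
  shows "(\<integral>\<^sup>+p. ennreal (gauss p) * ennreal (w \<bullet> p) \<partial>lborel) \<le> ennreal (norm w / 2)"
proof (cases "w = 0")
  case False
  then have pos: "norm w > 0" by simp
  let ?I = "\<lambda>f. \<integral>\<^sup>+p. ennreal (gauss (p :: real^'n)) * ennreal (f p) \<partial>lborel"
  have neg: "?I (\<lambda>p. w \<bullet> p) = ?I (\<lambda>p. - (w \<bullet> p))"
  proof -
    have "?I (\<lambda>p. w \<bullet> p) = (\<integral>\<^sup>+p. ennreal (gauss (\<chi> i. (-1::real) * p $ i)) * ennreal (w \<bullet> (\<chi> i. -1 * p $ i)) \<partial>lborel)"
      by (rule nn_integral_lborel_flip[symmetric]) auto
    also have "\<dots> = ?I (\<lambda>p. - (w \<bullet> p))"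
      by (subst gauss_flip, simp) (simp add: inner_vec_def sum_negf)
    finally show ?thesis .
  qed
  have "2 * ?I (\<lambda>p. w \<bullet> p) = ?I (\<lambda>p. w \<bullet> p) + ?I (\<lambda>p. - (w \<bullet> p))"
    unfolding neg by (simp only: mult_2)
  also have "\<dots> = (\<integral>\<^sup>+p. ennreal (gauss p) * ennreal (w \<bullet> p) + ennreal (gauss p) * ennreal (- (w \<bullet> p)) \<partial>lborel)"
    by (rule nn_integral_add[symmetric]) auto
  also have "\<dots> \<le> (\<integral>\<^sup>+p. ennreal (norm w / 2) * ennreal (gauss p) + ennreal (1 / (2 * norm w)) * (ennreal (gauss p) * ennreal ((w \<bullet> p)\<^sup>2)) \<partial>lborel)"
  proof (rule nn_integral_mono)
    fix p :: "real^'n"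
    have "ennreal (w \<bullet> p) + ennreal (- (w \<bullet> p)) = ennreal \<bar>w \<bullet> p\<bar>"
      by (cases "w \<bullet> p \<ge> 0") (auto simp: ennreal_neg)
    also have "\<bar>w \<bullet> p\<bar> \<le> norm w / 2 + 1 / (2 * norm w) * (w \<bullet> p)\<^sup>2"
    proof -
      have "0 \<le> (\<bar>w \<bullet> p\<bar> - norm w)\<^sup>2 / (2 * norm w)" using pos by simp
      also have "(\<bar>w \<bullet> p\<bar> - norm w)\<^sup>2 / (2 * norm w) = norm w / 2 + 1 / (2 * norm w) * (w \<bullet> p)\<^sup>2 - \<bar>w \<bullet> p\<bar>"
        using pos by (simp add: power2_diff field_simps power2_eq_square)
      finally show ?thesis by simp
    qed
    then have "ennreal \<bar>w \<bullet> p\<bar> \<le> ennreal (norm w / 2 + 1 / (2 * norm w) * (w \<bullet> p)\<^sup>2)" by (rule ennreal_leI)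
    finally have "ennreal (gauss p) * (ennreal (w \<bullet> p) + ennreal (- (w \<bullet> p))) \<le> ennreal (gauss p) * ennreal (norm w / 2 + 1 / (2 * norm w) * (w \<bullet> p)\<^sup>2)"
      by (rule mult_left_mono) simp
    also have "ennreal (norm w / 2 + 1 / (2 * norm w) * (w \<bullet> p)\<^sup>2) = ennreal (norm w / 2) + ennreal (1 / (2 * norm w)) * ennreal ((w \<bullet> p)\<^sup>2)"
      by (simp add: ennreal_mult'[symmetric])
    finally show "ennreal (gauss p) * ennreal (w \<bullet> p) + ennreal (gauss p) * ennreal (- (w \<bullet> p))
      \<le> ennreal (norm w / 2) * ennreal (gauss p) + ennreal (1 / (2 * norm w)) * (ennreal (gauss p) * ennreal ((w \<bullet> p)\<^sup>2))"
      by (simp add: distrib_left mult_ac)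
  qed
  also have "\<dots> = ennreal (norm w / 2) * (\<integral>\<^sup>+p. ennreal (gauss (p :: real^'n)) \<partial>lborel) + ennreal (1 / (2 * norm w)) * ?I (\<lambda>p. (w \<bullet> p)\<^sup>2)"
    by (subst nn_integral_add, simp, simp, subst nn_integral_cmult, simp, subst nn_integral_cmult) auto
  also have "?I (\<lambda>p. (w \<bullet> p)\<^sup>2) = ennreal ((norm w)\<^sup>2)"
    using nn_integral_gauss_sum_square[where A = UNIV and w = "\<lambda>i. w $ i"]
    unfolding power2_norm_eq_inner inner_vec_def by (simp add: power2_eq_square)
  also have "ennreal (norm w / 2) * (\<integral>\<^sup>+p. ennreal (gauss (p :: real^'n)) \<partial>lborel) + ennreal (1 / (2 * norm w)) * ennreal ((norm w)\<^sup>2) = 2 * ennreal (norm w / 2)"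
  proof -
    have "ennreal (1 / (2 * norm w)) * ennreal ((norm w)\<^sup>2) = ennreal (norm w / 2)"
      using pos by (simp add: ennreal_mult'[symmetric] power2_eq_square)
    then show ?thesis by (simp only: nn_integral_gauss mult_1_right mult_2)
  qed
  finally show ?thesis
    by (subst (asm) ennreal_mult_le_mult_iff) auto
qed simp

section \<open>Slice charts and their Jacobians\<close>

text \<open>The vector that represents the linear form putting \<open>p\<close> into column
  \<open>k\<close> and taking the determinant. It is the generalized cross product of the other
  columns: orthogonal to them, with their (d-1)-dimensional volume as its length. For a chart it is
  a normal to the hypersurface weighted with the area element.\<close>

definition cofactor :: "'n::finite \<Rightarrow> real^'n^'n \<Rightarrow> real^'n"
  where "cofactor k A = (\<chi> l. det (\<chi> i j. if j = k then axis l 1 $ i else A $ i $ j))"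

lemma det_replace_column:
  fixes A :: "real^'n::finite^'n"
  shows "det (\<chi> i j. if j = k then p $ i else A $ i $ j) = cofactor k A \<bullet> p"
proof -
  have tr: "(\<chi> i j. if j = k then x $ i else A $ i $ j) = transpose (\<chi> i. if i = k then x else column i A)" for x
    by (simp add: transpose_def column_def vec_eq_iff)
  have "(\<chi> i. if i = k then p else column i A) = (\<chi> i. if i = k then (\<Sum>l\<in>UNIV. p $ l *s axis l 1) else column i A)"
    by (simp only: basis_expansion)
  then have "det (\<chi> i j. if j = k then p $ i else A $ i $ j)
      = (\<Sum>l\<in>UNIV. det (\<chi> i. if i = k then p $ l *s axis l 1 else column i A))"
    unfolding tr det_transpose by (simp only: det_linear_row_sum[OF finite])
  also have "\<dots> = (\<Sum>l\<in>UNIV. p $ l * det (\<chi> i. if i = k then axis l 1 else column i A))"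
    by (simp only: det_row_mul)
  also have "\<dots> = cofactor k A \<bullet> p"
    unfolding cofactor_def inner_vec_def tr det_transpose by (simp add: mult.commute)
  finally show ?thesis .
qed

text \<open>
  The matrix \<open>B\<close> obtained from \<open>A\<close> by putting \<open>w = cofactor k A\<close> in column \<open>k\<close> has determinant \<open>w \<bullet> w\<close>,
  and \<open>B\<^sup>T B\<close> is the bordered Gram matrix up to the factor \<open>w \<bullet> w\<close>, because \<open>w\<close> is orthogonal to the
  other columns.
\<close>

lemma norm_cofactor_le:
  fixes A :: "real^'n::finite^'n"
  shows "ennreal (norm (cofactor k A))
    \<le> ennreal (sqrt (det (\<chi> i j. if i = k \<or> j = k then (if i = j then 1 else 0) else column i A \<bullet> column j A)))"
    (is "_ \<le> ennreal (sqrt (det ?G))")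
proof (cases "cofactor k A = 0")
  case False
  define w where "w = cofactor k A"
  define B where "B = (\<chi> i j. if j = k then w $ i else A $ i $ j)"
  have w: "w \<bullet> w \<noteq> 0" using False by (simp add: w_def)
  have detB: "det B = w \<bullet> w"
    unfolding B_def w_def by (rule det_replace_column)
  have orth: "w \<bullet> column j A = 0" if "j \<noteq> k" for j
  proof -
    have "w \<bullet> column j A = det (\<chi> i m. if m = k then column j A $ i else A $ i $ m)"
      unfolding w_def by (rule det_replace_column[symmetric])
    also have "\<dots> = 0"
      using that by (intro det_identical_columns[of j k]) (simp_all add: column_def)
    finally show ?thesis .
  qed
  then have orth': "column j A \<bullet> w = 0" if "j \<noteq> k" for j
    using that by (subst inner_commute) simp
  have col: "column j B = (if j = k then w else column j A)" for j
    by (simp add: B_def column_def vec_eq_iff)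
  have "transpose B ** B = (\<chi> i. if i = k then (w \<bullet> w) *s ?G $ i else ?G $ i)"
  proof -
    have "(transpose B ** B) $ i $ j = column i B \<bullet> column j B" for i j
      by (simp add: matrix_matrix_mult_def transpose_def column_def inner_vec_def)
    moreover have "column i B \<bullet> column j B = (\<chi> i. if i = k then (w \<bullet> w) *s ?G $ i else ?G $ i) $ i $ j" for i j
      by (cases "i = k"; cases "j = k") (simp_all add: col orth orth')
    ultimately show ?thesis by (simp only: vec_eq_iff) simp
  qed
  then have "det (transpose B ** B) = (w \<bullet> w) * det (\<chi> i. if i = k then ?G $ i else ?G $ i)"
    by (simp only: det_row_mul)
  then have "(det B)\<^sup>2 = (w \<bullet> w) * det (\<chi> i. if i = k then ?G $ i else ?G $ i)"
    by (simp only: det_mul det_transpose power2_eq_square)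
  also have "(\<chi> i. if i = k then ?G $ i else ?G $ i) = ?G"
    by (simp only: if_cancel vec_nth_inverse)
  finally have "w \<bullet> w = det ?G"
    using w unfolding detB by (simp add: power2_eq_square)
  then show ?thesis
    by (simp add: w_def[symmetric] norm_eq_sqrt_inner)
qed simp

lemma continuous_on_det:
  fixes A :: "'a::topological_space \<Rightarrow> real^'n::finite^'n"
  assumes "\<And>i j. continuous_on S (\<lambda>x. A x $ i $ j)"
  shows "continuous_on S (\<lambda>x. det (A x))"
  unfolding det_def by (intro continuous_intros assms)

lemma continuous_on_cofactor:
  fixes A :: "'a::topological_space \<Rightarrow> real^'n::finite^'n"
  assumes "\<And>i j. continuous_on S (\<lambda>x. A x $ i $ j)"
  shows "continuous_on S (\<lambda>x. cofactor k (A x))"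
  unfolding cofactor_def
proof (intro continuous_on_vec_lambda continuous_on_det)
  show "continuous_on S (\<lambda>x. (\<chi> i j. if j = k then axis l 1 $ i else A x $ i $ j) $ i $ j)" for l i j
    using assms by (cases "j = k") simp_all
qed

lemma slice_chartD:
  fixes \<phi> :: "real^'n::finite \<Rightarrow> real^'n"
  assumes "slice_chart M k U \<phi>"
  shows "open U" "open (\<phi> ` U)" "inj_on \<phi> U"
    and "\<And>u. u \<in> U \<Longrightarrow> (\<phi> has_derivative frechet_derivative \<phi> (at u)) (at u)"
    and "\<And>v. continuous_on U (\<lambda>u. frechet_derivative \<phi> (at u) v)"
    and "\<And>y. y \<in> \<phi> ` U \<Longrightarrow>
      (inv_into U \<phi> has_derivative frechet_derivative (inv_into U \<phi>) (at y)) (at y)"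
    and "\<And>u. u \<in> U \<Longrightarrow> \<phi> u \<in> M \<longleftrightarrow> u $ k = 0"
    and "continuous_on U \<phi>" "continuous_on (\<phi> ` U) (inv_into U \<phi>)"
proof -
  have *: "open U" "open (\<phi> ` U)" "inj_on \<phi> U" "smooth_on U \<phi>" "smooth_on (\<phi> ` U) (inv_into U \<phi>)"
    "\<phi> ` (U \<inter> {u. u $ k = 0}) = \<phi> ` U \<inter> M"
    using assms unfolding slice_chart_def by auto
  then show "open U" "open (\<phi> ` U)" "inj_on \<phi> U" by auto
  have 1: "Ck_on (Suc 0) U \<phi>" "Ck_on (Suc 0) (\<phi> ` U) (inv_into U \<phi>)" "Ck_on 0 U \<phi>" "Ck_on 0 (\<phi> ` U) (inv_into U \<phi>)"
    using *(4,5) unfolding smooth_on_def by blast+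
  then show "(\<phi> has_derivative frechet_derivative \<phi> (at u)) (at u)" if "u \<in> U" for u
    using 1(1) that by (simp add: frechet_derivative_works)
  show "continuous_on U (\<lambda>u. frechet_derivative \<phi> (at u) v)" for v
    using 1(1) by simp
  show "(inv_into U \<phi> has_derivative frechet_derivative (inv_into U \<phi>) (at y)) (at y)" if "y \<in> \<phi> ` U" for y
    using 1(2) that by (auto simp: frechet_derivative_works)
  show "continuous_on U \<phi>" "continuous_on (\<phi> ` U) (inv_into U \<phi>)"
    using 1 by auto
  show "\<phi> u \<in> M \<longleftrightarrow> u $ k = 0" if "u \<in> U" for u
  proof
    assume "\<phi> u \<in> M"
    then have "\<phi> u \<in> \<phi> ` (U \<inter> {u. u $ k = 0})" using *(6) that by blast
    then show "u $ k = 0" using *(3) that by (auto dest: inj_onD)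
  next
    assume "u $ k = 0"
    then show "\<phi> u \<in> M" using *(6) that by blast
  qed
qed

lemma slice_chart_inverse_derivative:
  fixes \<phi> :: "real^'n::finite \<Rightarrow> real^'n"
  assumes c: "slice_chart M k U \<phi>" and u: "u \<in> U"
  shows "frechet_derivative \<phi> (at u) (frechet_derivative (inv_into U \<phi>) (at (\<phi> u)) v) = v"
proof -
  let ?\<psi> = "inv_into U \<phi>"
  have y: "\<phi> u \<in> \<phi> ` U" and \<psi>: "?\<psi> (\<phi> u) = u"
    using u slice_chartD(3)[OF c] by auto
  have "((\<lambda>y. \<phi> (?\<psi> y)) has_derivative (\<lambda>v. frechet_derivative \<phi> (at u) (frechet_derivative ?\<psi> (at (\<phi> u)) v))) (at (\<phi> u))"
    using diff_chain_at[OF slice_chartD(6)[OF c y], of \<phi> "frechet_derivative \<phi> (at u)"] slice_chartD(4)[OF c u] \<psi>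
    by (simp add: o_def)
  then have "((\<lambda>y. y) has_derivative (\<lambda>v. frechet_derivative \<phi> (at u) (frechet_derivative ?\<psi> (at (\<phi> u)) v))) (at (\<phi> u))"
    by (rule has_derivative_transform_within_open[OF _ slice_chartD(2)[OF c] y]) (rule f_inv_into_f)
  then have "(\<lambda>v. frechet_derivative \<phi> (at u) (frechet_derivative ?\<psi> (at (\<phi> u)) v)) = (\<lambda>v. v)"
    using has_derivative_unique[OF _ has_derivative_ident] by blast
  then show ?thesis by (rule fun_cong)
qed

definition jacobian_matrix :: "(real^'n::finite \<Rightarrow> real^'n) \<Rightarrow> real^'n \<Rightarrow> real^'n^'n"
  where "jacobian_matrix \<phi> u = matrix (frechet_derivative \<phi> (at u))"

lemma column_jacobian: "column j (jacobian_matrix \<phi> u) = frechet_derivative \<phi> (at u) (axis j 1)"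
  by (simp add: jacobian_matrix_def column_def matrix_def vec_eq_iff)

lemma norm_cofactor_jacobian_le:
  "ennreal (norm (cofactor k (jacobian_matrix \<phi> u))) \<le> ennreal (chart_density k \<phi> u)"
  using norm_cofactor_le[of k "jacobian_matrix \<phi> u"] unfolding column_jacobian chart_density_def .

text \<open>Cramer's rule, applied to the preimage of \<open>p\<close> under the Jacobian matrix,
  which is the derivative of the inverse chart in direction \<open>p\<close>. It links the normal
  component of \<open>p\<close> to the rate at which the chart coordinate \<open>k\<close> changes
  along \<open>p\<close>.\<close>

lemma cofactor_inner_eq:
  fixes \<phi> :: "real^'n::finite \<Rightarrow> real^'n"
  assumes c: "slice_chart M k U \<phi>" and u: "u \<in> U"
  shows "cofactor k (jacobian_matrix \<phi> u) \<bullet> p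
    = frechet_derivative (inv_into U \<phi>) (at (\<phi> u)) p $ k * det (jacobian_matrix \<phi> u)"
proof -
  have lin: "linear (frechet_derivative \<phi> (at u))"
    using slice_chartD(4)[OF c u] by (rule has_derivative_linear)
  have "jacobian_matrix \<phi> u *v frechet_derivative (inv_into U \<phi>) (at (\<phi> u)) p = p"
    unfolding jacobian_matrix_def using slice_chart_inverse_derivative[OF c u] lin
    by (subst matrix_works) (simp_all add: linear_def scalar_mult_eq_scaleR[abs_def])
  then show ?thesis
    using cramer_lemma[of k "jacobian_matrix \<phi> u" "frechet_derivative (inv_into U \<phi>) (at (\<phi> u)) p"]
    by (simp only: det_replace_column)
qed

lemma continuous_on_jacobian:
  assumes c: "slice_chart M k U \<phi>"
  shows "continuous_on U (\<lambda>u. jacobian_matrix \<phi> u $ i $ j)"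
  unfolding jacobian_matrix_def matrix_def by (simp add: slice_chartD(5)[OF c] continuous_on_component)

definition base_point :: "'n::finite \<Rightarrow> real^'n \<Rightarrow> real^'n"
  where "base_point k u = u - (u $ k) *\<^sub>R axis k 1"

text \<open>
  The point \<open>sweep k \<phi> p u\<close>, moving with velocity \<open>p\<close>, reaches the boundary point
  \<open>\<phi> (base_point k u)\<close> after time \<open>u $ k\<close>.
\<close>

definition sweep :: "'n::finite \<Rightarrow> (real^'n \<Rightarrow> real^'n) \<Rightarrow> real^'n \<Rightarrow> real^'n \<Rightarrow> real^'n"
  where "sweep k \<phi> p u = \<phi> (base_point k u) - (u $ k) *\<^sub>R p"

lemma base_point_measurable [measurable]: "base_point k \<in> borel_measurable borel"
  unfolding base_point_def by measurable

lemma base_point_add: "v $ k = 0 \<Longrightarrow> base_point k (v + s *\<^sub>R axis k 1) = v"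
  by (simp add: base_point_def axis_def)

lemma sweep_has_derivative:
  assumes c: "slice_chart M k U \<phi>" and u: "base_point k u \<in> U"
  shows "(sweep k \<phi> p has_derivative
    (\<lambda>v. frechet_derivative \<phi> (at (base_point k u)) (base_point k v) - (v $ k) *\<^sub>R p)) (at u within S)"
proof -
  have k: "((\<lambda>u. u $ k) has_derivative (\<lambda>v. v $ k)) (at u within S)"
    by (rule bounded_linear_imp_has_derivative[OF bounded_linear_vec_nth])
  have b: "(base_point k has_derivative base_point k) (at u within S)"
    unfolding base_point_def by (auto intro!: derivative_eq_intros k)
  have "(\<phi> has_derivative frechet_derivative \<phi> (at (base_point k u))) (at (base_point k u) within base_point k ` S)"
    using slice_chartD(4)[OF c u] by (rule has_derivative_at_withinI)
  from diff_chain_within[OF b this]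
  have "((\<lambda>u. \<phi> (base_point k u)) has_derivative (\<lambda>v. frechet_derivative \<phi> (at (base_point k u)) (base_point k v))) (at u within S)"
    by (simp add: o_def)
  then show ?thesis
    unfolding sweep_def by (auto intro!: derivative_eq_intros k)
qed

text \<open>\<open>base_point\<close> annihilates direction \<open>k\<close> and fixes the others,
  so the derivative of the sweep is the Jacobian matrix of the chart with column \<open>k\<close>
  replaced by \<open>- p\<close>.\<close>

lemma det_sweep:
  assumes c: "slice_chart M k U \<phi>" and u: "u \<in> U"
  shows "\<bar>det (matrix (\<lambda>v. frechet_derivative \<phi> (at u) (base_point k v) - (v $ k) *\<^sub>R p))\<bar>
    = \<bar>cofactor k (jacobian_matrix \<phi> u) \<bullet> p\<bar>"
proof -
  interpret bounded_linear "frechet_derivative \<phi> (at u)"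
    using slice_chartD(4)[OF c u] by (rule has_derivative_bounded_linear)
  have "base_point k (axis j 1) = (if j = k then 0 else axis j 1)" for j :: 'a
    by (simp add: base_point_def axis_def)
  then have "matrix (\<lambda>v. frechet_derivative \<phi> (at u) (base_point k v) - (v $ k) *\<^sub>R p) $ i $ j
    = (if j = k then (- p) $ i else jacobian_matrix \<phi> u $ i $ j)" for i j
    by (simp add: matrix_def jacobian_matrix_def axis_def)
  then have "matrix (\<lambda>v. frechet_derivative \<phi> (at u) (base_point k v) - (v $ k) *\<^sub>R p)
    = (\<chi> i j. if j = k then (- p) $ i else jacobian_matrix \<phi> u $ i $ j)"
    by (simp only: vec_eq_iff vec_lambda_beta) simp
  then show ?thesis
    by (simp only: det_replace_column) simp
qed

text \<open>\<open>E\<close> parametrizes points that reach the chart within time \<open>h\<close>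
  while moving outward, the outward side being encoded by the sign \<open>\<tau>\<close>. On
  \<open>E\<close> this sign removes the modulus from the Jacobian determinant of the sweep, leaving
  the flux \<open>\<tau> u * (w u \<bullet> p)\<close>. The resulting bound depends on the time
  coordinate only through the range \<open>{0..h}\<close>, whence the factor
  \<open>h\<close>.\<close>

lemma chart_sweep:
  fixes \<phi> :: "real^'n::finite \<Rightarrow> real^'n" and G :: "real^'n \<Rightarrow> ennreal" and p :: "real^'n"
  assumes c: "slice_chart M k U \<phi>" and V: "V \<in> sets borel" "V \<subseteq> U"
    and f: "continuous_on UNIV f" and \<tau>[measurable]: "\<tau> \<in> borel_measurable borel" and \<tau>1: "\<And>u. \<bar>\<tau> u\<bar> = 1"
    and G[measurable]: "G \<in> borel_measurable borel"
    and h: "0 \<le> h"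
  defines "w \<equiv> \<lambda>u. cofactor k (jacobian_matrix \<phi> u)"
  defines "E \<equiv> {u. base_point k u \<in> V \<and> u $ k \<in> {0..h} \<and> 0 \<le> \<tau> (base_point k u) * (w (base_point k u) \<bullet> p)}"
  assumes le: "\<And>u. u \<in> E \<Longrightarrow> G (sweep k \<phi> p u) \<le> ennreal (f (\<phi> (base_point k u)))"
  shows "sweep k \<phi> p ` E \<in> sets lebesgue"
    and "(\<integral>\<^sup>+y\<in>sweep k \<phi> p ` E. G y \<partial>lebesgue)
      \<le> ennreal h * (\<integral>\<^sup>+u\<in>V. (ennreal (f (\<phi> u)) * ennreal (\<tau> u * (w u \<bullet> p))) \<partial>hyperplane_measure k)"
proof -
  note V(1)[measurable]
  \<comment> \<open>\<open>w\<close> and \<open>\<phi>\<close> are controlled only on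
    \<open>U\<close>; truncation to \<open>V\<close> makes them Borel on the whole space.\<close>
  define wI where "wI u = indicator V u *\<^sub>R w u" for u
  define fI where "fI u = indicator V u *\<^sub>R f (\<phi> u)" for u
  have [measurable]: "wI \<in> borel_measurable borel"
    unfolding wI_def w_def using V
    by (intro borel_measurable_continuous_on_indicator continuous_on_cofactor
        continuous_on_subset[OF continuous_on_jacobian[OF c]]) auto
  have [measurable]: "fI \<in> borel_measurable borel"
    unfolding fI_def using V
    by (intro borel_measurable_continuous_on_indicator continuous_on_compose2[OF f]
        continuous_on_subset[OF slice_chartD(8)[OF c]]) auto
  have E_eq: "E = {u. base_point k u \<in> V \<and> u $ k \<in> {0..h} \<and> 0 \<le> \<tau> (base_point k u) * (wI (base_point k u) \<bullet> p)}"
    unfolding E_def wI_def by (auto simp: indicator_def)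
  have E[measurable]: "E \<in> sets borel"
    unfolding E_eq by measurable
  let ?D = "\<lambda>u v. frechet_derivative \<phi> (at (base_point k u)) (base_point k v) - (v $ k) *\<^sub>R p"
  have deriv: "(sweep k \<phi> p has_derivative ?D u) (at u within E)" if "u \<in> E" for u
    using that V(2) by (intro sweep_has_derivative[OF c]) (auto simp: E_def)
  have det: "\<bar>det (matrix (?D u))\<bar> = \<tau> (base_point k u) * (wI (base_point k u) \<bullet> p)" if "u \<in> E" for u
  proof -
    have "base_point k u \<in> V" "0 \<le> \<tau> (base_point k u) * (w (base_point k u) \<bullet> p)"
      using that by (auto simp: E_def)
    moreover from this have "\<bar>det (matrix (?D u))\<bar> = \<bar>w (base_point k u) \<bullet> p\<bar>"
      unfolding w_def using V(2) by (intro det_sweep[OF c]) auto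
    moreover have "\<bar>w (base_point k u) \<bullet> p\<bar> = \<bar>\<tau> (base_point k u) * (w (base_point k u) \<bullet> p)\<bar>"
      by (simp add: abs_mult \<tau>1)
    ultimately show ?thesis by (simp add: wI_def)
  qed
  show "sweep k \<phi> p ` E \<in> sets lebesgue"
    using E deriv by (intro differentiable_image_in_sets_lebesgue) (auto simp: differentiable_on_def differentiable_def)
  have "(\<lambda>u. \<bar>det (matrix (?D u))\<bar> * indicator E u)
      = (\<lambda>u. \<tau> (base_point k u) * (wI (base_point k u) \<bullet> p) * indicator E u)"
    using det by (auto simp: indicator_def)
  then have meas: "(\<lambda>u. \<bar>det (matrix (?D u))\<bar> * indicator E u) \<in> borel_measurable borel"
    by simp
  let ?F = "\<lambda>u. indicator V u * (ennreal (fI u) * ennreal (\<tau> u * (wI u \<bullet> p)))"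
  have "(\<integral>\<^sup>+y\<in>sweep k \<phi> p ` E. G y \<partial>lebesgue)
      \<le> (\<integral>\<^sup>+u\<in>E. (G (sweep k \<phi> p u) * ennreal \<bar>det (matrix (?D u))\<bar>) \<partial>lborel)"
    by (rule nn_integral_image_le[OF E deriv meas G])
  also have "\<dots> \<le> (\<integral>\<^sup>+u. indicator {0..h} (u $ k) * ?F (base_point k u) \<partial>lborel)"
  proof (rule nn_integral_mono)
    fix u
    show "G (sweep k \<phi> p u) * ennreal \<bar>det (matrix (?D u))\<bar> * indicator E u
      \<le> indicator {0..h} (u $ k) * ?F (base_point k u)"
    proof (cases "u \<in> E")
      case True
      then have "base_point k u \<in> V" "u $ k \<in> {0..h}" by (auto simp: E_def)
      then show ?thesis
        using True by (simp add: det fI_def mult_right_mono[OF le])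
    qed simp
  qed
  also have "\<dots> = (\<integral>\<^sup>+v. (\<integral>\<^sup>+s. indicator {0..h} ((v + s *\<^sub>R axis k 1) $ k) * ?F (base_point k (v + s *\<^sub>R axis k 1)) \<partial>lborel) \<partial>hyperplane_measure k)"
    by (rule nn_integral_hyperplane) measurable
  \<comment> \<open>Almost every \<open>v\<close> has coordinate \<open>k\<close> equal to 0, so
    \<open>base_point\<close> returns \<open>v\<close> and the shifted point has coordinate exactly
    \<open>s\<close>.\<close>
  also have "\<dots> = (\<integral>\<^sup>+v. ennreal h * ?F v \<partial>hyperplane_measure k)"
  proof (rule nn_integral_cong_AE)
    show "AE v in hyperplane_measure k.
      (\<integral>\<^sup>+s. indicator {0..h} ((v + s *\<^sub>R axis k 1) $ k) * ?F (base_point k (v + s *\<^sub>R axis k 1)) \<partial>lborel) = ennreal h * ?F v"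
      using AE_hyperplane_measure
    proof eventually_elim
      case (elim v)
      have "(\<integral>\<^sup>+s. indicator {0..h} ((v + s *\<^sub>R axis k 1) $ k) * ?F (base_point k (v + s *\<^sub>R axis k 1)) \<partial>lborel)
        = (\<integral>\<^sup>+s. ?F v * indicator {0..h} s \<partial>lborel)"
        unfolding base_point_add[OF elim] by (simp add: elim axis_def mult.commute)
      also have "\<dots> = ennreal h * ?F v"
        using h by (subst nn_integral_cmult) (auto simp: mult.commute)
      finally show ?case .
    qed
  qed
  also have "\<dots> = ennreal h * (\<integral>\<^sup>+v. ?F v \<partial>hyperplane_measure k)"
    by (rule nn_integral_cmult) measurable
  also have "(\<integral>\<^sup>+v. ?F v \<partial>hyperplane_measure k)
      = (\<integral>\<^sup>+u\<in>V. (ennreal (f (\<phi> u)) * ennreal (\<tau> u * (w u \<bullet> p))) \<partial>hyperplane_measure k)"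
    by (rule nn_integral_cong) (simp add: fI_def wI_def split: split_indicator)
  finally show "(\<integral>\<^sup>+y\<in>sweep k \<phi> p ` E. G y \<partial>lebesgue)
      \<le> ennreal h * (\<integral>\<^sup>+u\<in>V. (ennreal (f (\<phi> u)) * ennreal (\<tau> u * (w u \<bullet> p))) \<partial>hyperplane_measure k)" .
qed

section \<open>Chart measures and the Gaussian flux through one chart\<close>

lemma continuous_on_chart_density:
  assumes c: "slice_chart M k U \<phi>"
  shows "continuous_on U (chart_density k \<phi>)"
  unfolding chart_density_def
proof (intro continuous_on_real_sqrt continuous_on_det)
  fix i j
  show "continuous_on U (\<lambda>u. (\<chi> i j. if i = k \<or> j = k then if i = j then 1 else 0
    else frechet_derivative \<phi> (at u) (axis i 1) \<bullet> frechet_derivative \<phi> (at u) (axis j 1)) $ i $ j)"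
    by (cases "i = k \<or> j = k") (auto intro!: continuous_on_inner slice_chartD(5)[OF c])
qed

lemma sets_chart_measure: "sets (chart_measure k U \<phi>) = sets borel"
  by (simp add: chart_measure_def)

lemma chart_measure_le_volume_measure:
  assumes "slice_chart M k U \<phi>"
  shows "sets (volume_measure M) = sets borel" "chart_measure k U \<phi> \<le> volume_measure M"
proof -
  show "sets (volume_measure M) = sets borel"
    unfolding volume_measure_def using assms by (intro sets_SUP) (auto simp: sets_chart_measure)
  show "chart_measure k U \<phi> \<le> volume_measure M"
    unfolding volume_measure_def using assms by (intro SUP_upper2[of "(k, U, \<phi>)"]) auto
qed

lemma slice_chart_image_borel:
  assumes c: "slice_chart M k U \<phi>" and V: "V \<in> sets borel" "V \<subseteq> U"
  shows "\<phi> ` V \<in> sets borel"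
proof -
  have "\<phi> ` V = inv_into U \<phi> -` V \<inter> \<phi> ` U"
    using V(2) slice_chartD(3)[OF c] by (force simp: inv_into_f_f)
  also have "\<dots> \<in> sets (restrict_space borel (\<phi> ` U))"
    using measurable_sets[OF borel_measurable_continuous_on_restrict[OF slice_chartD(9)[OF c]] V(1)]
    by (simp add: space_restrict_space)
  finally show ?thesis
    using slice_chartD(2)[OF c] by (simp add: sets_restrict_space_iff)
qed

text \<open>The volume measure is a supremum and hence dominates each chart measure; injectivity of
  the chart turns the integral over the image of \<open>V\<close> into one over
  \<open>V\<close>.\<close>

lemma nn_integral_chart_le:
  fixes \<phi> :: "real^'n::finite \<Rightarrow> real^'n"
  assumes c: "slice_chart M k U \<phi>" and V: "V \<in> sets borel" "V \<subseteq> U"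
    and f[measurable]: "f \<in> borel_measurable borel"
  shows "(\<integral>\<^sup>+u\<in>V. (f (\<phi> u) * ennreal (chart_density k \<phi> u)) \<partial>hyperplane_measure k)
    \<le> (\<integral>\<^sup>+y\<in>\<phi> ` V. f y \<partial>volume_measure M)"
proof -
  let ?H = "restrict_space (hyperplane_measure k) U"
  have U: "U \<in> sets borel" using slice_chartD(1)[OF c] by simp
  have im[measurable]: "\<phi> ` V \<in> sets borel"
    by (rule slice_chart_image_borel[OF c V])
  have sH: "sets ?H = sets (restrict_space borel U)"
    by (simp cong: sets_restrict_space_cong)
  have [measurable]: "\<phi> \<in> borel_measurable ?H"
    using borel_measurable_continuous_on_restrict[OF slice_chartD(8)[OF c]] by (simp cong: measurable_cong_sets add: sH)
  have [measurable]: "chart_density k \<phi> \<in> borel_measurable ?H"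
    using borel_measurable_continuous_on_restrict[OF continuous_on_chart_density[OF c]] by (simp cong: measurable_cong_sets add: sH)
  have "(\<integral>\<^sup>+y\<in>\<phi> ` V. f y \<partial>chart_measure k U \<phi>)
      = (\<integral>\<^sup>+u. ennreal (chart_density k \<phi> u) * (f (\<phi> u) * indicator (\<phi> ` V) (\<phi> u)) \<partial>?H)"
    unfolding chart_measure_def by (subst nn_integral_distr, simp, simp, subst nn_integral_density) auto
  also have "\<dots> = (\<integral>\<^sup>+u. ennreal (chart_density k \<phi> u) * (f (\<phi> u) * indicator (\<phi> ` V) (\<phi> u)) * indicator U u \<partial>hyperplane_measure k)"
    using U by (subst nn_integral_restrict_space) auto
  also have "\<dots> = (\<integral>\<^sup>+u\<in>V. (f (\<phi> u) * ennreal (chart_density k \<phi> u)) \<partial>hyperplane_measure k)"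
  proof (rule nn_integral_cong)
    fix u
    have "\<phi> u \<in> \<phi> ` V \<longleftrightarrow> u \<in> V" if "u \<in> U"
      using that V(2) slice_chartD(3)[OF c] by (simp add: inj_on_image_mem_iff)
    then show "ennreal (chart_density k \<phi> u) * (f (\<phi> u) * indicator (\<phi> ` V) (\<phi> u)) * indicator U u
      = f (\<phi> u) * ennreal (chart_density k \<phi> u) * indicator V u"
      using V(2) by (auto simp: mult_ac split: split_indicator)
  qed
  finally show ?thesis
    using nn_integral_mono_measure[OF _ chart_measure_le_volume_measure(2)[OF c]]
      chart_measure_le_volume_measure(1)[OF c] sets_chart_measure by metis
qed

text \<open>After the integrals are exchanged, the momentum integral at each parameter is the
  Gaussian mean of the positive part of the flux. It is at most half the length of the cofactor
  vector, and that length is at most the area density of the chart.\<close>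

lemma chart_flux_gauss:
  fixes \<phi> :: "real^'n::finite \<Rightarrow> real^'n"
  assumes c: "slice_chart M k U \<phi>" and V: "V \<in> sets borel" "V \<subseteq> U"
    and f: "continuous_on UNIV f" and \<tau>[measurable]: "\<tau> \<in> borel_measurable borel" and \<tau>1: "\<And>u. \<bar>\<tau> u\<bar> = 1"
  defines "K \<equiv> \<lambda>p. \<integral>\<^sup>+u\<in>V. (ennreal (f (\<phi> u)) * ennreal (\<tau> u * (cofactor k (jacobian_matrix \<phi> u) \<bullet> p))) \<partial>hyperplane_measure k"
  shows "K \<in> borel_measurable borel"
    "(\<integral>\<^sup>+p. ennreal (gauss p) * K p \<partial>lborel) \<le> ennreal (1 / 2) * (\<integral>\<^sup>+y\<in>\<phi> ` V. ennreal (f y) \<partial>volume_measure M)"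
proof -
  let ?H = "hyperplane_measure k"
  interpret H: sigma_finite_measure ?H by (rule sigma_finite_hyperplane_measure)
  interpret pair_sigma_finite lborel ?H by standard
  note V(1)[measurable]
  define wI where "wI u = indicator V u *\<^sub>R cofactor k (jacobian_matrix \<phi> u)" for u
  define fI where "fI u = indicator V u *\<^sub>R f (\<phi> u)" for u
  have [measurable]: "wI \<in> borel_measurable borel"
    unfolding wI_def using V
    by (intro borel_measurable_continuous_on_indicator continuous_on_cofactor
        continuous_on_subset[OF continuous_on_jacobian[OF c]]) auto
  have [measurable]: "fI \<in> borel_measurable borel"
    unfolding fI_def using V
    by (intro borel_measurable_continuous_on_indicator continuous_on_compose2[OF f]
        continuous_on_subset[OF slice_chartD(8)[OF c]]) auto
  have K: "K = (\<lambda>p. \<integral>\<^sup>+u. ennreal (fI u) * ennreal ((\<tau> u *\<^sub>R wI u) \<bullet> p) \<partial>?H)"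
    unfolding K_def by (intro ext nn_integral_cong) (simp add: fI_def wI_def split: split_indicator)
  show m: "K \<in> borel_measurable borel"
    unfolding K by measurable
  have "(\<integral>\<^sup>+p. ennreal (gauss p) * K p \<partial>lborel)
      = (\<integral>\<^sup>+p. \<integral>\<^sup>+u. ennreal (gauss p) * (ennreal (fI u) * ennreal ((\<tau> u *\<^sub>R wI u) \<bullet> p)) \<partial>?H \<partial>lborel)"
    unfolding K by (intro nn_integral_cong nn_integral_cmult[symmetric]) measurable
  also have "\<dots> = (\<integral>\<^sup>+u. \<integral>\<^sup>+p. ennreal (gauss p) * (ennreal (fI u) * ennreal ((\<tau> u *\<^sub>R wI u) \<bullet> p)) \<partial>lborel \<partial>?H)"
    by (rule Fubini'[symmetric]) measurable
  also have "\<dots> \<le> (\<integral>\<^sup>+u. ennreal (1 / 2) * ((ennreal (f (\<phi> u)) * ennreal (chart_density k \<phi> u)) * indicator V u) \<partial>?H)"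
  proof (rule nn_integral_mono)
    fix u
    have "(\<integral>\<^sup>+p. ennreal (gauss p) * (ennreal (fI u) * ennreal ((\<tau> u *\<^sub>R wI u) \<bullet> p)) \<partial>lborel)
      = ennreal (fI u) * (\<integral>\<^sup>+p. ennreal (gauss p) * ennreal ((\<tau> u *\<^sub>R wI u) \<bullet> p) \<partial>lborel)"
      by (subst nn_integral_cmult[symmetric]) (auto simp: mult_ac)
    also have "\<dots> \<le> ennreal (fI u) * ennreal (norm (\<tau> u *\<^sub>R wI u) / 2)"
      by (intro mult_left_mono nn_integral_gauss_inner_pos) simp
    also have "ennreal (norm (\<tau> u *\<^sub>R wI u) / 2) = ennreal (1 / 2) * ennreal (norm (wI u))"
      by (subst ennreal_mult'[symmetric]) (simp_all add: \<tau>1)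
    also have "ennreal (fI u) * (ennreal (1 / 2) * ennreal (norm (wI u)))
      \<le> ennreal (1 / 2) * ((ennreal (f (\<phi> u)) * ennreal (chart_density k \<phi> u)) * indicator V u)"
    proof (cases "u \<in> V")
      case True
      have "ennreal (norm (wI u)) \<le> ennreal (chart_density k \<phi> u)"
        using True norm_cofactor_jacobian_le by (simp add: wI_def)
      then have "ennreal (1 / 2) * (ennreal (f (\<phi> u)) * ennreal (norm (wI u)))
        \<le> ennreal (1 / 2) * (ennreal (f (\<phi> u)) * ennreal (chart_density k \<phi> u))"
        by (intro mult_left_mono) auto
      then show ?thesis using True by (simp add: fI_def mult_ac)
    qed (simp add: fI_def)
    finally show "(\<integral>\<^sup>+p. ennreal (gauss p) * (ennreal (fI u) * ennreal ((\<tau> u *\<^sub>R wI u) \<bullet> p)) \<partial>lborel)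
      \<le> ennreal (1 / 2) * ((ennreal (f (\<phi> u)) * ennreal (chart_density k \<phi> u)) * indicator V u)" .
  qed
  also have "\<dots> = ennreal (1 / 2) * (\<integral>\<^sup>+u\<in>V. (ennreal (f (\<phi> u)) * ennreal (chart_density k \<phi> u)) \<partial>?H)"
  proof (rule nn_integral_cmult)
    have "(\<lambda>u. indicator V u *\<^sub>R chart_density k \<phi> u) \<in> borel_measurable borel"
      using V by (intro borel_measurable_continuous_on_indicator continuous_on_subset[OF continuous_on_chart_density[OF c]]) auto
    then have "(\<lambda>u. ennreal (fI u) * ennreal (indicator V u *\<^sub>R chart_density k \<phi> u)) \<in> borel_measurable ?H"
      by measurable
    also have "(\<lambda>u. ennreal (fI u) * ennreal (indicator V u *\<^sub>R chart_density k \<phi> u))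
      = (\<lambda>u. ennreal (f (\<phi> u)) * ennreal (chart_density k \<phi> u) * indicator V u)"
      by (auto simp: fI_def split: split_indicator)
    finally show "(\<lambda>u. ennreal (f (\<phi> u)) * ennreal (chart_density k \<phi> u) * indicator V u) \<in> borel_measurable ?H" .
  qed
  also have "\<dots> \<le> ennreal (1 / 2) * (\<integral>\<^sup>+y\<in>\<phi> ` V. ennreal (f y) \<partial>volume_measure M)"
    using borel_measurable_continuous_onI[OF f]
    by (intro mult_left_mono nn_integral_chart_le[OF c V]) auto
  finally show "(\<integral>\<^sup>+p. ennreal (gauss p) * K p \<partial>lborel)
    \<le> ennreal (1 / 2) * (\<integral>\<^sup>+y\<in>\<phi> ` V. ennreal (f y) \<partial>volume_measure M)" .
qed

section \<open>Crossing a hypersurface along straight lines\<close>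

text \<open>Since \<open>R\<close> is open, the times in \<open>{0..h}\<close> spent outside
  \<open>R\<close> form a compact set, which has a least element.\<close>

lemma first_exit:
  fixes q p :: "'a::real_normed_vector"
  assumes R: "open R" "q \<in> R" and h: "0 \<le> h" "q + h *\<^sub>R p \<notin> R"
  obtains s where "0 < s" "s \<le> h" "q + s *\<^sub>R p \<notin> R" "\<And>t. 0 \<le> t \<Longrightarrow> t < s \<Longrightarrow> q + t *\<^sub>R p \<in> R"
proof -
  let ?S = "{0..h} \<inter> (\<lambda>t. q + t *\<^sub>R p) -` (- R)"
  have "closed ?S"
    using R(1) by (intro closed_Int closed_vimage closed_Compl continuous_intros) auto
  then have "compact ?S"
    using compact_Icc compact_Int_closed closed_atLeastAtMost bounded_subset[OF bounded_closed_interval, of ?S 0 h]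
    by (metis compact_eq_bounded_closed inf_le1)
  moreover have "h \<in> ?S" using h by auto
  ultimately obtain s where s: "s \<in> ?S" "\<And>t. t \<in> ?S \<Longrightarrow> s \<le> t"
    using compact_attains_inf[of ?S] by blast
  show thesis
  proof
    show "0 < s" using s(1) R(2) by (cases "s = 0") auto
    show "s \<le> h" "q + s *\<^sub>R p \<notin> R" using s(1) by auto
    show "q + t *\<^sub>R p \<in> R" if "0 \<le> t" "t < s" for t
      using that s(1) s(2)[of t] by auto
  qed
qed

text \<open>
  At most one side of the hypersurface in a chart lies in \<open>R\<close>, since otherwise
  \<open>\<phi> ` W \<subseteq> interior (closure R) = R\<close>.
\<close>

lemma chart_side:
  fixes \<phi> :: "real^'n::finite \<Rightarrow> real^'n"
  assumes c: "slice_chart M k U \<phi>" and W: "convex W" "open W" "W \<subseteq> U"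
    and R: "interior (closure R) = R" "frontier R \<subseteq> M"
  obtains \<epsilon> :: real where "\<bar>\<epsilon>\<bar> = 1"
    "\<And>u v. u \<in> W \<Longrightarrow> \<phi> u \<notin> R \<Longrightarrow> v \<in> W \<Longrightarrow> 0 < \<epsilon> * v $ k \<Longrightarrow> \<phi> v \<notin> R"
proof -
  define side where "side \<epsilon> = W \<inter> {v. 0 < \<epsilon> * v $ k}" for \<epsilon> :: real
  \<comment> \<open>Each half of \<open>W\<close> is convex, so its image is connected. If it met
    both \<open>R\<close> and the complement, it would meet \<open>frontier R\<close> and hence
    \<open>M\<close>; but the chart sends only points with coordinate \<open>k\<close> equal to 0
    into \<open>M\<close>.\<close>
  have in_or_out: "\<phi> ` side \<epsilon> \<subseteq> R" if "\<phi> ` side \<epsilon> \<inter> R \<noteq> {}" for \<epsilon>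
  proof (rule ccontr)
    assume "\<not> \<phi> ` side \<epsilon> \<subseteq> R"
    moreover have "convex {v :: real^'n. 0 < \<epsilon> * v $ k}"
      using convex_halfspace_gt[of 0 "\<epsilon> *\<^sub>R axis k (1::real) :: real^'n"] by (simp add: inner_axis' inner_real_def)
    then have "connected (\<phi> ` side \<epsilon>)"
      unfolding side_def using W
      by (intro connected_continuous_image convex_connected convex_Int continuous_on_subset[OF slice_chartD(8)[OF c]]) auto
    ultimately have "\<phi> ` side \<epsilon> \<inter> frontier R \<noteq> {}"
      using that by (intro connected_Int_frontier) auto
    then obtain v where "v \<in> side \<epsilon>" "\<phi> v \<in> M" using R(2) by auto
    then show False
      using slice_chartD(7)[OF c, of v] W(3) by (auto simp: side_def)
  qed
  \<comment> \<open>If neither sign works, both halves are mapped into \<open>R\<close> although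
    some point of \<open>W\<close> is not. If all of \<open>W\<close> is mapped into
    \<open>R\<close>, no side is excluded and the claim is vacuous.\<close>
  have "\<exists>\<epsilon>. \<bar>\<epsilon>\<bar> = 1 \<and> (\<forall>u\<in>W. \<phi> u \<notin> R \<longrightarrow> \<phi> ` side \<epsilon> \<inter> R = {})"
  proof (rule ccontr)
    assume neg: "\<not> ?thesis"
    have in_R: "\<phi> ` side 1 \<subseteq> R" "\<phi> ` side (- 1) \<subseteq> R"
      by (rule in_or_out, use neg in force)+
    from neg have "\<exists>u\<in>W. \<phi> u \<notin> R" by (metis abs_one)
    then obtain u where u: "u \<in> W" "\<phi> u \<notin> R" by blast
    have "\<phi> ` W \<subseteq> closure R"
    proof
      fix y assume "y \<in> \<phi> ` W"
      then obtain v where v: "v \<in> W" "y = \<phi> v" by auto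
      show "y \<in> closure R"
      proof (cases "v $ k = 0")
        case False
        then have "v \<in> side 1 \<or> v \<in> side (-1)" using v by (auto simp: side_def)
        then show ?thesis using in_R v closure_subset by blast
      next
        case True
        \<comment> \<open>A point on the hypersurface is approached from the positive half, which
          puts it into the closure.\<close>
        let ?g = "\<lambda>t. v + t *\<^sub>R axis k 1"
        have g: "((\<lambda>t. ?g t) \<longlongrightarrow> v) (at_right 0)"
          by (auto intro!: tendsto_eq_intros)
        then have ev: "\<forall>\<^sub>F t in at_right 0. ?g t \<in> W"
          using W(2) v(1) by (rule topological_tendstoD)
        have "isCont \<phi> v"
          using slice_chartD(4)[OF c, of v] v W by (auto intro: has_derivative_continuous)
        then have lim: "((\<lambda>t. \<phi> (?g t)) \<longlongrightarrow> y) (at_right 0)"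
          unfolding v(2) by (rule isCont_tendsto_compose[OF _ g])
        have "\<forall>\<^sub>F t in at_right 0. \<phi> (?g t) \<in> closure R"
          using ev eventually_at_right_less
        proof eventually_elim
          case (elim t)
          then have "?g t \<in> side 1" using True by (simp add: side_def axis_def)
          then show ?case using in_R closure_subset by blast
        qed
        then show ?thesis
          by (rule Lim_in_closed_set[OF closed_closure _ trivial_limit_at_right_real lim])
      qed
    qed
    moreover have "open (\<phi> ` W)"
    proof -
      have "\<phi> ` W = \<phi> ` U \<inter> inv_into U \<phi> -` W"
        using W(3) slice_chartD(3)[OF c] by (force simp: inv_into_f_f)
      then show ?thesis
        using continuous_open_preimage[OF slice_chartD(9)[OF c] slice_chartD(2)[OF c] W(2)] by simp
    qed
    ultimately have "\<phi> ` W \<subseteq> R"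
      using R(1) interior_maximal by blast
    then show False using u by blast
  qed
  then obtain \<epsilon> where "\<bar>\<epsilon>\<bar> = 1" "\<forall>u\<in>W. \<phi> u \<notin> R \<longrightarrow> \<phi> ` side \<epsilon> \<inter> R = {}" by blast
  then show thesis
    by (intro that[of \<epsilon>]) (auto simp: side_def)
qed

text \<open>Were the derivative of \<open>\<epsilon>\<close> times the chart coordinate negative
  along \<open>p\<close>, this quantity would become positive as soon as one moves backwards from
  the boundary point. The backward path would then enter the side excluded from \<open>R\<close>,
  although it runs in \<open>R\<close> up to time \<open>s\<close>.\<close>

lemma exit_sign:
  fixes \<phi> :: "real^'n::finite \<Rightarrow> real^'n"
  assumes c: "slice_chart M k U \<phi>" and W: "open W" "W \<subseteq> U"
    and u: "u \<in> W" "u $ k = 0" and \<epsilon>: "\<And>v. v \<in> W \<Longrightarrow> 0 < \<epsilon> * v $ k \<Longrightarrow> \<phi> v \<notin> R"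
    and s: "0 < s" "\<And>t. 0 < t \<Longrightarrow> t < s \<Longrightarrow> \<phi> u - t *\<^sub>R p \<in> R"
  shows "0 \<le> \<epsilon> * frechet_derivative (inv_into U \<phi>) (at (\<phi> u)) p $ k"
proof (rule ccontr)
  let ?\<psi> = "inv_into U \<phi>"
  let ?D = "frechet_derivative ?\<psi> (at (\<phi> u))"
  assume neg: "\<not> 0 \<le> \<epsilon> * ?D p $ k"
  have y: "\<phi> u \<in> \<phi> ` U" and \<psi>: "?\<psi> (\<phi> u) = u"
    using u W slice_chartD(3)[OF c] by auto
  let ?g = "\<lambda>t. \<phi> u - t *\<^sub>R p"
  have D: "(?\<psi> has_derivative ?D) (at (?g 0))"
    using slice_chartD(6)[OF c y] by simp
  have "(?g has_derivative (\<lambda>t. - (t *\<^sub>R p))) (at 0)"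
    by (auto intro!: derivative_eq_intros)
  from diff_chain_at[OF this D]
  have "((\<lambda>t. ?\<psi> (?g t)) has_derivative (\<lambda>t. ?D (- (t *\<^sub>R p)))) (at 0)"
    by (simp add: o_def)
  moreover have "linear ?D" using D by (rule has_derivative_linear)
  ultimately have d: "((\<lambda>t. ?\<psi> (?g t)) has_derivative (\<lambda>t. - (t *\<^sub>R ?D p))) (at 0)"
    by (simp add: linear_neg linear_scale)
  have "((\<lambda>t. \<epsilon> * ?\<psi> (?g t) $ k) has_derivative (\<lambda>t. \<epsilon> * (- (t *\<^sub>R ?D p)) $ k)) (at 0)"
    by (intro has_derivative_mult_right bounded_linear.has_derivative[OF bounded_linear_vec_nth d])
  moreover have "(\<lambda>t. \<epsilon> * (- (t *\<^sub>R ?D p)) $ k) = (*) (- (\<epsilon> * ?D p $ k))"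
    by (simp add: fun_eq_iff)
  ultimately have "((\<lambda>t. \<epsilon> * ?\<psi> (?g t) $ k) has_real_derivative - (\<epsilon> * ?D p $ k)) (at 0)"
    by (simp only: has_field_derivative_def)
  from has_real_derivative_pos_inc_right[OF this] neg obtain d where d0: "0 < d"
    and pos: "\<And>t. 0 < t \<Longrightarrow> t < d \<Longrightarrow> 0 < \<epsilon> * ?\<psi> (?g t) $ k"
    using u(2) \<psi> by auto
  have lim: "(?g \<longlongrightarrow> \<phi> u) (at_right 0)"
    by (auto intro!: tendsto_eq_intros)
  have "isCont ?\<psi> (\<phi> u)"
    using slice_chartD(6)[OF c y] by (rule has_derivative_continuous)
  then have "((\<lambda>t. ?\<psi> (?g t)) \<longlongrightarrow> ?\<psi> (\<phi> u)) (at_right 0)"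
    by (rule isCont_tendsto_compose[OF _ lim])
  then have "\<forall>\<^sub>F t in at_right 0. ?\<psi> (?g t) \<in> W"
    using W(1) u(1) unfolding \<psi> by (rule topological_tendstoD)
  moreover have "\<forall>\<^sub>F t in at_right 0. ?g t \<in> \<phi> ` U"
    using lim slice_chartD(2)[OF c] y by (rule topological_tendstoD)
  moreover have "\<forall>\<^sub>F t in at_right (0::real). t \<in> {0<..<min d s}"
    using d0 s(1) by (intro eventually_at_right_real) simp
  ultimately have "\<forall>\<^sub>F t in at_right (0::real). False"
  proof eventually_elim
    case (elim t)
    have "\<phi> (?\<psi> (?g t)) \<notin> R"
      using elim pos by (intro \<epsilon>) auto
    then show False
      using elim s(2) by (simp add: f_inv_into_f)
  qed
  then show False by simp
qed

text \<open>In Cramer's rule the determinant may have either sign, so its sign has to be merged with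
  the side \<open>\<epsilon>\<close>. This determines the choice of \<open>\<tau>\<close> in
  \<open>boundary_flux\<close>.\<close>

lemma sign_cofactor_exit:
  fixes \<phi> :: "real^'n::finite \<Rightarrow> real^'n"
  assumes c: "slice_chart M k U \<phi>" and W: "open W" "W \<subseteq> U"
    and u: "u \<in> W" "u $ k = 0" and \<epsilon>: "\<And>v. v \<in> W \<Longrightarrow> 0 < \<epsilon> * v $ k \<Longrightarrow> \<phi> v \<notin> R"
    and s: "0 < s" "\<And>t. 0 < t \<Longrightarrow> t < s \<Longrightarrow> \<phi> u - t *\<^sub>R p \<in> R"
  shows "0 \<le> (if 0 \<le> det (jacobian_matrix \<phi> u) then \<epsilon> else - \<epsilon>) * (cofactor k (jacobian_matrix \<phi> u) \<bullet> p)"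
proof -
  let ?d = "det (jacobian_matrix \<phi> u)" and ?x = "frechet_derivative (inv_into U \<phi>) (at (\<phi> u)) p $ k"
  have "0 \<le> \<epsilon> * ?x"
    by (rule exit_sign[OF c W u \<epsilon> s])
  then have "0 \<le> (\<epsilon> * ?x) * \<bar>?d\<bar>" by simp
  also have "\<dots> = (if 0 \<le> ?d then \<epsilon> else - \<epsilon>) * (?x * ?d)"
    by simp
  also have "?x * ?d = cofactor k (jacobian_matrix \<phi> u) \<bullet> p"
    using u W by (intro cofactor_inner_eq[OF c, symmetric]) auto
  finally show ?thesis .
qed

section \<open>Assembling the flux from countably many charts\<close>

text \<open>The Lindelof property makes the cover countable. The sets \<open>W\<close> are convex so
  that their two halves in \<open>chart_side\<close> are connected.\<close>

lemma embedded_hypersurface_cover: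
  fixes M :: "(real^'n::finite) set"
  assumes M: "embedded_hypersurface M" "M \<noteq> {}"
  obtains k U \<phi> W where
    "\<And>i::nat. slice_chart M (k i) (U i) (\<phi> i)" "\<And>i. convex (W i)" "\<And>i. open (W i)" "\<And>i. W i \<subseteq> U i"
    "M \<subseteq> (\<Union>i. \<phi> i ` W i)"
proof -
  define P where "P A \<longleftrightarrow> (\<exists>k U \<phi> W. slice_chart M k U \<phi> \<and> convex W \<and> open W \<and> W \<subseteq> U \<and> A = \<phi> ` W)" for A
  have op: "open A" if A: "P A" for A
  proof -
    from A obtain k U \<phi> W where c: "slice_chart M k U \<phi>" and W: "open W" "W \<subseteq> U" "A = \<phi> ` W"
      unfolding P_def by blast
    have "A = \<phi> ` U \<inter> inv_into U \<phi> -` W"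
      using W slice_chartD(3)[OF c] by (force simp: inv_into_f_f)
    then show ?thesis
      using continuous_open_preimage[OF slice_chartD(9)[OF c] slice_chartD(2)[OF c] W(1)] by simp
  qed
  have cov: "\<exists>A. P A \<and> x \<in> A" if "x \<in> M" for x
  proof -
    obtain k U \<phi> u where c: "slice_chart M k U \<phi>" and u: "u \<in> U" "x = \<phi> u"
      using M(1) \<open>x \<in> M\<close> unfolding embedded_hypersurface_def by blast
    obtain r where r: "0 < r" "ball u r \<subseteq> U"
      using slice_chartD(1)[OF c] u(1) open_contains_ball by blast
    have "P (\<phi> ` ball u r)"
      unfolding P_def using c r by (intro exI[of _ k] exI[of _ U] exI[of _ \<phi>] exI[of _ "ball u r"]) auto
    then show ?thesis using u r(1) by (intro exI[of _ "\<phi> ` ball u r"]) auto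
  qed
  obtain F where F: "F \<subseteq> {A. P A}" "countable F" "\<Union>F = \<Union>{A. P A}"
    using Lindelof[of "{A. P A}"] op by auto
  obtain x A where "x \<in> M" "P A" "x \<in> A" using cov M(2) by blast
  then have "x \<in> \<Union>F" unfolding F(3) by blast
  then have "F \<noteq> {}" by blast
  define A where "A = from_nat_into F"
  have rA: "range A = F"
    unfolding A_def using F(2) \<open>F \<noteq> {}\<close> by (rule range_from_nat_into[rotated])
  have "\<forall>i. \<exists>k U \<phi> W. slice_chart M k U \<phi> \<and> convex W \<and> open W \<and> W \<subseteq> U \<and> A i = \<phi> ` W"
    using rA F(1) unfolding P_def by blast
  then obtain k U \<phi> W where *: "\<And>i. slice_chart M (k i) (U i) (\<phi> i)" "\<And>i. convex (W i)" "\<And>i. open (W i)"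
    "\<And>i. W i \<subseteq> U i" "\<And>i. A i = \<phi> i ` W i"
    by metis
  have "M \<subseteq> \<Union>(range A)"
    unfolding rA F(3) using cov by blast
  then have "M \<subseteq> (\<Union>i. \<phi> i ` W i)"
    using *(5) by simp
  with * show thesis by (intro that)
qed

lemma slice_chart_vimage_borel:
  assumes c: "slice_chart M k U \<phi>" and W: "W \<in> sets borel" "W \<subseteq> U" and B: "B \<in> sets borel"
  shows "W \<inter> \<phi> -` B \<in> sets borel"
proof -
  have "U \<inter> \<phi> -` B \<in> sets (restrict_space borel U)"
    using measurable_sets[OF borel_measurable_continuous_on_restrict[OF slice_chartD(8)[OF c]] B]
    by (simp add: space_restrict_space Int_commute)
  then have "U \<inter> \<phi> -` B \<in> sets borel"
    using slice_chartD(1)[OF c] by (simp add: sets_restrict_space_iff)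
  then have "W \<inter> (U \<inter> \<phi> -` B) \<in> sets borel"
    using W(1) by simp
  then show ?thesis
    using W(2) by (simp add: Int_absorb2 flip: Int_assoc)
qed

lemma borel_measurable_chart_sign:
  assumes c: "slice_chart M k U \<phi>"
  shows "(\<lambda>u. if 0 \<le> indicator U u *\<^sub>R det (jacobian_matrix \<phi> u) then a else b) \<in> borel_measurable borel"
proof -
  have [measurable]: "(\<lambda>u. indicator U u *\<^sub>R det (jacobian_matrix \<phi> u)) \<in> borel_measurable borel"
    using slice_chartD(1)[OF c]
    by (intro borel_measurable_continuous_on_indicator continuous_on_det continuous_on_jacobian[OF c]) auto
  show ?thesis by measurable
qed

text \<open>The first exit point of a drift that leaves \<open>R\<close> lies on \<open>M\<close>,
  and \<open>p\<close> points outward there; so the points with nonzero \<open>G\<close> lie in the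
  union of the swept sets. Cutting \<open>M\<close> into disjoint pieces, each within one chart,
  lets the pieces add up to the integral over \<open>M\<close>. \<open>G\<close> will be
  instantiated with the infimum of the density along the drift, which is at most the value of
  \<open>f\<close> at the exit point.\<close>

lemma boundary_flux:
  fixes M R :: "(real^'n::finite) set" and f :: "real^'n \<Rightarrow> real" and G :: "real^'n \<Rightarrow> real^'n \<Rightarrow> ennreal"
  assumes M: "embedded_hypersurface M" "closed M"
    and R: "open R" "interior (closure R) = R" "frontier R \<subseteq> M"
    and h: "0 < h" and f: "continuous_on UNIV f"
    and G: "\<And>p. (\<lambda>q. G q p) \<in> borel_measurable borel"
    and Gle: "\<And>q p s. s \<in> {0..h} \<Longrightarrow> G q p \<le> ennreal (f (q + s *\<^sub>R p))"
    and G0: "\<And>q p. G q p \<noteq> 0 \<Longrightarrow> q \<in> R \<and> q + h *\<^sub>R p \<notin> R"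
  shows "(\<integral>\<^sup>+p. ennreal (gauss p) * (\<integral>\<^sup>+q. G q p \<partial>lborel) \<partial>lborel)
    \<le> ennreal (h / 2) * (\<integral>\<^sup>+y\<in>M. ennreal (f y) \<partial>volume_measure M)"
proof (cases "M = {}")
  case True
  \<comment> \<open>Without a frontier, \<open>R\<close> is empty or the whole space, and no drift
    leaves it.\<close>
  have "G q p = 0" for q p
  proof (rule ccontr)
    assume "G q p \<noteq> 0"
    with G0 have "q \<in> R" "q + h *\<^sub>R p \<notin> R" by auto
    then show False
      using R(1,3) True connected_Int_frontier[OF connected_UNIV, of R] by auto
  qed
  then show ?thesis by simp
next
  case False
  obtain k U \<phi> W where c: "\<And>i::nat. slice_chart M (k i) (U i) (\<phi> i)"
    and W: "\<And>i. convex (W i)" "\<And>i. open (W i)" "\<And>i. W i \<subseteq> U i"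
    and cover: "M \<subseteq> (\<Union>i. \<phi> i ` W i)"
    by (rule embedded_hypersurface_cover[OF M(1) False]) (rule that)
  define B where "B i = disjointed (\<lambda>i. \<phi> i ` W i) i \<inter> M" for i
  have im: "\<phi> i ` W i \<in> sets borel" for i
    by (rule slice_chart_image_borel[OF c]) (use W in auto)
  have B[measurable]: "B i \<in> sets borel" for i
  proof -
    have "range (disjointed (\<lambda>i. \<phi> i ` W i)) \<subseteq> sets borel"
      by (rule sets.range_disjointed_sets) (use im in blast)
    then have "disjointed (\<lambda>i. \<phi> i ` W i) i \<in> sets borel" by blast
    then show ?thesis
      unfolding B_def using M(2) by (intro sets.Int) auto
  qed
  have BW: "B i \<subseteq> \<phi> i ` W i" for i
    unfolding B_def using disjointed_subset by fast
  have UB: "(\<Union>i. B i) = M"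
  proof -
    have "(\<Union>i. B i) = (\<Union>i. disjointed (\<lambda>i. \<phi> i ` W i) i) \<inter> M"
      unfolding B_def by blast
    also have "\<dots> = (\<Union>i. \<phi> i ` W i) \<inter> M"
      by (simp only: UN_disjointed_eq)
    also have "\<dots> = M"
      using cover by (rule Int_absorb1)
    finally show ?thesis .
  qed
  have disj: "disjoint_family B"
    using disjoint_family_disjointed[of "\<lambda>i. \<phi> i ` W i"] unfolding B_def disjoint_family_on_def by blast
  define V where "V i = W i \<inter> \<phi> i -` B i" for i
  have V: "V i \<in> sets borel" "V i \<subseteq> U i" for i
    unfolding V_def using W by (auto intro!: slice_chart_vimage_borel[OF c])
  have imV: "\<phi> i ` V i = B i" for i
    unfolding V_def using BW by blast
  have "\<exists>e :: real. \<bar>e\<bar> = 1 \<and> (\<forall>u v. u \<in> W i \<longrightarrow> \<phi> i u \<notin> R \<longrightarrow> v \<in> W i \<longrightarrow> 0 < e * v $ k i \<longrightarrow> \<phi> i v \<notin> R)" for i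
    by (rule chart_side[OF c W R(2,3)]) blast
  then obtain e :: "nat \<Rightarrow> real" where e: "\<And>i. \<bar>e i\<bar> = 1"
    "\<And>i u v. u \<in> W i \<Longrightarrow> \<phi> i u \<notin> R \<Longrightarrow> v \<in> W i \<Longrightarrow> 0 < e i * v $ k i \<Longrightarrow> \<phi> i v \<notin> R"
    by metis
  \<comment> \<open>The sign from \<open>sign_cofactor_exit\<close>; the indicator makes it Borel on
    the whole space and has no effect on \<open>U i\<close>.\<close>
  define \<tau> where "\<tau> i u = (if 0 \<le> indicator (U i) u *\<^sub>R det (jacobian_matrix (\<phi> i) u) then e i else - e i)" for i u
  have \<tau>: "\<tau> i \<in> borel_measurable borel" "\<bar>\<tau> i u\<bar> = 1" for i u
  proof -
    show "\<tau> i \<in> borel_measurable borel"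
      unfolding \<tau>_def[abs_def] by (rule borel_measurable_chart_sign[OF c])
    show "\<bar>\<tau> i u\<bar> = 1"
      using e(1)[of i] by (simp add: \<tau>_def)
  qed
  define w where "w i u = cofactor (k i) (jacobian_matrix (\<phi> i) u)" for i u
  define E where "E i p = {u. base_point (k i) u \<in> V i \<and> u $ k i \<in> {0..h} \<and>
    0 \<le> \<tau> i (base_point (k i) u) * (w i (base_point (k i) u) \<bullet> p)}" for i p
  define K where "K i p = (\<integral>\<^sup>+u\<in>V i. (ennreal (f (\<phi> i u)) * ennreal (\<tau> i u * (w i u \<bullet> p))) \<partial>hyperplane_measure (k i))" for i p
  define \<Theta> where "\<Theta> i p = sweep (k i) (\<phi> i) p" for i p
  have sweep_le: "\<Theta> i p ` E i p \<in> sets lebesgue"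
    "(\<integral>\<^sup>+y\<in>\<Theta> i p ` E i p. G y p \<partial>lebesgue) \<le> ennreal h * K i p" for i p
  proof -
    have le: "G (sweep (k i) (\<phi> i) p u) p \<le> ennreal (f (\<phi> i (base_point (k i) u)))" if "u \<in> E i p" for u
      using Gle[of "u $ k i" "sweep (k i) (\<phi> i) p u" p] that by (simp add: E_def sweep_def)
    show "\<Theta> i p ` E i p \<in> sets lebesgue"
      unfolding \<Theta>_def E_def w_def
      by (rule chart_sweep(1)[OF c[of i] V[of i] f \<tau>[of i] G[of p] less_imp_le[OF h]], rule le)
        (unfold E_def w_def, assumption)
    show "(\<integral>\<^sup>+y\<in>\<Theta> i p ` E i p. G y p \<partial>lebesgue) \<le> ennreal h * K i p"
      unfolding \<Theta>_def E_def K_def w_def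
      by (rule chart_sweep(2)[OF c[of i] V[of i] f \<tau>[of i] G[of p] less_imp_le[OF h]], rule le)
        (unfold E_def w_def, assumption)
  qed
  have K: "K i \<in> borel_measurable borel"
    "(\<integral>\<^sup>+p. ennreal (gauss p) * K i p \<partial>lborel) \<le> ennreal (1 / 2) * (\<integral>\<^sup>+y\<in>B i. ennreal (f y) \<partial>volume_measure M)" for i
    using chart_flux_gauss[OF c V f \<tau>, of i i] unfolding K_def[abs_def] w_def imV by auto
  \<comment> \<open>With \<open>u\<close> the chart parameter of the first exit point and
    \<open>s\<close> the exit time, shifting \<open>u\<close> by \<open>s\<close> in direction
    \<open>k i\<close> gives the parameter that the sweep maps to \<open>q\<close>.\<close>
  have exit: "\<exists>i. q \<in> \<Theta> i p ` E i p" if "G q p \<noteq> 0" for q p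
  proof -
    have q: "q \<in> R" "q + h *\<^sub>R p \<notin> R" using G0[OF that] by auto
    obtain s where s: "0 < s" "s \<le> h" "q + s *\<^sub>R p \<notin> R" "\<And>t. 0 \<le> t \<Longrightarrow> t < s \<Longrightarrow> q + t *\<^sub>R p \<in> R"
      using first_exit[OF R(1) q(1) less_imp_le[OF h] q(2)] by metis
    let ?y = "q + s *\<^sub>R p"
    have lim: "((\<lambda>t. q + t *\<^sub>R p) \<longlongrightarrow> ?y) (at_left s)"
      by (auto intro!: tendsto_eq_intros)
    have "\<forall>\<^sub>F t in at_left s. q + t *\<^sub>R p \<in> closure R"
      using eventually_at_left_real[OF s(1)] by eventually_elim (use s(4) in \<open>simp add: closure_def\<close>)
    then have "?y \<in> closure R"
      by (rule Lim_in_closed_set[OF closed_closure _ trivial_limit_at_left_real lim])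
    then have "?y \<in> M"
      using R(1,3) s(3) by (auto simp: frontier_def interior_open)
    then obtain i where "?y \<in> B i" using UB by blast
    then obtain u where u: "u \<in> V i" "?y = \<phi> i u" using imV by blast
    have u0: "u $ k i = 0"
      using slice_chartD(7)[OF c, of u i] u V(2) \<open>?y \<in> M\<close> by auto
    have uW: "u \<in> W i" using u(1) by (simp add: V_def)
    have "0 \<le> (if 0 \<le> det (jacobian_matrix (\<phi> i) u) then e i else - e i) * (w i u \<bullet> p)"
      unfolding w_def
    proof (rule sign_cofactor_exit[OF c W(2,3) uW u0 _ s(1)])
      show "\<phi> i v \<notin> R" if "v \<in> W i" "0 < e i * v $ k i" for v
        using e(2)[OF uW _ that] s(3) u(2) by simp
      show "\<phi> i u - t *\<^sub>R p \<in> R" if "0 < t" "t < s" for t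
        unfolding u(2)[symmetric] using s(4)[of "s - t"] that by (simp add: algebra_simps)
    qed
    moreover have "u \<in> U i" using u(1) V(2) by blast
    ultimately have "0 \<le> \<tau> i u * (w i u \<bullet> p)"
      by (simp add: \<tau>_def)
    then have "u + s *\<^sub>R axis (k i) 1 \<in> E i p"
      using u(1) s u0 unfolding E_def mem_Collect_eq base_point_add[OF u0] by (simp add: axis_def)
    moreover have "\<Theta> i p (u + s *\<^sub>R axis (k i) 1) = q"
      unfolding \<Theta>_def sweep_def base_point_add[OF u0] by (simp add: u0 axis_def flip: u(2))
    ultimately show ?thesis by (metis imageI)
  qed
  have le: "(\<integral>\<^sup>+q. G q p \<partial>lborel) \<le> (\<Sum>i. ennreal h * K i p)" for p
  proof -
    have Gm: "(\<lambda>q. G q p) \<in> borel_measurable lebesgue"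
      using G by (simp add: measurable_completion)
    have "(\<integral>\<^sup>+q. G q p \<partial>lborel) = (\<integral>\<^sup>+q. G q p \<partial>lebesgue)"
      by (simp add: nn_integral_completion)
    also have "\<dots> \<le> (\<integral>\<^sup>+q. (\<Sum>i. G q p * indicator (\<Theta> i p ` E i p) q) \<partial>lebesgue)"
    proof (rule nn_integral_mono)
      fix q
      show "G q p \<le> (\<Sum>i. G q p * indicator (\<Theta> i p ` E i p) q)"
      proof (cases "G q p = 0")
        case False
        then obtain i where i: "q \<in> \<Theta> i p ` E i p" using exit by blast
        have "G q p = (\<Sum>j\<in>{i}. G q p * indicator (\<Theta> j p ` E j p) q)"
          using i by simp
        also have "\<dots> \<le> (\<Sum>i. G q p * indicator (\<Theta> i p ` E i p) q)"
          by (rule sum_le_suminf) auto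
        finally show ?thesis .
      qed simp
    qed
    also have "\<dots> = (\<Sum>i. \<integral>\<^sup>+q\<in>\<Theta> i p ` E i p. G q p \<partial>lebesgue)"
      using Gm sweep_le(1) by (intro nn_integral_suminf borel_measurable_times_ennreal borel_measurable_indicator) auto
    also have "\<dots> \<le> (\<Sum>i. ennreal h * K i p)"
      using sweep_le(2) by (intro suminf_le) auto
    finally show ?thesis .
  qed
  note K(1)[measurable]
  have vol: "sets (volume_measure M) = sets borel"
    by (rule chart_measure_le_volume_measure(1)[OF c])
  have "(\<integral>\<^sup>+p. ennreal (gauss p) * (\<integral>\<^sup>+q. G q p \<partial>lborel) \<partial>lborel)
      \<le> (\<integral>\<^sup>+p. ennreal (gauss p) * (\<Sum>i. ennreal h * K i p) \<partial>lborel)"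
    by (intro nn_integral_mono mult_left_mono le) simp
  also have "\<dots> = (\<integral>\<^sup>+p. (\<Sum>i. ennreal h * (ennreal (gauss p) * K i p)) \<partial>lborel)"
    by (intro nn_integral_cong) (simp only: ennreal_suminf_cmult[symmetric] mult.left_commute)
  also have "\<dots> = (\<Sum>i. \<integral>\<^sup>+p. ennreal h * (ennreal (gauss p) * K i p) \<partial>lborel)"
    by (intro nn_integral_suminf) measurable
  also have "\<dots> = (\<Sum>i. ennreal h * (\<integral>\<^sup>+p. ennreal (gauss p) * K i p \<partial>lborel))"
    by (intro suminf_cong nn_integral_cmult) measurable
  also have "\<dots> \<le> (\<Sum>i. ennreal h * (ennreal (1 / 2) * (\<integral>\<^sup>+y\<in>B i. ennreal (f y) \<partial>volume_measure M)))"
    using K(2) by (intro suminf_le mult_left_mono) auto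
  also have "\<dots> = ennreal (h / 2) * (\<Sum>i. \<integral>\<^sup>+y\<in>B i. ennreal (f y) \<partial>volume_measure M)"
  proof -
    have "ennreal h * ennreal (1 / 2) = ennreal (h / 2)"
      using h by (subst ennreal_mult'[symmetric]) auto
    then show ?thesis
      by (simp only: ennreal_suminf_cmult mult.assoc[symmetric])
  qed
  also have "(\<Sum>i. \<integral>\<^sup>+y\<in>B i. ennreal (f y) \<partial>volume_measure M)
      = (\<integral>\<^sup>+y. (\<Sum>i. ennreal (f y) * indicator (B i) y) \<partial>volume_measure M)"
    using borel_measurable_continuous_onI[OF f] B
    by (intro nn_integral_suminf[symmetric]) (simp add: measurable_cong_sets[OF vol refl])
  also have "\<dots> = (\<integral>\<^sup>+y\<in>M. ennreal (f y) \<partial>volume_measure M)"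
    by (intro nn_integral_cong) (simp add: ennreal_suminf_cmult suminf_indicator[OF disj] UB)
  finally show ?thesis .
qed

section \<open>The symplectic Euler scheme\<close>

text \<open>The mean value inequality for \<open>F\<close> minus its linear prediction; it yields
  the consistency error of one Euler step.\<close>

lemma increment_bound:
  fixes F :: "real \<Rightarrow> 'a::real_normed_vector"
  assumes "a \<le> b"
    and F: "\<And>s. s \<in> {a..b} \<Longrightarrow> (F has_vector_derivative F' s) (at s within {a..b})"
    and bound: "\<And>s. s \<in> {a..b} \<Longrightarrow> norm (F' s - c) \<le> \<omega>"
  shows "norm (F b - F a - (b - a) *\<^sub>R c) \<le> (b - a) * \<omega>"
proof -
  have "norm ((F b - b *\<^sub>R c) - (F a - a *\<^sub>R c)) \<le> \<omega> * norm (b - a)"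
  proof (rule differentiable_bound[of "{a..b}" "\<lambda>s. F s - s *\<^sub>R c" "\<lambda>s x. x *\<^sub>R (F' s - c)"])
    fix s assume s: "s \<in> {a..b}"
    have "((\<lambda>s. F s - s *\<^sub>R c) has_vector_derivative F' s - c) (at s within {a..b})"
      by (auto intro!: derivative_eq_intros F[OF s])
    then show "((\<lambda>s. F s - s *\<^sub>R c) has_derivative (\<lambda>x. x *\<^sub>R (F' s - c))) (at s within {a..b})"
      by (simp add: has_vector_derivative_def)
    show "onorm (\<lambda>x. x *\<^sub>R (F' s - c)) \<le> \<omega>"
    proof (rule onorm_le)
      show "norm (x *\<^sub>R (F' s - c)) \<le> \<omega> * norm x" for x :: real
        using mult_right_mono[OF bound[OF s], of "\<bar>x\<bar>"] by (simp add: mult.commute)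
    qed
  qed (use \<open>a \<le> b\<close> in auto)
  then show ?thesis
    using \<open>a \<le> b\<close> by (simp add: algebra_simps)
qed

text \<open>The force \<open>g\<close> is evaluated at the position already updated. With the old
  position the step would in general not preserve volume.\<close>

definition euler_step :: "('a::real_vector \<Rightarrow> 'a) \<Rightarrow> real \<Rightarrow> 'a \<times> 'a \<Rightarrow> 'a \<times> 'a"
  where "euler_step g h z = (let q = fst z + h *\<^sub>R snd z in (q, snd z + h *\<^sub>R g q))"

lemma fst_euler_step: "fst (euler_step g h z) = fst z + h *\<^sub>R snd z"
  and snd_euler_step: "snd (euler_step g h z) = snd z + h *\<^sub>R g (fst z + h *\<^sub>R snd z)"
  by (simp_all add: euler_step_def Let_def)

text \<open>\<open>e\<close> and \<open>f\<close> are the errors in position and momentum, and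
  \<open>\<omega>\<close> is the consistency error per unit time. The constant 3 counts the terms
  \<open>h * f\<close>, \<open>h * L * e\<close> and \<open>h^2 * L * f\<close>, each at most
  \<open>h * L * X\<close>; likewise \<open>2 * h + h^2 * L\<close> is at most
  \<open>3 * h * L\<close>.\<close>

lemma euler_error_step:
  fixes e f L h \<omega> X :: real
  assumes e': "e' \<le> e + h * f + h * \<omega>" and f': "f' \<le> f + h * (L * e') + h * \<omega>"
    and X: "e + f \<le> X" and nn: "0 \<le> e" "0 \<le> f" "0 \<le> \<omega>" "0 \<le> h" "h \<le> 1" "1 \<le> L"
  shows "e' + f' \<le> (1 + 3 * L * h) * X + 3 * L * h * \<omega>"
proof -
  have X0: "0 \<le> X" using X nn by linarith
  have hL: "h \<le> h * L" "0 \<le> h * L" using nn by (auto simp: mult_le_cancel_left1)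
  have "e' + f' \<le> (1 + h * L) * e' + f + h * \<omega>"
    using f' by (simp add: algebra_simps)
  also have "\<dots> \<le> (1 + h * L) * (e + h * f + h * \<omega>) + f + h * \<omega>"
    using e' hL by (intro add_right_mono mult_left_mono) auto
  also have "\<dots> = (e + f) + h * f + h * L * e + (h * L * h) * f + (2 * h + h * L * h) * \<omega>"
    by (simp add: algebra_simps)
  also have "\<dots> \<le> X + h * L * X + h * L * X + h * L * X + 3 * (h * L) * \<omega>"
  proof -
    have "e \<le> X" "f \<le> X" using X nn by auto
    then have "h * f \<le> h * L * X" by (intro mult_mono hL nn)
    moreover have "h * L * e \<le> h * L * X" using \<open>e \<le> X\<close> hL(2) by (rule mult_left_mono)
    moreover have hLh: "h * L * h \<le> h * L" using nn(5) hL(2) by (rule mult_left_le)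
    then have "(h * L * h) * f \<le> h * L * X" using \<open>f \<le> X\<close> hL(2) nn(2) by (rule mult_mono)
    moreover have "(2 * h + h * L * h) * \<omega> \<le> 3 * (h * L) * \<omega>"
      using hL(1) hLh nn(3) by (intro mult_right_mono) linarith
    ultimately show ?thesis using X by linarith
  qed
  also have "\<dots> = (1 + 3 * L * h) * X + 3 * L * h * \<omega>"
    by (simp add: algebra_simps)
  finally show ?thesis .
qed

text \<open>A discrete Gronwall argument. The force is Lipschitz only in a tube of radius
  \<open>\<delta>\<close> around the exact path, so the induction bounds the error by
  \<open>min \<eta> \<delta>\<close> and thereby keeps the discrete positions in the tube.\<close>

lemma euler_converges:
  fixes g :: "'a::real_normed_vector \<Rightarrow> 'a" and P Q :: "real \<Rightarrow> 'a"
  assumes T: "0 < T" and \<delta>: "0 < \<delta>"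
    and Q: "\<And>t. t \<in> {0..T} \<Longrightarrow> (Q has_vector_derivative P t) (at t within {0..T})"
    and P: "\<And>t. t \<in> {0..T} \<Longrightarrow> (P has_vector_derivative g (Q t)) (at t within {0..T})"
    and gQ: "continuous_on {0..T} (\<lambda>t. g (Q t))"
    and lip: "\<And>t x. t \<in> {0..T} \<Longrightarrow> norm (x - Q t) \<le> \<delta> \<Longrightarrow> norm (g x - g (Q t)) \<le> L * norm (x - Q t)"
    and L: "1 \<le> L" and \<eta>: "0 < \<eta>"
  shows "\<forall>\<^sub>F N in sequentially. \<forall>k\<le>N.
    norm (fst ((euler_step g (T / real N) ^^ k) (Q 0, P 0)) - Q (real k * (T / real N)))
    + norm (snd ((euler_step g (T / real N) ^^ k) (Q 0, P 0)) - P (real k * (T / real N))) \<le> \<eta>"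
proof -
  \<comment> \<open>Chosen so that the accumulated error, at most
    \<open>\<omega> * exp (3 * L * T)\<close>, does not exceed
    \<open>min \<eta> \<delta>\<close>.\<close>
  define \<omega> where "\<omega> = min \<eta> \<delta> / exp (3 * L * T)"
  have \<omega>: "0 < \<omega>" "\<omega> * exp (3 * L * T) = min \<eta> \<delta>" using \<eta> \<delta> by (auto simp: \<omega>_def)
  have cP: "continuous_on {0..T} P"
    using P by (rule continuous_on_vector_derivative)
  have "uniformly_continuous_on {0..T} P" "uniformly_continuous_on {0..T} (\<lambda>t. g (Q t))"
    using cP gQ by (auto intro: compact_uniformly_continuous)
  then obtain d1 d2 where d: "0 < d1" "0 < d2"
    and d1: "\<And>s t. s \<in> {0..T} \<Longrightarrow> t \<in> {0..T} \<Longrightarrow> \<bar>s - t\<bar> < d1 \<Longrightarrow> norm (P s - P t) < \<omega>"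
    and d2: "\<And>s t. s \<in> {0..T} \<Longrightarrow> t \<in> {0..T} \<Longrightarrow> \<bar>s - t\<bar> < d2 \<Longrightarrow> norm (g (Q s) - g (Q t)) < \<omega>"
    using \<omega>(1) unfolding uniformly_continuous_on_def dist_norm real_norm_def by metis
  have "(\<lambda>N. T / real N) \<longlonglongrightarrow> 0"
    by (rule lim_const_over_n)
  then have "\<forall>\<^sub>F N in sequentially. T / real N < min 1 (min d1 d2)"
    using d by (intro order_tendstoD) auto
  then show ?thesis
    using eventually_gt_at_top[of 0]
  proof eventually_elim
    case (elim N)
    define h where "h = T / real N"
    have h: "0 < h" "h \<le> 1" "h < d1" "h < d2" using elim T by (auto simp: h_def)
    define z where "z k = (euler_step g h ^^ k) (Q 0, P 0)" for k
    define e where "e k = norm (fst (z k) - Q (real k * h))" for k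
    define f where "f k = norm (snd (z k) - P (real k * h))" for k
    \<comment> \<open>A majorant of the recursion in \<open>euler_error_step\<close>: with
      \<open>a = 3 * L * h\<close>, the bound \<open>1 + a \<le> exp a\<close> gives
      \<open>(1 + a) * X k + a * \<omega> \<le> X (Suc k)\<close>.\<close>
    define X where "X k = \<omega> * (exp (3 * L * h * real k) - 1)" for k
    have kT: "real k * h \<in> {0..T}" if "k \<le> N" for k
    proof -
      have "real k * h \<le> real N * h" using that h by (intro mult_right_mono) auto
      also have "real N * h = T" using elim by (simp add: h_def)
      finally show ?thesis using h by simp
    qed
    have XT: "X k \<le> min \<eta> \<delta>" if "k \<le> N" for k
    proof -
      have "X k \<le> \<omega> * exp (3 * L * h * real k)" using \<omega>(1) by (simp add: X_def)
      also have "\<dots> \<le> \<omega> * exp (3 * L * T)"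
        using \<omega>(1) kT[OF that] L by (simp add: mult_ac mult_left_mono)
      finally show ?thesis using \<omega>(2) by simp
    qed
    have "e k + f k \<le> X k" if "k \<le> N" for k
      using that
    proof (induction k)
      case 0
      then show ?case by (simp add: e_def f_def X_def z_def)
    next
      case (Suc k)
      let ?t = "real k * h" and ?t' = "real (Suc k) * h"
      have t: "?t \<in> {0..T}" "?t' \<in> {0..T}"
        using Suc.prems by (intro kT, simp)+
      have tt: "?t' - ?t = h" "?t \<le> ?t'" using h by (auto simp: algebra_simps)
      have sub: "{?t..?t'} \<subseteq> {0..T}" using t by auto
      have IH: "e k + f k \<le> X k" using Suc by simp
      have "norm (Q ?t' - Q ?t - (?t' - ?t) *\<^sub>R P ?t) \<le> (?t' - ?t) * \<omega>"
      proof (rule increment_bound[OF tt(2)])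
        fix s assume s: "s \<in> {?t..?t'}"
        then show "(Q has_vector_derivative P s) (at s within {?t..?t'})"
          using Q sub has_vector_derivative_within_subset by blast
        show "norm (P s - P ?t) \<le> \<omega>"
        proof (rule less_imp_le, rule d1)
          show "s \<in> {0..T}" using s sub by blast
          show "\<bar>s - ?t\<bar> < d1" using s tt h unfolding abs_le_iff atLeastAtMost_iff by linarith
        qed (rule t)
      qed
      then have Qstep: "norm (Q ?t' - Q ?t - h *\<^sub>R P ?t) \<le> h * \<omega>" unfolding tt .
      \<comment> \<open>The momentum increment is compared with the force at the end of the
        interval, since the kick uses the new position.\<close>
      have "norm (P ?t' - P ?t - (?t' - ?t) *\<^sub>R g (Q ?t')) \<le> (?t' - ?t) * \<omega>"
      proof (rule increment_bound[OF tt(2)])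
        fix s assume s: "s \<in> {?t..?t'}"
        then show "(P has_vector_derivative g (Q s)) (at s within {?t..?t'})"
          using P sub has_vector_derivative_within_subset by blast
        show "norm (g (Q s) - g (Q ?t')) \<le> \<omega>"
        proof (rule less_imp_le, rule d2)
          show "s \<in> {0..T}" using s sub by blast
          show "\<bar>s - ?t'\<bar> < d2" using s tt h unfolding abs_le_iff atLeastAtMost_iff by linarith
        qed (rule t)
      qed
      then have Pstep: "norm (P ?t' - P ?t - h *\<^sub>R g (Q ?t')) \<le> h * \<omega>" unfolding tt .
      have z: "z (Suc k) = euler_step g h (z k)" by (simp add: z_def)
      have e': "e (Suc k) \<le> e k + h * f k + h * \<omega>"
      proof -
        have "fst (z (Suc k)) - Q ?t' = (fst (z k) - Q ?t) + h *\<^sub>R (snd (z k) - P ?t) - (Q ?t' - Q ?t - h *\<^sub>R P ?t)"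
          by (simp add: z fst_euler_step algebra_simps)
        also have "norm \<dots> \<le> norm (fst (z k) - Q ?t) + norm (h *\<^sub>R (snd (z k) - P ?t)) + norm (Q ?t' - Q ?t - h *\<^sub>R P ?t)"
          by (meson norm_triangle_ineq norm_triangle_ineq4 add_mono order_refl order_trans)
        also have "\<dots> \<le> e k + h * f k + h * \<omega>"
          using Qstep h by (simp add: e_def f_def)
        finally show ?thesis by (simp only: e_def)
      qed
      have step: "(1 + 3 * L * h) * X k + 3 * L * h * \<omega> \<le> X (Suc k)"
      proof -
        have "1 + 3 * L * h \<le> exp (3 * L * h)" by (rule exp_ge_add_one_self)
        then have "(1 + 3 * L * h) * exp (3 * L * h * real k) \<le> exp (3 * L * h) * exp (3 * L * h * real k)"
          by (rule mult_right_mono) simp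
        also have "\<dots> = exp (3 * L * h * real (Suc k))"
          by (simp add: exp_add[symmetric] algebra_simps)
        finally have "\<omega> * ((1 + 3 * L * h) * exp (3 * L * h * real k) - 1) \<le> X (Suc k)"
          unfolding X_def using \<omega>(1) by (intro mult_left_mono diff_right_mono) auto
        then show ?thesis by (simp add: X_def algebra_simps)
      qed
      have nn: "0 \<le> e k" "0 \<le> f k" by (auto simp: e_def f_def)
      \<comment> \<open>The new position error depends on old errors only. Bounding it first places
        the new position in the tube, where the Lipschitz estimate for the kick is
        available.\<close>
      have "e (Suc k) \<le> (1 + 3 * L * h) * X k + 3 * L * h * \<omega>"
      proof -
        have "h * f k \<le> 3 * L * h * X k"
          using IH nn h L by (intro mult_mono) auto
        moreover have "h * \<omega> \<le> 3 * L * h * \<omega>"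
          using h L \<omega>(1) by (intro mult_right_mono) auto
        ultimately show ?thesis
          using e' IH nn by (simp add: algebra_simps)
      qed
      then have "e (Suc k) \<le> \<delta>"
        using step XT[OF Suc.prems] by linarith
      then have lip': "norm (g (fst (z (Suc k))) - g (Q ?t')) \<le> L * e (Suc k)"
        unfolding e_def by (rule lip[OF t(2)])
      have f': "f (Suc k) \<le> f k + h * (L * e (Suc k)) + h * \<omega>"
      proof -
        have "snd (z (Suc k)) - P ?t' = (snd (z k) - P ?t) + h *\<^sub>R (g (fst (z (Suc k))) - g (Q ?t')) - (P ?t' - P ?t - h *\<^sub>R g (Q ?t'))"
          by (simp add: z fst_euler_step snd_euler_step algebra_simps)
        also have "norm \<dots> \<le> norm (snd (z k) - P ?t) + norm (h *\<^sub>R (g (fst (z (Suc k))) - g (Q ?t'))) + norm (P ?t' - P ?t - h *\<^sub>R g (Q ?t'))"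
          by (meson norm_triangle_ineq norm_triangle_ineq4 add_mono order_refl order_trans)
        also have "\<dots> \<le> f k + h * (L * e (Suc k)) + h * \<omega>"
          using Pstep h lip' by (intro add_mono) (auto simp: f_def)
        finally show ?thesis by (simp only: f_def)
      qed
      have "e (Suc k) + f (Suc k) \<le> (1 + 3 * L * h) * X k + 3 * L * h * \<omega>"
        using \<omega>(1) h L by (intro euler_error_step[OF e' f' IH nn]) auto
      with step show ?case by linarith
    qed
    then show ?case
      using XT unfolding e_def f_def z_def h_def by fastforce
  qed
qed

section \<open>Local Lipschitz bounds for the force\<close>

text \<open>The derivative is bounded on a compact closed neighbourhood of \<open>K\<close>, and the
  mean value inequality applies inside each ball around a point of \<open>K\<close>, which is
  convex.\<close>

lemma C1_lipschitz_near_compact: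
  fixes f :: "real^'n::finite \<Rightarrow> real"
  assumes K: "compact K" "K \<subseteq> U" and U: "open U"
    and f: "\<And>x. x \<in> U \<Longrightarrow> (f has_derivative f' x) (at x)" "\<And>v. continuous_on U (\<lambda>x. f' x v)"
  obtains \<delta> L where "0 < \<delta>" "0 \<le> L"
    "\<And>x y. y \<in> K \<Longrightarrow> norm (x - y) \<le> \<delta> \<Longrightarrow> \<bar>f x - f y\<bar> \<le> L * norm (x - y)"
proof -
  obtain \<epsilon> where \<epsilon>: "0 < \<epsilon>" "(\<Union>x\<in>K. ball x \<epsilon>) \<subseteq> U"
    using compact_subset_open_imp_ball_epsilon_subset[OF K(1) U K(2)] by blast
  define \<delta> where "\<delta> = \<epsilon> / 2"
  define K' where "K' = (\<Union>x\<in>K. cball x \<delta>)"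
  have "K' = {x + y |x y. x \<in> K \<and> y \<in> cball 0 \<delta>}"
    unfolding K'_def by (force simp: dist_norm norm_minus_commute intro: exI[of _ "_ - _"])
  then have cK': "compact K'"
    using compact_sums[OF K(1) compact_cball[of 0 \<delta>]] by (simp only:)
  have K'U: "K' \<subseteq> U"
    using \<epsilon> unfolding K'_def \<delta>_def by (force simp: subset_iff)
  \<comment> \<open>Continuity is given for each directional derivative separately; this sum over
    the coordinate directions is continuous and dominates the operator norm.\<close>
  define b where "b x = (\<Sum>i\<in>UNIV. \<bar>f' x (axis i 1)\<bar>)" for x
  have "continuous_on K' b"
    unfolding b_def by (intro continuous_intros continuous_on_subset[OF f(2) K'U])
  then have "bounded (b ` K')"
    using cK' by (intro compact_imp_bounded compact_continuous_image)
  then obtain L where L: "\<And>x. x \<in> K' \<Longrightarrow> \<bar>b x\<bar> \<le> L" "0 < L"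
    unfolding bounded_pos by auto
  show thesis
  proof
    show "0 < \<delta>" "0 \<le> L" using \<epsilon>(1) L(2) by (auto simp: \<delta>_def)
    fix x y assume y: "y \<in> K" and xy: "norm (x - y) \<le> \<delta>"
    have sub: "cball y \<delta> \<subseteq> K'" using y by (auto simp: K'_def)
    have on: "onorm (f' w) \<le> L" if w: "w \<in> cball y \<delta>" for w
    proof (rule onorm_le)
      fix v
      have w': "w \<in> K'" "w \<in> U" using w sub K'U by auto
      interpret bounded_linear "f' w" using f(1)[OF w'(2)] by (rule has_derivative_bounded_linear)
      have "f' w v = f' w (\<Sum>i\<in>UNIV. v $ i *\<^sub>R axis i 1)"
        using basis_expansion[of v] by (simp add: scalar_mult_eq_scaleR)
      also have "\<dots> = (\<Sum>i\<in>UNIV. v $ i * f' w (axis i 1))"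
        by (simp add: sum scaleR)
      also have "\<bar>\<dots>\<bar> \<le> (\<Sum>i\<in>UNIV. norm v * \<bar>f' w (axis i 1)\<bar>)"
        by (intro order_trans[OF sum_abs] sum_mono) (simp add: abs_mult mult_right_mono component_le_norm_cart)
      also have "\<dots> = norm v * b w" by (simp add: b_def sum_distrib_left)
      also have "\<dots> \<le> norm v * L"
        using L(1)[OF w'(1)] by (intro mult_left_mono) auto
      finally show "norm (f' w v) \<le> L * norm v" by (simp add: mult.commute)
    qed
    have "norm (f x - f y) \<le> L * norm (x - y)"
    proof (rule differentiable_bound[of "cball y \<delta>" f f'])
      show "(f has_derivative f' w) (at w within cball y \<delta>)" if "w \<in> cball y \<delta>" for w
        by (rule has_derivative_at_withinI[OF f(1)[OF subsetD[OF K'U subsetD[OF sub that]]]])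
      show "x \<in> cball y \<delta>" "y \<in> cball y \<delta>"
        using xy \<open>0 < \<delta>\<close> by (simp_all add: dist_norm norm_minus_commute)
    qed (rule convex_cball, rule on)
    then show "\<bar>f x - f y\<bar> \<le> L * norm (x - y)" by simp
  qed
qed

text \<open>The gradient of \<open>ln \<circ> \<pi>\<close>, which is the force. At zeros of
  \<open>\<pi>\<close> division by zero makes it 0, so the Euler map is total.\<close>

definition score :: "(real^'n::finite \<Rightarrow> real) \<Rightarrow> real^'n \<Rightarrow> real^'n"
  where "score \<pi> q = (\<chi> i. frechet_derivative \<pi> (at q) (axis i 1) / \<pi> q)"

lemma smooth_on_UNIV_D:
  assumes "smooth_on UNIV \<pi>"
  shows "continuous_on UNIV \<pi>"
    and "\<And>x. (\<pi> has_derivative frechet_derivative \<pi> (at x)) (at x)"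
    and "\<And>v. smooth_on UNIV (\<lambda>x. frechet_derivative \<pi> (at x) v)"
proof -
  have *: "Ck_on n UNIV \<pi>" for n using assms by (simp add: smooth_on_def)
  show "continuous_on UNIV \<pi>" using *[of 0] by simp
  show "(\<pi> has_derivative frechet_derivative \<pi> (at x)) (at x)" for x
    using *[of "Suc 0"] by (simp add: frechet_derivative_works)
  show "smooth_on UNIV (\<lambda>x. frechet_derivative \<pi> (at x) v)" for v
    unfolding smooth_on_def using *[of "Suc n" for n] by simp
qed

lemma inner_score:
  fixes \<pi> :: "real^'n::finite \<Rightarrow> real"
  assumes "smooth_on UNIV \<pi>"
  shows "v \<bullet> score \<pi> q = frechet_derivative \<pi> (at q) v / \<pi> q"
proof -
  interpret bounded_linear "frechet_derivative \<pi> (at q)"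
    using smooth_on_UNIV_D(2)[OF assms] by (rule has_derivative_bounded_linear)
  have "frechet_derivative \<pi> (at q) v = frechet_derivative \<pi> (at q) (\<Sum>i\<in>UNIV. v $ i *\<^sub>R axis i 1)"
    using basis_expansion[of v] by (simp add: scalar_mult_eq_scaleR)
  also have "\<dots> = (\<Sum>i\<in>UNIV. v $ i * frechet_derivative \<pi> (at q) (axis i 1))"
    by (simp add: sum scaleR)
  finally show ?thesis
    by (simp add: inner_vec_def score_def sum_divide_distrib)
qed

lemma borel_measurable_score [measurable (raw)]:
  assumes "smooth_on UNIV \<pi>"
  shows "score \<pi> \<in> borel_measurable borel"
  unfolding score_def[abs_def]
proof (rule borel_measurable_vec_lambda)
  show "(\<lambda>q. frechet_derivative \<pi> (at q) (axis i 1) / \<pi> q) \<in> borel_measurable borel" for i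
    using smooth_on_UNIV_D(1)[OF assms] smooth_on_UNIV_D(1)[OF smooth_on_UNIV_D(3)[OF assms]]
    by (intro borel_measurable_divide borel_measurable_continuous_onI)
qed

lemma score_lipschitz:
  fixes \<pi> :: "real^'n::finite \<Rightarrow> real"
  assumes \<pi>: "smooth_on UNIV \<pi>" and K: "compact K" "\<And>x. x \<in> K \<Longrightarrow> 0 < \<pi> x"
  obtains \<delta> L where "0 < \<delta>" "1 \<le> L"
    "\<And>x y. y \<in> K \<Longrightarrow> norm (x - y) \<le> \<delta> \<Longrightarrow> norm (score \<pi> x - score \<pi> y) \<le> L * norm (x - y)"
proof -
  let ?U = "{x. 0 < \<pi> x}"
  have U: "open ?U"
    using smooth_on_UNIV_D(1)[OF \<pi>] by (intro open_Collect_less continuous_intros)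
  let ?a = "\<lambda>i x. frechet_derivative \<pi> (at x) (axis i 1)"
  have "\<exists>\<delta> L. 0 < \<delta> \<and> 0 \<le> L \<and>
    (\<forall>y\<in>K. \<forall>x. norm (x - y) \<le> \<delta> \<longrightarrow> \<bar>score \<pi> x $ i - score \<pi> y $ i\<bar> \<le> L * norm (x - y))" for i
  proof -
    let ?f' = "\<lambda>x v. (frechet_derivative (?a i) (at x) v * \<pi> x - ?a i x * frechet_derivative \<pi> (at x) v) / (\<pi> x * \<pi> x)"
    note ai = smooth_on_UNIV_D(3)[OF \<pi>, of "axis i 1"]
    have D: "((\<lambda>x. score \<pi> x $ i) has_derivative ?f' x) (at x)" if "x \<in> ?U" for x
      using has_derivative_divide'[OF smooth_on_UNIV_D(2)[OF ai] smooth_on_UNIV_D(2)[OF \<pi>], of x] that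
      by (simp add: score_def)
    have sub: "continuous_on ?U g" if "continuous_on UNIV g" for g :: "real^'n \<Rightarrow> real"
      using that by (rule continuous_on_subset) simp
    have C: "continuous_on ?U (\<lambda>x. ?f' x v)" for v
      by (intro continuous_intros sub smooth_on_UNIV_D(1)[OF \<pi>] smooth_on_UNIV_D(1)[OF ai]
          smooth_on_UNIV_D(1)[OF smooth_on_UNIV_D(3)[OF ai]] smooth_on_UNIV_D(1)[OF smooth_on_UNIV_D(3)[OF \<pi>]]) auto
    have KU: "K \<subseteq> ?U" using K(2) by blast
    show ?thesis
      by (rule C1_lipschitz_near_compact[OF K(1) KU U D C]) blast+
  qed
  then obtain d L where dL: "\<And>i. 0 < d i" "\<And>i. 0 \<le> L i"
    "\<And>i x y. y \<in> K \<Longrightarrow> norm (x - y) \<le> d i \<Longrightarrow> \<bar>score \<pi> x $ i - score \<pi> y $ i\<bar> \<le> L i * norm (x - y)"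
    by metis
  show thesis
  proof
    show "0 < Min (range d)" using dL(1) by (subst Min_gr_iff) auto
    \<comment> \<open>The summand 1 secures \<open>1 \<le> L\<close>, which the error recursion of
      the scheme requires.\<close>
    show "1 \<le> 1 + (\<Sum>i\<in>UNIV. L i)" using dL(2) by (simp add: sum_nonneg)
    fix x y assume y: "y \<in> K" and xy: "norm (x - y) \<le> Min (range d)"
    have "norm (score \<pi> x - score \<pi> y) \<le> (\<Sum>i\<in>UNIV. \<bar>(score \<pi> x - score \<pi> y) $ i\<bar>)"
      by (rule norm_le_l1_cart)
    also have "\<dots> \<le> (\<Sum>i\<in>UNIV. L i * norm (x - y))"
    proof (rule sum_mono)
      fix i
      have "norm (x - y) \<le> d i" using xy by (rule order_trans) simp
      then show "\<bar>(score \<pi> x - score \<pi> y) $ i\<bar> \<le> L i * norm (x - y)"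
        using dL(3)[OF y] by simp
    qed
    also have "\<dots> \<le> (1 + (\<Sum>i\<in>UNIV. L i)) * norm (x - y)"
      by (simp add: sum_distrib_right[symmetric] mult_right_mono)
    finally show "norm (score \<pi> x - score \<pi> y) \<le> (1 + (\<Sum>i\<in>UNIV. L i)) * norm (x - y)" .
  qed
qed

section \<open>Exact trajectories and the density along their discrete approximations\<close>

lemma GDERIV_unique:
  assumes "GDERIV f x :> a" "GDERIV f x :> b"
  shows "a = b"
proof -
  have "(\<lambda>h. h \<bullet> a) = (\<lambda>h. h \<bullet> b)"
    using assms unfolding gderiv_def by (rule has_derivative_unique)
  then have "h \<bullet> (a - b) = 0" for h
    by (simp add: inner_diff_right fun_eq_iff)
  from this[of "a - b"] show ?thesis by simp
qed

text \<open>Gradients are unique, so the vectors \<open>a\<close> and \<open>b\<close> in the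
  definition are \<open>- score \<pi> (Q t)\<close> and \<open>P t\<close>.\<close>

lemma hamilton_solutionD:
  fixes \<pi> :: "real^'n::finite \<Rightarrow> real"
  assumes \<pi>: "smooth_on UNIV \<pi>" and sol: "hamilton_solution \<pi> T P Q" and t: "t \<in> {0..T}"
  shows "0 < \<pi> (Q t)"
    and "(P has_vector_derivative score \<pi> (Q t)) (at t within {0..T})"
    and "(Q has_vector_derivative P t) (at t within {0..T})"
proof -
  obtain a b where pos: "0 < \<pi> (Q t)"
    and a: "GDERIV (\<lambda>q. hamiltonian \<pi> (P t) q) (Q t) :> a"
    and b: "GDERIV (\<lambda>p. hamiltonian \<pi> p (Q t)) (P t) :> b"
    and PQ: "(P has_vector_derivative - a) (at t within {0..T})" "(Q has_vector_derivative b) (at t within {0..T})"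
    using sol t unfolding hamilton_solution_def by blast
  have "((\<lambda>q. hamiltonian \<pi> (P t) q) has_derivative (\<lambda>v. - (frechet_derivative \<pi> (at (Q t)) v * inverse (\<pi> (Q t))))) (at (Q t))"
    unfolding hamiltonian_def
    by (intro has_derivative_add_const has_derivative_minus has_derivative_ln pos smooth_on_UNIV_D(2)[OF \<pi>])
  then have "GDERIV (\<lambda>q. hamiltonian \<pi> (P t) q) (Q t) :> - score \<pi> (Q t)"
    unfolding gderiv_def by (simp add: inner_score[OF \<pi>] divide_inverse)
  with a have "a = - score \<pi> (Q t)" by (rule GDERIV_unique)
  moreover have "((\<lambda>p. hamiltonian \<pi> p (Q t)) has_derivative (\<lambda>v. v \<bullet> P t)) (at (P t))"
  proof -
    have "((\<lambda>p. - ln (\<pi> (Q t)) + 1 / 2 * (p \<bullet> p)) has_derivative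
        (\<lambda>v. 0 + 1 / 2 * (P t \<bullet> v + v \<bullet> P t))) (at (P t))"
      by (intro has_derivative_add has_derivative_const has_derivative_mult_right has_derivative_inner has_derivative_ident)
    then show ?thesis
      by (simp add: hamiltonian_def power2_norm_eq_inner inner_commute[of "P t"])
  qed
  then have "GDERIV (\<lambda>p. hamiltonian \<pi> p (Q t)) (P t) :> P t"
    unfolding gderiv_def .
  with b have "b = P t" by (rule GDERIV_unique)
  ultimately show "0 < \<pi> (Q t)" "(P has_vector_derivative score \<pi> (Q t)) (at t within {0..T})"
    "(Q has_vector_derivative P t) (at t within {0..T})"
    using pos PQ by auto
qed

text \<open>Where \<open>\<pi>\<close> is positive, this is \<open>exp\<close> of minus the
  Hamiltonian, up to the normalizing constant of the Gaussian.\<close>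

definition phase_density :: "(real^'n::finite \<Rightarrow> real) \<Rightarrow> (real^'n) \<times> (real^'n) \<Rightarrow> real"
  where "phase_density \<pi> z = \<pi> (fst z) * gauss (snd z)"

text \<open>\<open>?H\<close> is minus the energy. In its derivative the contributions of position
  and momentum cancel, the force being the gradient of \<open>ln \<circ> \<pi>\<close>.\<close>

lemma phase_density_conserved:
  fixes \<pi> :: "real^'n::finite \<Rightarrow> real"
  assumes \<pi>: "smooth_on UNIV \<pi>" and sol: "hamilton_solution \<pi> T P Q" and t: "t \<in> {0..T}"
  shows "phase_density \<pi> (Q t, P t) = phase_density \<pi> (Q 0, P 0)"
proof -
  note s = hamilton_solutionD[OF \<pi> sol]
  let ?H = "\<lambda>t. ln (\<pi> (Q t)) - 1 / 2 * (P t \<bullet> P t)"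
  have "(?H has_derivative (\<lambda>h. 0)) (at t within {0..T})" if t: "t \<in> {0..T}" for t
  proof -
    note PD = s(2)[OF t, unfolded has_vector_derivative_def] and QD = s(3)[OF t, unfolded has_vector_derivative_def]
    have lin: "linear (frechet_derivative \<pi> (at (Q t)))"
      using smooth_on_UNIV_D(2)[OF \<pi>] by (rule has_derivative_linear)
    have "((\<lambda>t. \<pi> (Q t)) has_derivative (\<lambda>h. frechet_derivative \<pi> (at (Q t)) (h *\<^sub>R P t))) (at t within {0..T})"
      using diff_chain_within[OF QD has_derivative_at_withinI[OF smooth_on_UNIV_D(2)[OF \<pi>]]] by (simp add: o_def)
    then have "(?H has_derivative (\<lambda>h. frechet_derivative \<pi> (at (Q t)) (h *\<^sub>R P t) * inverse (\<pi> (Q t))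
        - 1 / 2 * (P t \<bullet> (h *\<^sub>R score \<pi> (Q t)) + (h *\<^sub>R score \<pi> (Q t)) \<bullet> P t))) (at t within {0..T})"
      by (intro has_derivative_diff has_derivative_ln has_derivative_mult_right has_derivative_inner PD s(1) t)
    moreover have "frechet_derivative \<pi> (at (Q t)) (h *\<^sub>R P t) = h * frechet_derivative \<pi> (at (Q t)) (P t)" for h
      using linear_scale[OF lin, of h "P t"] by simp
    moreover have "P t \<bullet> score \<pi> (Q t) = frechet_derivative \<pi> (at (Q t)) (P t) * inverse (\<pi> (Q t))"
      "score \<pi> (Q t) \<bullet> P t = frechet_derivative \<pi> (at (Q t)) (P t) * inverse (\<pi> (Q t))"
      using inner_score[OF \<pi>, of "P t" "Q t"] by (simp_all only: divide_inverse inner_commute[of "score \<pi> (Q t)" "P t"])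
    ultimately show ?thesis by simp
  qed
  then obtain c where "\<forall>t\<in>{0..T}. ?H t = c"
    using has_derivative_zero_constant[of "{0..T}" ?H] by (auto simp only: convex_real_interval)
  moreover have "0 \<in> {0..T}" using t by auto
  ultimately have "?H t = ?H 0" using t by metis
  moreover have "phase_density \<pi> (Q t, P t) = (1 / sqrt (2 * pi)) ^ CARD('n) * exp (?H t)" if t: "t \<in> {0..T}" for t
  proof -
    have "?H t = ln (\<pi> (Q t)) + - (norm (P t))\<^sup>2 / 2"
      unfolding power2_norm_eq_inner by simp
    then have "exp (?H t) = \<pi> (Q t) * exp (- (norm (P t))\<^sup>2 / 2)"
      using s(1)[OF t] by (simp only: exp_add exp_ln)
    then show ?thesis
      by (simp only: phase_density_def gauss_eq fst_conv snd_conv mult.left_commute)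
  qed
  ultimately show ?thesis
    using t \<open>0 \<in> {0..T}\<close> by (simp only:)
qed

lemma continuous_on_phase_density:
  assumes "continuous_on UNIV \<pi>"
  shows "continuous_on UNIV (phase_density \<pi>)"
  unfolding phase_density_def
  by (intro continuous_intros continuous_on_compose2[OF assms] continuous_on_compose2[OF continuous_gauss]) auto

text \<open>On the exact curve the phase density keeps its initial value. For \<open>c > 1\<close>
  the open set \<open>?W\<close> therefore contains the curve and, by compactness, a neighbourhood
  of some radius \<open>e\<close>. For large \<open>N\<close> the discrete path, including its
  straight drifts, stays in that neighbourhood.\<close>

lemma euler_eventually_good:
  fixes \<pi> :: "real^'n::finite \<Rightarrow> real"
  assumes \<pi>: "smooth_on UNIV \<pi>" and sol: "hamilton_solution \<pi> T P Q" and T: "0 < T"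
    and c: "1 < c" and V: "open V" "Q T \<in> V"
  defines "z \<equiv> \<lambda>N k. (euler_step (score \<pi>) (T / real N) ^^ k) (Q 0, P 0)"
  shows "\<forall>\<^sub>F N in sequentially. fst (z N N) \<in> V \<and> (\<forall>k\<le>N. \<forall>s\<in>{0..T / real N}.
    phase_density \<pi> (Q 0, P 0) \<le> c * phase_density \<pi> (fst (z N k) + s *\<^sub>R snd (z N k), snd (z N k)))"
proof -
  note s = hamilton_solutionD[OF \<pi> sol]
  let ?I = "{0..T}"
  have cQ: "continuous_on ?I Q" by (rule continuous_on_vector_derivative[OF s(3)])
  have cP: "continuous_on ?I P" by (rule continuous_on_vector_derivative[OF s(2)])
  have "compact (Q ` ?I)" using cQ by (intro compact_continuous_image) auto
  then obtain \<delta> L where \<delta>: "0 < \<delta>" and L: "1 \<le> L"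
    and lip: "\<And>x y. y \<in> Q ` ?I \<Longrightarrow> norm (x - y) \<le> \<delta> \<Longrightarrow> norm (score \<pi> x - score \<pi> y) \<le> L * norm (x - y)"
    using score_lipschitz[OF \<pi>, of "Q ` ?I"] s(1) by blast
  have cS: "continuous_on {x. 0 < \<pi> x} (score \<pi>)"
    unfolding score_def[abs_def]
    by (intro continuous_on_vec_lambda continuous_on_divide continuous_on_subset[OF smooth_on_UNIV_D(1)[OF \<pi>]]
        continuous_on_subset[OF smooth_on_UNIV_D(1)[OF smooth_on_UNIV_D(3)[OF \<pi>]]]) auto
  have cSQ: "continuous_on ?I (\<lambda>t. score \<pi> (Q t))"
    using s(1) by (intro continuous_on_compose2[OF cS cQ]) auto
  let ?\<rho>0 = "phase_density \<pi> (Q 0, P 0)"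
  have \<rho>0: "0 < ?\<rho>0"
    using s(1)[of 0] T by (simp add: phase_density_def gauss_pos)
  let ?W = "{w. ?\<rho>0 < c * phase_density \<pi> w}"
  have "open ?W"
    by (intro open_Collect_less continuous_intros continuous_on_phase_density smooth_on_UNIV_D(1)[OF \<pi>])
  moreover have "compact ((\<lambda>t. (Q t, P t)) ` ?I)"
    using cQ cP by (intro compact_continuous_image continuous_on_Pair) auto
  moreover have "(\<lambda>t. (Q t, P t)) ` ?I \<subseteq> ?W"
  proof (intro image_subsetI CollectI)
    fix t assume t: "t \<in> ?I"
    have "?\<rho>0 < c * ?\<rho>0" using c \<rho>0 by simp
    then show "?\<rho>0 < c * phase_density \<pi> (Q t, P t)"
      unfolding phase_density_conserved[OF \<pi> sol t] .
  qed
  ultimately obtain e where e: "0 < e" "(\<Union>w\<in>(\<lambda>t. (Q t, P t)) ` ?I. ball w e) \<subseteq> ?W"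
    using compact_subset_open_imp_ball_epsilon_subset by blast
  obtain v where v: "0 < v" "ball (Q T) v \<subseteq> V"
    using V open_contains_ball by blast
  have "bounded (P ` ?I)"
    using cP by (intro compact_imp_bounded compact_continuous_image) auto
  then obtain b where b: "0 < b" "\<And>t. t \<in> ?I \<Longrightarrow> norm (P t) \<le> b"
    unfolding bounded_pos by auto
  \<comment> \<open>\<open>v / 2\<close> puts the endpoint into \<open>V\<close>,
    \<open>e / 4\<close> keeps the vertices near the curve, and 1 bounds the discrete momenta by
    \<open>b + 1\<close>.\<close>
  define \<eta> where "\<eta> = min (min (v / 2) (e / 4)) 1"
  have \<eta>: "0 < \<eta>" "\<eta> < v" "\<eta> \<le> e / 4" "\<eta> \<le> 1" using v(1) e(1) by (auto simp: \<eta>_def)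
  have conv: "\<forall>\<^sub>F N in sequentially. \<forall>k\<le>N.
    norm (fst (z N k) - Q (real k * (T / real N))) + norm (snd (z N k) - P (real k * (T / real N))) \<le> \<eta>"
    unfolding z_def
    by (rule euler_converges[OF T \<delta> s(3) s(2) cSQ _ L \<eta>(1)]) (use lip in auto)
  have "(\<lambda>N. T / real N) \<longlonglongrightarrow> 0"
    by (rule lim_const_over_n)
  \<comment> \<open>A drift then has length below \<open>e / 4\<close>; together with the errors in
    position and momentum this stays below \<open>e\<close>.\<close>
  then have "\<forall>\<^sub>F N in sequentially. T / real N < e / (4 * (b + 1))"
    using e(1) b(1) by (intro order_tendstoD) auto
  with conv show ?thesis
    using eventually_gt_at_top[of 0]
  proof eventually_elim
    case (elim N)
    define h where "h = T / real N"
    have h: "0 < h" "real N * h = T" "h * (b + 1) < e / 4"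
      using elim T b(1) by (auto simp: h_def field_simps)
    have close: "norm (fst (z N k) - Q (real k * h)) \<le> \<eta>" "norm (snd (z N k) - P (real k * h)) \<le> \<eta>" if "k \<le> N" for k
      using elim(1) that unfolding h_def by (smt (verit) norm_ge_zero)+
    have "fst (z N N) \<in> ball (Q T) v"
      using close(1)[of N] \<eta>(2) h(2) by (simp add: dist_norm norm_minus_commute)
    then have "fst (z N N) \<in> V" using v(2) by blast
    moreover have "?\<rho>0 \<le> c * phase_density \<pi> (fst (z N k) + s *\<^sub>R snd (z N k), snd (z N k))"
      if k: "k \<le> N" and s: "s \<in> {0..h}" for k s
    proof -
      let ?t = "real k * h"
      have "real k * h \<le> real N * h" using k h(1) by (intro mult_right_mono) auto
      then have t: "?t \<in> ?I" using h by simp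
      have "norm (snd (z N k)) \<le> norm (P ?t) + norm (snd (z N k) - P ?t)"
        by (metis add.commute diff_add_cancel norm_triangle_ineq)
      also have "\<dots> \<le> b + 1" using b(2)[OF t] close(2)[OF k] \<eta>(4) by linarith
      finally have "\<bar>s\<bar> * norm (snd (z N k)) \<le> h * (b + 1)"
        using s h(1) by (intro mult_mono) auto
      then have 1: "norm (s *\<^sub>R snd (z N k)) \<le> e / 4" using h(3) by simp
      have "dist (Q ?t, P ?t) (fst (z N k) + s *\<^sub>R snd (z N k), snd (z N k))
        \<le> dist (Q ?t) (fst (z N k) + s *\<^sub>R snd (z N k)) + dist (P ?t) (snd (z N k))"
        unfolding dist_Pair_Pair by (rule sqrt_sum_squares_le_sum) simp_all
      moreover have "dist (Q ?t) (fst (z N k) + s *\<^sub>R snd (z N k)) \<le> norm (fst (z N k) - Q ?t) + norm (s *\<^sub>R snd (z N k))"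
      proof -
        have "dist (Q ?t) (fst (z N k) + s *\<^sub>R snd (z N k)) = norm (fst (z N k) - Q ?t + s *\<^sub>R snd (z N k))"
          unfolding dist_norm by (subst norm_minus_commute) (simp add: algebra_simps)
        also have "\<dots> \<le> norm (fst (z N k) - Q ?t) + norm (s *\<^sub>R snd (z N k))"
          by (rule norm_triangle_ineq)
        finally show ?thesis .
      qed
      moreover have "dist (P ?t) (snd (z N k)) = norm (snd (z N k) - P ?t)"
        unfolding dist_norm by (rule norm_minus_commute)
      ultimately have "dist (Q ?t, P ?t) (fst (z N k) + s *\<^sub>R snd (z N k), snd (z N k)) < e"
        using 1 close[OF k] \<eta>(3) e(1) by linarith
      then have "(fst (z N k) + s *\<^sub>R snd (z N k), snd (z N k)) \<in> ?W"
        using t by (intro subsetD[OF e(2)] UN_I[of "(Q ?t, P ?t)"] imageI) (simp_all only: mem_ball)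
      then show ?thesis by simp
    qed
    ultimately show ?case unfolding h_def by blast
  qed
qed

section \<open>Measure preservation of the scheme and measurability along a drift\<close>

lemma nn_integral_lborel_translation:
  fixes f :: "'a::euclidean_space \<Rightarrow> ennreal"
  assumes [measurable]: "f \<in> borel_measurable borel"
  shows "(\<integral>\<^sup>+x. f (x + t) \<partial>lborel) = (\<integral>\<^sup>+x. f x \<partial>lborel)"
proof -
  have "(\<integral>\<^sup>+x. f x \<partial>lborel) = (\<integral>\<^sup>+x. f x \<partial>distr lborel borel ((+) t))"
    by (simp only: lborel_distr_plus)
  also have "\<dots> = (\<integral>\<^sup>+x. f (t + x) \<partial>lborel)"
    by (rule nn_integral_distr) simp_all
  finally show ?thesis by (simp only: add.commute)
qed

lemma euler_step_measurable [measurable]: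
  fixes g :: "'a::euclidean_space \<Rightarrow> 'a"
  assumes [measurable]: "g \<in> borel_measurable borel"
  shows "euler_step g h \<in> lborel \<Otimes>\<^sub>M lborel \<rightarrow>\<^sub>M lborel \<Otimes>\<^sub>M lborel"
  unfolding euler_step_def[abs_def] Let_def by measurable

text \<open>A symplectic Euler step is a composition of two shears, each a translation in one variable.\<close>

lemma nn_integral_euler_step:
  fixes g :: "'a::euclidean_space \<Rightarrow> 'a" and f :: "'a \<times> 'a \<Rightarrow> ennreal"
  assumes [measurable]: "g \<in> borel_measurable borel" "f \<in> borel_measurable (lborel \<Otimes>\<^sub>M lborel)"
  shows "(\<integral>\<^sup>+z. f (euler_step g h z) \<partial>(lborel \<Otimes>\<^sub>M lborel)) = (\<integral>\<^sup>+z. f z \<partial>(lborel \<Otimes>\<^sub>M lborel))"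
proof -
  let ?f1 = "\<lambda>z. f (fst z, snd z + h *\<^sub>R g (fst z))"
  have [measurable]: "?f1 \<in> borel_measurable (lborel \<Otimes>\<^sub>M lborel)" by measurable
  have "(\<integral>\<^sup>+z. f (euler_step g h z) \<partial>(lborel \<Otimes>\<^sub>M lborel))
      = (\<integral>\<^sup>+p. \<integral>\<^sup>+q. ?f1 (q + h *\<^sub>R p, p) \<partial>lborel \<partial>lborel)"
    by (subst lborel_pair.nn_integral_snd[symmetric]) (simp_all add: euler_step_def Let_def)
  also have "\<dots> = (\<integral>\<^sup>+p. \<integral>\<^sup>+q. ?f1 (q, p) \<partial>lborel \<partial>lborel)"
    by (intro nn_integral_cong nn_integral_lborel_translation) measurable
  also have "\<dots> = (\<integral>\<^sup>+q. \<integral>\<^sup>+p. f (q, p + h *\<^sub>R g q) \<partial>lborel \<partial>lborel)"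
    by (subst lborel_pair.Fubini') (simp_all add: case_prod_beta)
  also have "\<dots> = (\<integral>\<^sup>+q. \<integral>\<^sup>+p. f (q, p) \<partial>lborel \<partial>lborel)"
    by (intro nn_integral_cong nn_integral_lborel_translation) measurable
  also have "\<dots> = (\<integral>\<^sup>+z. f z \<partial>(lborel \<Otimes>\<^sub>M lborel))"
    by (rule lborel.nn_integral_fst) simp
  finally show ?thesis .
qed

lemma euler_iterate_measurable [measurable]:
  fixes g :: "'a::euclidean_space \<Rightarrow> 'a"
  assumes [measurable]: "g \<in> borel_measurable borel"
  shows "(euler_step g h ^^ k) \<in> lborel \<Otimes>\<^sub>M lborel \<rightarrow>\<^sub>M lborel \<Otimes>\<^sub>M lborel"
  by (induction k) (simp_all add: id_def)

lemma nn_integral_euler_iterate: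
  fixes g :: "'a::euclidean_space \<Rightarrow> 'a" and f :: "'a \<times> 'a \<Rightarrow> ennreal"
  assumes g[measurable]: "g \<in> borel_measurable borel" and f: "f \<in> borel_measurable (lborel \<Otimes>\<^sub>M lborel)"
  shows "(\<integral>\<^sup>+z. f ((euler_step g h ^^ k) z) \<partial>(lborel \<Otimes>\<^sub>M lborel)) = (\<integral>\<^sup>+z. f z \<partial>(lborel \<Otimes>\<^sub>M lborel))"
  using f
proof (induction k arbitrary: f)
  case (Suc k)
  note Suc.prems[measurable]
  have "(\<integral>\<^sup>+z. f ((euler_step g h ^^ Suc k) z) \<partial>(lborel \<Otimes>\<^sub>M lborel))
      = (\<integral>\<^sup>+z. f (euler_step g h z) \<partial>(lborel \<Otimes>\<^sub>M lborel))"
    using Suc.IH[of "\<lambda>z. f (euler_step g h z)"] by simp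
  also have "\<dots> = (\<integral>\<^sup>+z. f z \<partial>(lborel \<Otimes>\<^sub>M lborel))"
    by (rule nn_integral_euler_step) measurable
  finally show ?case .
qed simp

text \<open>The infimum over a whole drift bounds the density at the crossing point, wherever it is.\<close>

definition inf_along :: "(real^'n::finite \<Rightarrow> real) \<Rightarrow> real \<Rightarrow> (real^'n) \<times> (real^'n) \<Rightarrow> ennreal"
  where "inf_along \<pi> h z = (INF s\<in>{0..h}. ennreal (\<pi> (fst z + s *\<^sub>R snd z)))"

lemma inf_along_le: "s \<in> {0..h} \<Longrightarrow> inf_along \<pi> h (q, p) \<le> ennreal (\<pi> (q + s *\<^sub>R p))"
  unfolding inf_along_def fst_conv snd_conv by (rule INF_lower)

text \<open>The infimum runs over uncountably many points, but its superlevel sets are intersections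
  of closed sets and hence closed.\<close>

lemma borel_measurable_inf_along:
  assumes \<pi>: "continuous_on UNIV \<pi>"
  shows "inf_along \<pi> h \<in> borel_measurable (lborel \<Otimes>\<^sub>M lborel)"
proof -
  have *: "inf_along \<pi> h \<in> borel_measurable borel"
  proof (rule borel_measurableI_ge)
    fix y
    have "closed {z. y \<le> ennreal (\<pi> (fst z + s *\<^sub>R snd z))}" for s
      by (intro closed_Collect_le continuous_intros continuous_on_compose2[OF \<pi>] continuous_on_ennreal) auto
    then have "closed (\<Inter>s\<in>{0..h}. {z. y \<le> ennreal (\<pi> (fst z + s *\<^sub>R snd z))})"
      by (intro closed_INT) auto
    also have "(\<Inter>s\<in>{0..h}. {z. y \<le> ennreal (\<pi> (fst z + s *\<^sub>R snd z))}) = {z \<in> space borel. y \<le> inf_along \<pi> h z}"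
      by (auto simp: inf_along_def le_INF_iff)
    finally show "{z \<in> space borel. y \<le> inf_along \<pi> h z} \<in> sets borel" by (rule borel_closed)
  qed
  have eq: "sets (lborel \<Otimes>\<^sub>M lborel :: ((real^'n) \<times> (real^'n)) measure) = sets borel"
    unfolding borel_prod[symmetric] by (rule sets_pair_measure_cong) simp_all
  show ?thesis
    unfolding measurable_cong_sets[OF eq refl] by (rule *)
qed

section \<open>Mass escaping along discrete paths\<close>

text \<open>A countable union of differentiable images of pieces of a null hyperplane. This serves
  to replace \<open>S\<close> by its interior and to enclose the frontier in an open set of small
  mass.\<close>

lemma negligible_embedded_hypersurface:
  fixes M :: "(real^'n::finite) set"
  assumes "embedded_hypersurface M"
  shows "negligible M"
proof (cases "M = {}")
  case False
  obtain k U \<phi> W where c: "\<And>i::nat. slice_chart M (k i) (U i) (\<phi> i)"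
    and W: "\<And>i. convex (W i)" "\<And>i. open (W i)" "\<And>i. W i \<subseteq> U i"
    and cover: "M \<subseteq> (\<Union>i. \<phi> i ` W i)"
    by (rule embedded_hypersurface_cover[OF assms False]) (rule that)
  have "negligible (\<phi> i ` (W i \<inter> {u. u $ k i = 0}))" for i
  proof (rule negligible_differentiable_image_negligible[OF order_refl])
    have "negligible {u :: real^'n. u \<bullet> axis (k i) 1 = 0}"
      by (rule negligible_standard_hyperplane) (auto simp: Basis_vec_def)
    then show "negligible (W i \<inter> {u. u $ k i = 0})"
      by (rule negligible_subset) (auto simp: inner_axis)
    show "\<phi> i differentiable_on W i \<inter> {u. u $ k i = 0}"
      unfolding differentiable_on_def differentiable_def
      using slice_chartD(4)[OF c[of i]] W(3)[of i] by (blast intro: has_derivative_at_withinI)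
  qed
  then have "negligible (\<Union>i. \<phi> i ` (W i \<inter> {u. u $ k i = 0}))"
    by (rule negligible_Union_nat)
  then show ?thesis
  proof (rule negligible_subset)
    show "M \<subseteq> (\<Union>i. \<phi> i ` (W i \<inter> {u. u $ k i = 0}))"
    proof
      fix y assume y: "y \<in> M"
      then obtain i u where u: "u \<in> W i" "y = \<phi> i u" using cover by blast
      have "u \<in> U i" using u(1) W(3) by blast
      then have "u $ k i = 0" using slice_chartD(7)[OF c[of i]] y u(2) by blast
      then show "y \<in> (\<Union>i. \<phi> i ` (W i \<inter> {u. u $ k i = 0}))" using u by blast
    qed
  qed
qed simp

lemma last_before_exit:
  fixes a :: "nat \<Rightarrow> 'a"
  assumes "a 0 \<in> R" "a N \<notin> R"
  obtains k where "k < N" "a k \<in> R" "a (Suc k) \<notin> R"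
proof -
  have "\<exists>k<N. a k \<in> R \<and> a (Suc k) \<notin> R"
    using assms(2)
  proof (induction N)
    case (Suc N)
    then show ?case by (cases "a N \<in> R") (auto intro: less_SucI)
  qed (use assms(1) in simp)
  then show thesis using that by blast
qed

text \<open>A path from \<open>A\<close> starts in \<open>R\<close>. Either it ends in both
  \<open>V\<close> and \<open>R\<close>, or one of its steps leaves \<open>R\<close>. In both cases
  the initial density is at most \<open>c\<close> times the integrand at the vertex to which it is
  charged. The iterates preserve Lebesgue measure, so the \<open>N\<close> crossing terms have equal
  integrals, and \<open>N * (h / 2) = T / 2\<close>.\<close>

lemma discrete_escape_bound:
  fixes \<pi> :: "real^'n::finite \<Rightarrow> real"
  assumes \<pi>: "smooth_on UNIV \<pi>" "\<And>x. 0 \<le> \<pi> x" and T: "0 < T" and N: "0 < N" and c: "0 < c"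
    and M: "embedded_hypersurface M" "closed M"
    and R: "open R" "interior (closure R) = R" "frontier R \<subseteq> M" and V: "open V"
  defines "F \<equiv> euler_step (score \<pi>) (T / real N)"
  defines "A \<equiv> {z. fst z \<in> R \<and> fst ((F ^^ N) z) \<in> V \<union> - R \<and>
    (\<forall>k\<in>{..N}. ennreal (phase_density \<pi> z)
      \<le> ennreal c * (ennreal (gauss (snd ((F ^^ k) z))) * inf_along \<pi> (T / real N) ((F ^^ k) z)))}"
  shows "A \<in> sets (lborel \<Otimes>\<^sub>M lborel)"
    and "(\<integral>\<^sup>+z\<in>A. ennreal (phase_density \<pi> z) \<partial>(lborel \<Otimes>\<^sub>M lborel))
      \<le> ennreal c * (ennreal (T / 2) * (\<integral>\<^sup>+y\<in>M. ennreal (\<pi> y) \<partial>volume_measure M) + (\<integral>\<^sup>+x\<in>V. ennreal (\<pi> x) \<partial>lborel))"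
proof -
  define h where "h = T / real N"
  have h: "0 < h" "real N * h = T" using T N by (auto simp: h_def)
  let ?L = "lborel \<Otimes>\<^sub>M lborel :: ((real^'n) \<times> (real^'n)) measure"
  let ?I = "\<integral>\<^sup>+y\<in>M. ennreal (\<pi> y) \<partial>volume_measure M"
  have c\<pi>: "continuous_on UNIV \<pi>" by (rule smooth_on_UNIV_D(1)[OF \<pi>(1)])
  have [measurable]: "\<pi> \<in> borel_measurable borel" by (rule borel_measurable_continuous_onI[OF c\<pi>])
  have sc: "score \<pi> \<in> borel_measurable borel" by (rule borel_measurable_score[OF \<pi>(1)])
  note [measurable] = sc borel_measurable_inf_along[OF c\<pi>, of h]
  define Z where "Z k = F ^^ k" for k
  define V' where "V' = V \<union> - R"
  have F: "Z k \<in> ?L \<rightarrow>\<^sub>M ?L" for k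
    unfolding Z_def F_def by (rule euler_iterate_measurable[OF sc])
  have Fint: "(\<integral>\<^sup>+z. f (Z k z) \<partial>?L) = (\<integral>\<^sup>+z. f z \<partial>?L)" if "f \<in> borel_measurable ?L" for f k
    unfolding Z_def F_def using sc that by (rule nn_integral_euler_iterate)
  have \<rho>[measurable]: "(\<lambda>z. ennreal (phase_density \<pi> z)) \<in> borel_measurable ?L"
    unfolding phase_density_def by measurable
  have [measurable]: "R \<in> sets borel" "V \<in> sets borel" "V' \<in> sets borel"
    using R(1) V by (auto simp: V'_def)
  define H where "H z = ennreal c * (ennreal (gauss (snd z)) * inf_along \<pi> h z)" for z
  have "H \<in> borel_measurable ?L"
    unfolding H_def[abs_def] by measurable
  then have [measurable]: "(\<lambda>z. H (Z k z)) \<in> borel_measurable ?L" for k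
    by (rule measurable_compose[OF F])
  have [measurable]: "(\<lambda>z. fst (Z k z)) \<in> borel_measurable ?L" for k
    by (rule measurable_compose[OF F]) measurable
  have A_eq: "A = {z. fst z \<in> R \<and> fst (Z N z) \<in> V' \<and> (\<forall>k\<in>{..N}. ennreal (phase_density \<pi> z) \<le> H (Z k z))}"
    by (simp only: A_def h_def Z_def V'_def H_def)
  also have "\<dots> = {z \<in> space ?L. fst z \<in> R \<and> fst (Z N z) \<in> V' \<and>
    (\<forall>k\<in>{..N}. ennreal (phase_density \<pi> z) \<le> H (Z k z))}"
    by (simp add: space_pair_measure)
  also have "\<dots> \<in> sets ?L" by measurable
  finally show A: "A \<in> sets ?L" .
  have dens: "ennreal (phase_density \<pi> z) = ennreal (\<pi> (fst z)) * ennreal (gauss (snd z))" for z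
    unfolding phase_density_def by (rule ennreal_mult'[OF \<pi>(2)])
  define G where "G q p = indicator R q * indicator (- R) (q + h *\<^sub>R p) * inf_along \<pi> h (q, p)" for q p
  define G' where "G' z = ennreal (gauss (snd z)) * G (fst z) (snd z)" for z
  define E where "E z = ennreal (phase_density \<pi> z) * indicator V (fst z)" for z
  have [measurable]: "G' \<in> borel_measurable ?L"
    unfolding G'_def[abs_def] G_def by measurable
  have [measurable]: "E \<in> borel_measurable ?L"
    unfolding E_def[abs_def] by measurable
  have [measurable]: "(\<lambda>z. G' (Z k z)) \<in> borel_measurable ?L" "(\<lambda>z. E (Z k z)) \<in> borel_measurable ?L" for k
    by (rule measurable_compose[OF F \<open>G' \<in> borel_measurable ?L\<close>],
        rule measurable_compose[OF F \<open>E \<in> borel_measurable ?L\<close>])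
  have flux: "(\<integral>\<^sup>+z. G' z \<partial>?L) \<le> ennreal (h / 2) * ?I"
  proof -
    have Gm: "(\<lambda>q. G q p) \<in> borel_measurable borel" for p
      unfolding G_def by measurable
    have "(\<integral>\<^sup>+z. G' z \<partial>?L) = (\<integral>\<^sup>+p. \<integral>\<^sup>+q. G' (q, p) \<partial>lborel \<partial>lborel)"
      by (rule lborel_pair.nn_integral_snd[symmetric]) measurable
    also have "\<dots> = (\<integral>\<^sup>+p. ennreal (gauss p) * (\<integral>\<^sup>+q. G q p \<partial>lborel) \<partial>lborel)"
      unfolding G'_def fst_conv snd_conv using Gm by (intro nn_integral_cong nn_integral_cmult) simp
    also have "\<dots> \<le> ennreal (h / 2) * ?I"
    proof (rule boundary_flux[OF M R h(1) c\<pi> Gm])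
      show "G q p \<le> ennreal (\<pi> (q + s *\<^sub>R p))" if "s \<in> {0..h}" for q p s
        using inf_along_le[OF that, of \<pi> q p] by (simp add: G_def split: split_indicator)
      show "q \<in> R \<and> q + h *\<^sub>R p \<notin> R" if "G q p \<noteq> 0" for q p
        using that by (simp add: G_def split: split_indicator_asm)
    qed
    finally show ?thesis .
  qed
  have final: "(\<integral>\<^sup>+z. E z \<partial>?L) = (\<integral>\<^sup>+x\<in>V. ennreal (\<pi> x) \<partial>lborel)"
  proof -
    have "(\<integral>\<^sup>+z. E z \<partial>?L) = (\<integral>\<^sup>+x. \<integral>\<^sup>+p. E (x, p) \<partial>lborel \<partial>lborel)"
      by (rule lborel.nn_integral_fst[symmetric]) measurable
    also have "\<dots> = (\<integral>\<^sup>+x. \<integral>\<^sup>+p. (ennreal (\<pi> x) * indicator V x) * ennreal (gauss (p :: real^'n)) \<partial>lborel \<partial>lborel)"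
      unfolding E_def dens fst_conv snd_conv by (simp only: mult_ac)
    also have "\<dots> = (\<integral>\<^sup>+x\<in>V. ennreal (\<pi> x) \<partial>lborel)"
      by (intro nn_integral_cong) (simp add: nn_integral_cmult nn_integral_gauss)
    finally show ?thesis .
  qed
  have fst_F: "fst (Z (Suc k) z) = fst (Z k z) + h *\<^sub>R snd (Z k z)" for k z
    by (simp add: Z_def F_def fst_euler_step h_def)
  have pointwise: "ennreal (phase_density \<pi> z) * indicator A z
    \<le> ennreal c * ((\<Sum>k<N. G' (Z k z)) + E (Z N z))" for z
  proof (cases "z \<in> A")
    case True
    then have z: "fst z \<in> R" "fst (Z N z) \<in> V \<union> - R"
      and le: "\<And>k. k \<le> N \<Longrightarrow> ennreal (phase_density \<pi> z)
        \<le> ennreal c * (ennreal (gauss (snd (Z k z))) * inf_along \<pi> h (Z k z))"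
      by (auto simp: A_eq V'_def H_def)
    have "ennreal (phase_density \<pi> z) \<le> ennreal c * ((\<Sum>k<N. G' (Z k z)) + E (Z N z))"
    proof (cases "fst (Z N z) \<in> R")
      case True
      then have V': "fst (Z N z) \<in> V" using z(2) by blast
      \<comment> \<open>The condition in \<open>A\<close> includes \<open>k = N\<close>, and the
        time 0 in its infimum gives the density at the endpoint itself.\<close>
      have "inf_along \<pi> h (Z N z) \<le> ennreal (\<pi> (fst (Z N z)))"
        using inf_along_le[of 0 h \<pi> "fst (Z N z)" "snd (Z N z)"] h(1) by simp
      then have "ennreal (gauss (snd (Z N z))) * inf_along \<pi> h (Z N z)
          \<le> ennreal (gauss (snd (Z N z))) * ennreal (\<pi> (fst (Z N z)))"
        by (rule mult_left_mono) simp
      also have "\<dots> = E (Z N z)"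
        using V' by (simp add: E_def dens mult.commute)
      also have "\<dots> \<le> (\<Sum>k<N. G' (Z k z)) + E (Z N z)" by simp
      finally show ?thesis
        using le[of N] by (meson mult_left_mono order_refl order_trans zero_le)
    next
      case False
      obtain k where k: "k < N" "fst (Z k z) \<in> R" "fst (Z (Suc k) z) \<notin> R"
        by (rule last_before_exit[of "\<lambda>k. fst (Z k z)" R N]) (use z(1) False in \<open>auto simp: Z_def\<close>)
      have "ennreal (gauss (snd (Z k z))) * inf_along \<pi> h (Z k z) = G' (Z k z)"
        using k(2,3) unfolding fst_F by (simp add: G'_def G_def)
      also have "\<dots> \<le> (\<Sum>k<N. G' (Z k z))"
        using k(1) by (intro member_le_sum) auto
      also have "\<dots> \<le> (\<Sum>k<N. G' (Z k z)) + E (Z N z)" by simp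
      finally show ?thesis
        using le[of k] k(1) by (meson less_imp_le mult_left_mono order_trans zero_le)
    qed
    then show ?thesis using True by simp
  qed simp
  have "(\<integral>\<^sup>+z\<in>A. ennreal (phase_density \<pi> z) \<partial>?L)
      \<le> (\<integral>\<^sup>+z. ennreal c * ((\<Sum>k<N. G' (Z k z)) + E (Z N z)) \<partial>?L)"
    by (rule nn_integral_mono) (rule pointwise)
  also have "\<dots> = ennreal c * ((\<Sum>k<N. \<integral>\<^sup>+z. G' (Z k z) \<partial>?L) + (\<integral>\<^sup>+z. E (Z N z) \<partial>?L))"
    by (subst nn_integral_cmult, measurable, subst nn_integral_add, measurable, subst nn_integral_sum) measurable
  also have "\<dots> = ennreal c * (of_nat N * (\<integral>\<^sup>+z. G' z \<partial>?L) + (\<integral>\<^sup>+z. E z \<partial>?L))"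
    by (simp only: Fint \<open>G' \<in> borel_measurable ?L\<close> \<open>E \<in> borel_measurable ?L\<close> sum_constant card_lessThan)
  also have "\<dots> \<le> ennreal c * (of_nat N * (ennreal (h / 2) * ?I) + (\<integral>\<^sup>+x\<in>V. ennreal (\<pi> x) \<partial>lborel))"
    unfolding final using flux by (intro mult_left_mono add_right_mono) auto
  also have "of_nat N * (ennreal (h / 2) * ?I) = ennreal (T / 2) * ?I"
  proof -
    have "of_nat N * ennreal (h / 2) = ennreal (T / 2)"
      using h by (simp add: ennreal_of_nat_eq_real_of_nat ennreal_mult'[symmetric])
    then show ?thesis by (simp only: mult.assoc[symmetric])
  qed
  finally show "(\<integral>\<^sup>+z\<in>A. ennreal (phase_density \<pi> z) \<partial>?L)
    \<le> ennreal c * (ennreal (T / 2) * ?I + (\<integral>\<^sup>+x\<in>V. ennreal (\<pi> x) \<partial>lborel))" .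
qed

section \<open>The conductance bound\<close>

lemma emeasure_std_gaussian:
  assumes "B \<in> sets borel"
  shows "emeasure std_gaussian B = (\<integral>\<^sup>+p. ennreal (gauss (p :: real^'n::finite)) * indicator B p \<partial>lborel)"
proof -
  have eq: "(\<Prod>i\<in>UNIV. ennreal (std_normal_density (p $ i))) = ennreal (gauss p)" for p :: "real^'n"
    by (simp add: gauss_def prod_ennreal)
  have "emeasure std_gaussian B = (\<integral>\<^sup>+p. ennreal (gauss (p :: real^'n)) * indicator B p \<partial>lebesgue)"
    unfolding std_gaussian_def eq using assms by (intro emeasure_density measurable_completion) simp_all
  then show ?thesis by (simp only: nn_integral_completion)
qed

text \<open>Fatou's lemma for the sets \<open>A (Suc N)\<close>. Their limes inferior
  \<open>B\<close> contains every phase point with position in \<open>interior S\<close> whose exact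
  trajectory ends outside \<open>S\<close>. Since \<open>B\<close> is measurable, monotonicity
  bounds the kernel by the Gaussian measure of its sections.\<close>

lemma escape_bound:
  fixes \<pi> :: "real^'n::finite \<Rightarrow> real" and S :: "(real^'n) set"
  assumes \<pi>: "smooth_on UNIV \<pi>" "\<And>x. 0 \<le> \<pi> x" and T: "0 < T" and c: "1 < c"
    and M: "embedded_hypersurface (frontier S)" and V: "open V" "frontier S \<subseteq> V"
  shows "(\<integral>\<^sup>+x\<in>S. (hmc_kernel \<pi> T x (- S) * ennreal (\<pi> x)) \<partial>lebesgue)
    \<le> ennreal c * (ennreal (T / 2) * (\<integral>\<^sup>+y\<in>frontier S. ennreal (\<pi> y) \<partial>volume_measure (frontier S))
      + (\<integral>\<^sup>+x\<in>V. ennreal (\<pi> x) \<partial>lborel))" (is "_ \<le> ?bound")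
proof -
  \<comment> \<open>Unlike \<open>interior S\<close>, this set lies on at most one side of its frontier.\<close>
  define R where "R = interior (closure S)"
  let ?L = "lborel \<Otimes>\<^sub>M lborel :: ((real^'n) \<times> (real^'n)) measure"
  let ?F = "\<lambda>N. euler_step (score \<pi>) (T / real N)"
  define A where "A N = {z. fst z \<in> R \<and> fst ((?F N ^^ N) z) \<in> V \<union> - R \<and>
    (\<forall>k\<in>{..N}. ennreal (phase_density \<pi> z)
      \<le> ennreal c * (ennreal (gauss (snd ((?F N ^^ k) z))) * inf_along \<pi> (T / real N) ((?F N ^^ k) z)))}" for N
  have R: "open R" "interior (closure R) = R" "frontier R \<subseteq> frontier S"
  proof -
    show "open R" by (simp add: R_def)
    have cl: "closure R \<subseteq> closure S"
      unfolding R_def by (rule closure_minimal[OF interior_subset closed_closure])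
    show "interior (closure R) = R"
    proof
      from cl show "interior (closure R) \<subseteq> R"
        unfolding R_def by (rule interior_mono)
      show "R \<subseteq> interior (closure R)"
        by (rule interior_maximal[OF closure_subset \<open>open R\<close>])
    qed
    show "frontier R \<subseteq> frontier S"
      using cl interior_mono[OF closure_subset, of S] \<open>open R\<close>
      unfolding frontier_def interior_open[OF \<open>open R\<close>] by (auto simp: R_def)
  qed
  have c0: "0 < c" using c by simp
  have A: "A (Suc N) \<in> sets ?L"
    "(\<integral>\<^sup>+z\<in>A (Suc N). ennreal (phase_density \<pi> z) \<partial>?L) \<le> ?bound" for N
    unfolding A_def by (rule discrete_escape_bound[OF \<pi> T zero_less_Suc c0 M frontier_closed R V(1)])+
  \<comment> \<open>The index \<open>Suc N\<close> keeps the number of Euler steps positive.\<close>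
  define B where "B = {z \<in> space ?L. \<exists>n. \<forall>N\<in>{n..}. z \<in> A (Suc N)}"
  note A(1)[measurable]
  have B[measurable]: "B \<in> sets ?L"
    unfolding B_def by measurable
  have [measurable]: "\<pi> \<in> borel_measurable borel"
    by (rule borel_measurable_continuous_onI[OF smooth_on_UNIV_D(1)[OF \<pi>(1)]])
  have dens: "ennreal (phase_density \<pi> z) = ennreal (\<pi> (fst z)) * ennreal (gauss (snd z))" for z
    unfolding phase_density_def by (rule ennreal_mult'[OF \<pi>(2)])
  have \<rho>[measurable]: "(\<lambda>z. ennreal (phase_density \<pi> z)) \<in> borel_measurable ?L"
    unfolding dens by measurable
  have in_B: "(x, p) \<in> B"
    if x: "x \<in> interior S" and sol: "hamilton_solution \<pi> T P Q" "P 0 = p" "Q 0 = x" "Q T \<in> - S" for x p P Q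
  proof -
    let ?z = "\<lambda>N k. (?F N ^^ k) (x, p)"
    \<comment> \<open>A point outside \<open>S\<close> lies outside \<open>closure S\<close>, hence
      outside \<open>R\<close>, or on the frontier, which \<open>V\<close> covers. So
      \<open>?V\<close> is an open neighbourhood of the exact endpoint.\<close>
    let ?V = "V \<union> - closure S"
    have "Q T \<in> ?V"
      using sol(4) V(2) closure_Un_frontier[of S] by blast
    moreover have "open ?V" using V(1) by auto
    ultimately have "\<forall>\<^sub>F N in sequentially. fst (?z N N) \<in> ?V \<and> (\<forall>k\<le>N. \<forall>s\<in>{0..T / real N}.
      phase_density \<pi> (x, p) \<le> c * phase_density \<pi> (fst (?z N k) + s *\<^sub>R snd (?z N k), snd (?z N k)))"
      using euler_eventually_good[OF \<pi>(1) sol(1) T c, of ?V] unfolding sol(2,3) by blast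
    then have "\<forall>\<^sub>F N in sequentially. (x, p) \<in> A N"
    proof eventually_elim
      case (elim N)
      have "x \<in> R"
        unfolding R_def using x interior_mono[OF closure_subset] by blast
      moreover have "fst (?z N N) \<in> V \<union> - R"
        using elim interior_subset[of "closure S"] unfolding R_def by blast
      moreover have "ennreal (phase_density \<pi> (x, p))
          \<le> ennreal c * (ennreal (gauss (snd (?z N k))) * inf_along \<pi> (T / real N) (?z N k))" if k: "k \<in> {..N}" for k
      proof -
        let ?g = "gauss (snd (?z N k))"
        \<comment> \<open>A lower bound for \<open>\<pi>\<close> that is uniform along the drift and
          so passes to the infimum; multiplication by \<open>c\<close> and the Gaussian recovers the
          initial phase density.\<close>
        let ?X = "phase_density \<pi> (x, p) / (c * ?g)"
        have g: "0 < ?g" by (rule gauss_pos)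
        have X: "?X \<le> \<pi> (fst (?z N k) + s *\<^sub>R snd (?z N k))" if "s \<in> {0..T / real N}" for s
        proof -
          have "phase_density \<pi> (x, p) \<le> c * phase_density \<pi> (fst (?z N k) + s *\<^sub>R snd (?z N k), snd (?z N k))"
            using elim k that by blast
          then show ?thesis
            using c0 g by (simp add: phase_density_def pos_divide_le_eq mult_ac)
        qed
        have "ennreal ?X \<le> inf_along \<pi> (T / real N) (?z N k)"
          unfolding inf_along_def by (intro INF_greatest ennreal_leI X)
        then have "ennreal c * (ennreal ?g * ennreal ?X) \<le> ennreal c * (ennreal ?g * inf_along \<pi> (T / real N) (?z N k))"
          by (intro mult_left_mono) auto
        also have "ennreal c * (ennreal ?g * ennreal ?X) = ennreal (phase_density \<pi> (x, p))"
          using c0 g by (simp add: ennreal_mult'[symmetric])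
        finally show ?thesis .
      qed
      ultimately show ?case
        unfolding A_def by simp
    qed
    then have "\<forall>\<^sub>F N in sequentially. (x, p) \<in> A (Suc N)"
      by (subst eventually_sequentially_Suc)
    then show ?thesis
      unfolding B_def eventually_sequentially by (auto simp: space_pair_measure)
  qed
  have kernel: "hmc_kernel \<pi> T x (- S) * ennreal (\<pi> x)
      \<le> (\<integral>\<^sup>+p. ennreal (phase_density \<pi> (x, p)) * indicator B (x, p) \<partial>lborel)" if x: "x \<in> interior S" for x
  proof -
    let ?Bx = "Pair x -` B"
    have "?Bx \<in> sets lborel" by (rule sets_Pair1[OF B])
    then have Bx: "?Bx \<in> sets borel" by simp
    have "hmc_kernel \<pi> T x (- S) \<le> emeasure std_gaussian ?Bx"
      unfolding hmc_kernel_def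
    proof (rule emeasure_mono)
      show "{p. \<exists>P Q. hamilton_solution \<pi> T P Q \<and> P 0 = p \<and> Q 0 = x \<and> Q T \<in> - S} \<subseteq> ?Bx"
        using in_B[OF x] by blast
      show "?Bx \<in> sets std_gaussian"
        using Bx by (simp add: std_gaussian_def)
    qed
    also have "\<dots> = (\<integral>\<^sup>+p. ennreal (gauss p) * indicator ?Bx p \<partial>lborel)"
      by (rule emeasure_std_gaussian[OF Bx])
    finally have "ennreal (\<pi> x) * hmc_kernel \<pi> T x (- S) \<le> ennreal (\<pi> x) * (\<integral>\<^sup>+p. ennreal (gauss p) * indicator ?Bx p \<partial>lborel)"
      by (rule mult_left_mono) simp
    also have "\<dots> = (\<integral>\<^sup>+p. ennreal (\<pi> x) * (ennreal (gauss p) * indicator ?Bx p) \<partial>lborel)"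
      using Bx by (intro nn_integral_cmult[symmetric]) simp
    also have "\<dots> = (\<integral>\<^sup>+p. ennreal (phase_density \<pi> (x, p)) * indicator B (x, p) \<partial>lborel)"
      unfolding dens by (intro nn_integral_cong) (simp add: mult.assoc indicator_def)
    finally show ?thesis by (simp only: mult.commute)
  qed
  \<comment> \<open>Off the null set \<open>frontier S\<close>, membership in \<open>S\<close> means
    membership in \<open>interior S\<close>, where \<open>kernel\<close> applies.\<close>
  have "AE x in lebesgue. x \<notin> frontier S"
    using negligible_embedded_hypersurface[OF M] by (intro AE_not_in) (simp add: negligible_iff_null_sets)
  then have "AE x in lebesgue. hmc_kernel \<pi> T x (- S) * ennreal (\<pi> x) * indicator S x
      \<le> (\<integral>\<^sup>+p. ennreal (phase_density \<pi> (x, p)) * indicator B (x, p) \<partial>lborel)"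
  proof eventually_elim
    case (elim x)
    then show ?case
      using kernel[of x] closure_subset[of S] by (cases "x \<in> S") (auto simp: frontier_def)
  qed
  then have "(\<integral>\<^sup>+x\<in>S. (hmc_kernel \<pi> T x (- S) * ennreal (\<pi> x)) \<partial>lebesgue)
      \<le> (\<integral>\<^sup>+x. \<integral>\<^sup>+p. ennreal (phase_density \<pi> (x, p)) * indicator B (x, p) \<partial>lborel \<partial>lebesgue)"
    by (rule nn_integral_mono_AE)
  also have "\<dots> = (\<integral>\<^sup>+x. \<integral>\<^sup>+p. ennreal (phase_density \<pi> (x, p)) * indicator B (x, p) \<partial>lborel \<partial>lborel)"
    by (rule nn_integral_completion)
  also have "\<dots> = (\<integral>\<^sup>+z. ennreal (phase_density \<pi> z) * indicator B z \<partial>?L)"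
    by (rule lborel.nn_integral_fst) measurable
  also have "\<dots> \<le> (\<integral>\<^sup>+z. liminf (\<lambda>N. ennreal (phase_density \<pi> z) * indicator (A (Suc N)) z) \<partial>?L)"
  proof (rule nn_integral_mono)
    fix z
    show "ennreal (phase_density \<pi> z) * indicator B z
      \<le> liminf (\<lambda>N. ennreal (phase_density \<pi> z) * indicator (A (Suc N)) z)"
    proof (cases "z \<in> B")
      case True
      then have "\<forall>\<^sub>F N in sequentially. z \<in> A (Suc N)"
        unfolding B_def eventually_sequentially by auto
      then have "\<forall>\<^sub>F N in sequentially. ennreal (phase_density \<pi> z) * indicator B z
          \<le> ennreal (phase_density \<pi> z) * indicator (A (Suc N)) z"
        by eventually_elim (simp add: True)
      then show ?thesis by (rule Liminf_bounded)
    qed simp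
  qed
  also have "\<dots> \<le> liminf (\<lambda>N. \<integral>\<^sup>+z\<in>A (Suc N). ennreal (phase_density \<pi> z) \<partial>?L)"
    by (rule nn_integral_liminf) measurable
  also have "\<dots> \<le> limsup (\<lambda>N. \<integral>\<^sup>+z\<in>A (Suc N). ennreal (phase_density \<pi> z) \<partial>?L)"
    by (rule Liminf_le_Limsup) simp
  also have "\<dots> \<le> ?bound"
    by (rule Limsup_bounded) (simp add: A(2))
  finally show ?thesis .
qed

text \<open>The density defines a finite Borel measure, which is outer regular and vanishes on the
  null set \<open>M\<close>.\<close>

lemma open_neighbourhood_small_mass:
  fixes \<pi> :: "'a::euclidean_space \<Rightarrow> real"
  assumes [measurable]: "\<pi> \<in> borel_measurable borel" and fin: "(\<integral>\<^sup>+x. ennreal (\<pi> x) \<partial>lborel) \<noteq> \<infinity>"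
    and M: "closed M" "negligible M" and e: "0 < e"
  obtains V where "open V" "M \<subseteq> V" "(\<integral>\<^sup>+x\<in>V. ennreal (\<pi> x) \<partial>lborel) < e"
proof -
  let ?\<mu> = "density lborel (\<lambda>x. ennreal (\<pi> x))"
  have Mb: "M \<in> sets borel" using M(1) by simp
  have "M \<in> null_sets lborel"
    using M by (simp add: negligible_iff_null_sets null_sets_completion_iff)
  then have "emeasure ?\<mu> M = 0"
    using absolutely_continuousI_density[of "\<lambda>x. ennreal (\<pi> x)" lborel] by (auto simp: absolutely_continuous_def null_sets_def)
  moreover have "emeasure ?\<mu> M = (INF U\<in>{U. M \<subseteq> U \<and> open U}. emeasure ?\<mu> U)"
    using fin Mb by (intro outer_regular) (simp_all add: emeasure_density)
  ultimately have "(INF U\<in>{U. M \<subseteq> U \<and> open U}. emeasure ?\<mu> U) < e"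
    using e by simp
  then obtain V where V: "M \<subseteq> V" "open V" "emeasure ?\<mu> V < e"
    unfolding INF_less_iff by blast
  moreover have "emeasure ?\<mu> V = (\<integral>\<^sup>+x\<in>V. ennreal (\<pi> x) \<partial>lborel)"
    using V(2) by (simp add: emeasure_density)
  ultimately show thesis using that by simp
qed

theorem corollary2:
  fixes \<pi> :: "real^'n::finite \<Rightarrow> real" and T :: real and S :: "(real^'n) set"
  assumes "0 < T"
    and "smooth_probability_density \<pi>"
    and "embedded_hypersurface (frontier S)"
    and "locally_well_behaved S"
  shows "conductance \<pi> (hmc_kernel \<pi> T) S
    \<le> ennreal (1 / 2 * T) *
        ((\<integral>\<^sup>+q\<in>frontier S. ennreal (\<pi> q) \<partial>volume_measure (frontier S)) / density_mass \<pi> S)"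
proof -
  have \<pi>: "smooth_on UNIV \<pi>" "\<And>x. 0 \<le> \<pi> x" "(\<integral>\<^sup>+x. ennreal (\<pi> x) \<partial>lborel) = 1"
    using assms(2) by (simp_all add: smooth_probability_density_def nn_integral_completion)
  let ?N = "\<integral>\<^sup>+x\<in>S. (hmc_kernel \<pi> T x (- S) * ennreal (\<pi> x)) \<partial>lebesgue"
  let ?I = "\<integral>\<^sup>+q\<in>frontier S. ennreal (\<pi> q) \<partial>volume_measure (frontier S)"
  \<comment> \<open>One parameter controls both losses: the factor \<open>c = 1 + \<epsilon>\<close>
    and the mass of the neighbourhood \<open>V\<close>.\<close>
  have bound: "?N \<le> ennreal (1 + \<epsilon>) * (ennreal (T / 2) * ?I + ennreal \<epsilon>)" if \<epsilon>: "0 < \<epsilon>" for \<epsilon>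
  proof -
    have "\<pi> \<in> borel_measurable borel"
      by (rule borel_measurable_continuous_onI[OF smooth_on_UNIV_D(1)[OF \<pi>(1)]])
    then obtain V where V: "open V" "frontier S \<subseteq> V" "(\<integral>\<^sup>+x\<in>V. ennreal (\<pi> x) \<partial>lborel) < ennreal \<epsilon>"
      using open_neighbourhood_small_mass[of \<pi> "frontier S" "ennreal \<epsilon>"] \<epsilon> \<pi>(3)
        negligible_embedded_hypersurface[OF assms(3)] frontier_closed by auto
    have "?N \<le> ennreal (1 + \<epsilon>) * (ennreal (T / 2) * ?I + (\<integral>\<^sup>+x\<in>V. ennreal (\<pi> x) \<partial>lborel))"
      using \<epsilon> by (intro escape_bound[OF \<pi>(1,2) assms(1) _ assms(3) V(1,2)]) simp
    also have "\<dots> \<le> ennreal (1 + \<epsilon>) * (ennreal (T / 2) * ?I + ennreal \<epsilon>)"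
      using V(3) by (intro mult_left_mono add_left_mono) auto
    finally show ?thesis .
  qed
  have "?N \<le> ennreal (T / 2) * ?I"
  proof (cases "ennreal (T / 2) * ?I")
    case (real j)
    show ?thesis
    proof (rule ennreal_le_epsilon)
      fix e :: real assume e: "0 < e"
      \<comment> \<open>For \<open>\<epsilon> \<le> 1\<close> the product
        \<open>(1 + \<epsilon>) * (j + \<epsilon>)\<close> is at most
        \<open>j + \<epsilon> * (j + 2)\<close>, and the choice makes the excess at most
        \<open>e\<close>.\<close>
      define \<epsilon> where "\<epsilon> = min 1 (e / (j + 2))"
      have \<epsilon>: "0 < \<epsilon>" "\<epsilon> \<le> 1" "\<epsilon> * (j + 2) \<le> e"
      proof -
        show "0 < \<epsilon>" "\<epsilon> \<le> 1" using e real(1) by (auto simp: \<epsilon>_def)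
        have "\<epsilon> * (j + 2) \<le> e / (j + 2) * (j + 2)"
          using real(1) by (intro mult_right_mono) (auto simp: \<epsilon>_def)
        then show "\<epsilon> * (j + 2) \<le> e" using real(1) by simp
      qed
      have "?N \<le> ennreal ((1 + \<epsilon>) * (j + \<epsilon>))"
        using bound[OF \<epsilon>(1)] \<epsilon> real by (simp add: ennreal_mult' ennreal_plus)
      also have "(1 + \<epsilon>) * (j + \<epsilon>) \<le> j + \<epsilon> * (j + 2)"
        using \<epsilon>(1,2) by (simp add: algebra_simps mult_left_le)
      then have "ennreal ((1 + \<epsilon>) * (j + \<epsilon>)) \<le> ennreal (j + e)"
        using \<epsilon>(3) by (intro ennreal_leI) linarith
      also have "\<dots> = ennreal (T / 2) * ?I + ennreal e"
        using real e by simp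
      finally show "?N \<le> ennreal (T / 2) * ?I + ennreal e" .
    qed
  qed simp
  then have "?N / density_mass \<pi> S \<le> ennreal (T / 2) * ?I / density_mass \<pi> S"
    by (rule divide_right_mono_ennreal)
  then show ?thesis
    unfolding conductance_def by (simp add: ennreal_times_divide)
qed

end
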